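(* Let $\mathbf{G}=\{G_i : i\geq 1\}$ be a standard centered i.i.d. Gaussian sequence, and fix integers $m\geq 1$ and $d_1,\ldots,d_m\geq 2$. For every $j=1,\ldots,m$, let $\{(N^{(j)}_n, f^{(j)}_n) : n\geq 1\}$ be a sequence such that $\{N^{(j)}_n : n\geq 1\}$ is a sequence of integers going to infinity, and each function $f_n^{(j)}: [N_n^{(j)}]^{d_j} \rightarrow\mathbb{R}$ is symmetric and vanishes on diagonals. Assume that, for every $j$, the sequence $E[Q_{d_j}(N_n^{(j)},f^{(j)}_n, \mathbf{G})^2]$, $n\geq 1$, is bounded. Let $V$ be an $m\times m$ nonnegative symmetric matrix whose diagonal elements are different from zero. Suppose, moreover, that for every $i,j=1,\ldots,m$, as $n\to\infty$, $$E\bigl[Q_{d_i}(N_n^{(i)},f^{(i)}_n, \mathbf{G})\times Q_{d_j}(N_n^{(j)},f^{(j)}_n, \mathbf{G})\bigr] \rightarrow V(i,j).$$ Then the following three conditions are equivalent, as $n\rightarrow\infty$: (1) the vector $\{Q_{d_j}(N_n^{(j)},f^{(j)}_n, \mathbf{G}) : j=1,\ldots,m\}$ converges in law to a centered Gaussian vector with covariance matrix $V$; (2) for every $j=1,\ldots,m$, $E[Q_{d_j}(N_n^{(j)},f^{(j)}_n,\mathbf{G})^4] \rightarrow 3V(j,j)^2$; (3) for every $j=1,\ldots,m$ and every $r=1,\ldots,d_j-1$, $\|f_n^{(j)}\star_r f_n^{(j)}\|_{2d_j-2r} \rightarrow 0$.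
   Context: Notation: $[N]=\{1,\ldots,N\}$. A symmetric function $f:[N]^d\to\mathbb{R}$ vanishes on diagonals if $f(i_1,\ldots,i_d)=0$ whenever $i_k=i_j$ for some $k\neq j$. The homogeneous sum of order $d$ is $$Q_d(N,f,\mathbf{G})=\sum_{1\leq i_1,\ldots,i_d\leq N} f(i_1,\ldots,i_d)G_{i_1}\cdots G_{i_d}.$$ "Nonnegative symmetric matrix" means symmetric positive semidefinite. For $r=0,\ldots,d$ the contraction $f\star_r f:[N]^{2d-2r}\to\mathbb{R}$ is $$f\star_r f(j_1,\ldots,j_{2d-2r})=\sum_{1\leq a_1,\ldots,a_r\leq N} f(a_1,\ldots,a_r,j_1,\ldots,j_{d-r})f(a_1,\ldots,a_r,j_{d-r+1},\ldots,j_{2d-2r}),$$ and for $g:[N]^p\to\mathbb{R}$, $\|g\|_p=\bigl(\sum_{1\leq i_1,\ldots,i_p\leq N} g(i_1,\ldots,i_p)^2\bigr)^{1/2}$. *)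

theory Defs
  imports "HOL-Probability.Probability" "HOL-Combinatorics.Permutations"
begin

text \<open>
  A function on \<open>[N]\<^sup>d\<close> is represented by a function on lists, of which only the values at
  the lists in \<open>tuples N d\<close> matter. Tuple positions are numbered from 0, entries from 1.
\<close>

definition tuples :: "nat \<Rightarrow> nat \<Rightarrow> nat list set" where
  "tuples N d = {xs. set xs \<subseteq> {1..N} \<and> length xs = d}"

definition symmetric_on_tuples :: "nat \<Rightarrow> nat \<Rightarrow> (nat list \<Rightarrow> real) \<Rightarrow> bool" where
  "symmetric_on_tuples N d f \<longleftrightarrow>
     (\<forall>xs\<in>tuples N d. \<forall>p. p permutes {..<d} \<longrightarrow> f (permute_list p xs) = f xs)"

definition vanishes_on_diagonals :: "nat \<Rightarrow> nat \<Rightarrow> (nat list \<Rightarrow> real) \<Rightarrow> bool" where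
  "vanishes_on_diagonals N d f \<longleftrightarrow>
     (\<forall>xs\<in>tuples N d. (\<exists>k<d. \<exists>j<d. k \<noteq> j \<and> xs ! k = xs ! j) \<longrightarrow> f xs = 0)"

definition homogeneous_sum ::
    "nat \<Rightarrow> nat \<Rightarrow> (nat list \<Rightarrow> real) \<Rightarrow> (nat \<Rightarrow> 'a \<Rightarrow> real) \<Rightarrow> 'a \<Rightarrow> real" where
  "homogeneous_sum d N f G \<omega> = (\<Sum>xs\<in>tuples N d. f xs * (\<Prod>k<d. G (xs ! k) \<omega>))"

definition contraction ::
    "nat \<Rightarrow> nat \<Rightarrow> nat \<Rightarrow> (nat list \<Rightarrow> real) \<Rightarrow> nat list \<Rightarrow> real" where
  "contraction d N r f js =
     (\<Sum>as\<in>tuples N r. f (as @ take (d - r) js) * f (as @ drop (d - r) js))"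

definition tuple_norm :: "nat \<Rightarrow> nat \<Rightarrow> (nat list \<Rightarrow> real) \<Rightarrow> real" where
  "tuple_norm p N g = L2_set g (tuples N p)"

definition nonneg_symmetric :: "real ^ 'm ^ 'm \<Rightarrow> bool" where
  "nonneg_symmetric V \<longleftrightarrow> transpose V = V \<and> (\<forall>x. 0 \<le> x \<bullet> (V *v x))"

text \<open>Laws on the real line; a point mass counts as a Gaussian law of variance zero.\<close>

definition gaussian_law_real :: "real measure \<Rightarrow> bool" where
  "gaussian_law_real \<nu> \<longleftrightarrow>
     (\<exists>c. \<nu> = return borel c) \<or>
     (\<exists>c \<sigma>. \<sigma> > 0 \<and> \<nu> = density lborel (\<lambda>x. ennreal (normal_density c \<sigma> x)))"

text \<open>
  A law on \<open>\<real>\<^sup>m\<close> is Gaussian if all its one-dimensional linear images are. This covers singular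
  covariance matrices, for which there is no density. As the mean is required to vanish,
  the covariances are the second moments.
\<close>

definition centered_gaussian_law ::
    "real ^ 'm ^ 'm \<Rightarrow> (real ^ 'm) measure \<Rightarrow> bool" where
  "centered_gaussian_law V \<mu> \<longleftrightarrow>
     prob_space \<mu> \<and> sets \<mu> = sets borel \<and>
     (\<forall>a. gaussian_law_real (distr \<mu> borel (\<lambda>x. a \<bullet> x))) \<and>
     (\<forall>i. (\<integral>x. x $ i \<partial>\<mu>) = 0) \<and>
     (\<forall>i j. (\<integral>x. x $ i * x $ j \<partial>\<mu>) = V $ i $ j)"

text \<open>
  The library's \<open>weak_conv_m\<close> is formulated with distribution functions and only covers
  laws on the real line.
\<close>

definition converges_in_law ::
    "'a measure \<Rightarrow> (nat \<Rightarrow> 'a \<Rightarrow> 'b::topological_space) \<Rightarrow> 'b measure \<Rightarrow> bool" where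
  "converges_in_law M X \<mu> \<longleftrightarrow>
     (\<forall>h :: 'b \<Rightarrow> real. continuous_on UNIV h \<and> bounded (range h) \<longrightarrow>
        (\<lambda>n. \<integral>\<omega>. h (X n \<omega>) \<partial>M) \<longlonglongrightarrow> (\<integral>x. h x \<partial>\<mu>))"

end

theory Submission
  imports Defs "HOL-Combinatorics.Multiset_Permutations"
begin

text \<open>
  Grouping the tuples with the same entries turns a homogeneous sum of order \<open>d\<close> into a multilinear
  polynomial \<open>F = \<Sum>\<^sub>A c(A) \<Prod>\<^sub>i\<^sub>\<in>\<^sub>A x\<^sub>i\<close> in independent standard Gaussian variables, where \<open>A\<close> runs over
  the sets with \<open>d\<close> elements and \<open>c(A)\<close> is \<open>d!\<close> times the value of \<open>f\<close> at an enumeration of \<open>A\<close>.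
  A product \<open>F\<^sub>c F\<^sub>e\<close> of two such polynomials is expanded in products of Hermite polynomials by writing
  \<open>x\<^sup>2 = (x\<^sup>2 - 1) + 1\<close> for each variable that occurs in both factors. Choosing the term \<open>1\<close> on a set \<open>C\<close>
  with \<open>r\<close> elements produces the contraction kernel \<open>\<Sum>\<^sub>C c(C \<union> A) e(C \<union> B)\<close>, so that
  \<open>F\<^sub>c F\<^sub>e = \<Sum>\<^sub>r W\<^sub>r\<close> (\<open>multilin_mult\<close>). The \<open>W\<^sub>r\<close> have different total degrees and are therefore
  orthogonal.

  Fourth moments control contractions. In \<open>E F\<^sup>4 = \<Sum>\<^sub>r E W\<^sub>r\<^sup>2\<close> the term \<open>W\<^sub>d\<close> is the constant \<open>E F\<^sup>2\<close>,
  and \<open>E W\<^sub>0\<^sup>2\<close> is exactly the sum of the squared norms of all the contractions of \<open>c\<close> with itself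
  (\<open>wick_square_norm\<close>), those for \<open>r = 0\<close> and \<open>r = d\<close> being \<open>(E F\<^sup>2)\<^sup>2\<close>. Hence
  \<open>E F\<^sup>4 - 3 (E F\<^sup>2)\<^sup>2\<close> dominates the squared norms for \<open>0 < r < d\<close> (\<open>fourth_moment_lower_bound\<close>).

  Contractions control the law. The gradients satisfy \<open>\<langle>\<nabla>F\<^sub>c, \<nabla>F\<^sub>e\<rangle> = \<Sum>\<^sub>r r W\<^sub>r\<close>, so the variance of
  this random variable is small as soon as the mixed contractions are, and these are dominated by
  the contractions of \<open>c\<close> and of \<open>e\<close> (\<open>sqnorm_contr_mixed_le\<close>, \<open>carre_du_champ_variance\<close>). For a
  linear combination \<open>F\<close> of the polynomials, Euler's identity and Gaussian integration by parts give
  \<open>\<phi>'(t) = - t E[\<Gamma> exp (\<i> t F)]\<close> for the characteristic function \<open>\<phi>\<close> of \<open>F\<close>, where \<open>\<Gamma>\<close> combines the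
  gradient products. If \<open>\<Gamma>\<close> is close to a constant \<open>\<sigma>\<^sup>2\<close>, this is nearly the equation of
  \<open>exp (- \<sigma>\<^sup>2 t\<^sup>2 / 2)\<close> (\<open>char_function_gaussian_bound\<close>). Characteristic functions of all linear
  combinations determine convergence in law, as bounded continuous functions can be
  approximated by trigonometric polynomials on large cubes (\<open>converges_in_law_of_char\<close>). The limit
  law is that of a vector of linear forms in independent Gaussians whose coefficient vectors have
  Gram matrix \<open>V\<close> (\<open>centered_gaussian_law_exists\<close>).

  The law controls fourth moments. By hypercontractivity the sixth moment of \<open>F\<close> is bounded by a
  constant times the cube of its second moment (\<open>sixth_moment_bound\<close>), so the fourth powers are
  uniformly integrable and their expectations converge along with the laws
  (\<open>fourth_moment_convergence\<close>).
\<close>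

section \<open>Multilinear polynomials and the product formula\<close>

definition multilin :: "nat set \<Rightarrow> (nat set \<Rightarrow> real) \<Rightarrow> (nat \<Rightarrow> real) \<Rightarrow> real" where
  "multilin I c x = (\<Sum>A\<in>Pow I. c A * (\<Prod>i\<in>A. x i))"

definition homogeneous :: "nat \<Rightarrow> (nat set \<Rightarrow> real) \<Rightarrow> bool" where
  "homogeneous d c \<longleftrightarrow> (\<forall>A. c A \<noteq> 0 \<longrightarrow> card A = d)"

definition inner_coeff :: "nat set \<Rightarrow> (nat set \<Rightarrow> real) \<Rightarrow> (nat set \<Rightarrow> real) \<Rightarrow> real" where
  "inner_coeff I c e = (\<Sum>A\<in>Pow I. c A * e A)"

text \<open>
  This is the set version of the contraction of order \<open>r\<close>; the restriction to \<open>C\<close> disjoint from \<open>A\<close>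
  and \<open>B\<close> reflects that the functions on tuples vanish on diagonals.
\<close>
definition contr :: "nat set \<Rightarrow> nat \<Rightarrow> (nat set \<Rightarrow> real) \<Rightarrow> (nat set \<Rightarrow> real) \<Rightarrow> nat set \<Rightarrow> nat set \<Rightarrow> real" where
  "contr I r c e A B = (\<Sum>C | C \<subseteq> I \<and> card C = r \<and> C \<inter> A = {} \<and> C \<inter> B = {}. c (C \<union> A) * e (C \<union> B))"

definition sqnorm :: "nat set \<Rightarrow> (nat set \<Rightarrow> nat set \<Rightarrow> real) \<Rightarrow> real" where
  "sqnorm I K = (\<Sum>A\<in>Pow I. \<Sum>B\<in>Pow I. (K A B)\<^sup>2)"

text \<open>
  The product of Hermite polynomials \<open>\<Prod>\<^sub>i H\<^sub>n\<^sub>(\<^sub>i\<^sub>)(x\<^sub>i)\<close> whose multi-index \<open>n(i) \<in> {0, 1, 2}\<close> counts how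
  many of the sets \<open>A\<close> and \<open>B\<close> contain \<open>i\<close>. Different pairs can give the same polynomial.
\<close>
definition wick :: "nat set \<Rightarrow> nat set \<Rightarrow> nat set \<Rightarrow> (nat \<Rightarrow> real) \<Rightarrow> real" where
  "wick I A B x = (\<Prod>i\<in>I. if i \<in> A \<inter> B then (x i)\<^sup>2 - 1 else if i \<in> A \<union> B then x i else 1)"

definition wick_sum :: "nat set \<Rightarrow> (nat set \<Rightarrow> nat set \<Rightarrow> real) \<Rightarrow> (nat \<Rightarrow> real) \<Rightarrow> real" where
  "wick_sum I K x = (\<Sum>A\<in>Pow I. \<Sum>B\<in>Pow I. K A B * wick I A B x)"

definition deriv_coeff :: "nat \<Rightarrow> (nat set \<Rightarrow> real) \<Rightarrow> nat set \<Rightarrow> real" where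
  "deriv_coeff i c A = (if i \<in> A then 0 else c (insert i A))"

text \<open>
  The gradient product \<open>\<langle>\<nabla>F\<^sub>c, \<nabla>F\<^sub>e\<rangle>\<close>.
\<close>
definition carre_du_champ :: "nat set \<Rightarrow> (nat set \<Rightarrow> real) \<Rightarrow> (nat set \<Rightarrow> real) \<Rightarrow> (nat \<Rightarrow> real) \<Rightarrow> real" where
  "carre_du_champ I c e x = (\<Sum>i\<in>I. multilin I (deriv_coeff i c) x * multilin I (deriv_coeff i e) x)"

lemma contr_of_bool:
  assumes "finite I"
  shows "contr I r c e A B =
    (\<Sum>C\<in>Pow I. of_bool (card C = r \<and> C \<inter> A = {} \<and> C \<inter> B = {}) * (c (C \<union> A) * e (C \<union> B)))"
  unfolding contr_def using assms by (intro sum.mono_neutral_cong_left) auto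

text \<open>
  Sorting subsets by cardinality is how the order \<open>r\<close> of a contraction enters.
\<close>
lemma sum_of_bool_card:
  fixes g :: "nat set \<Rightarrow> real"
  assumes "finite I"
  shows "(\<Sum>C\<in>Pow I. g C) = (\<Sum>r\<le>card I. \<Sum>C\<in>Pow I. of_bool (card C = r) * g C)"
proof -
  have "(\<Sum>r\<le>card I. \<Sum>C\<in>Pow I. of_bool (card C = r) * g C)
      = (\<Sum>C\<in>Pow I. \<Sum>r\<le>card I. of_bool (card C = r) * g C)" by (rule sum.swap)
  also have "\<dots> = (\<Sum>C\<in>Pow I. g C)"
  proof (intro sum.cong refl)
    fix C assume "C \<in> Pow I"
    then have "card C \<le> card I" using assms by (auto intro: card_mono)
    then show "(\<Sum>r\<le>card I. of_bool (card C = r) * g C) = g C"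
      by (simp add: of_bool_def if_distrib[of "\<lambda>x. x * _"] sum.delta cong: if_cong)
  qed
  finally show ?thesis by simp
qed

lemma sum_swap_pairs:
  "(\<Sum>a\<in>A. \<Sum>b\<in>B. \<Sum>c\<in>C. \<Sum>d\<in>D. f a b c d) = (\<Sum>c\<in>C. \<Sum>d\<in>D. \<Sum>a\<in>A. \<Sum>b\<in>B. f a b c d)"
proof -
  have "(\<Sum>a\<in>A. \<Sum>b\<in>B. \<Sum>c\<in>C. \<Sum>d\<in>D. f a b c d) = (\<Sum>a\<in>A. \<Sum>c\<in>C. \<Sum>b\<in>B. \<Sum>d\<in>D. f a b c d)"
    by (rule sum.cong[OF refl], rule sum.swap)
  also have "\<dots> = (\<Sum>c\<in>C. \<Sum>a\<in>A. \<Sum>b\<in>B. \<Sum>d\<in>D. f a b c d)"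
    by (rule sum.swap)
  also have "\<dots> = (\<Sum>c\<in>C. \<Sum>a\<in>A. \<Sum>d\<in>D. \<Sum>b\<in>B. f a b c d)"
    by (rule sum.cong[OF refl], rule sum.cong[OF refl], rule sum.swap)
  also have "\<dots> = (\<Sum>c\<in>C. \<Sum>d\<in>D. \<Sum>a\<in>A. \<Sum>b\<in>B. f a b c d)"
    by (rule sum.cong[OF refl], rule sum.swap)
  finally show ?thesis .
qed

text \<open>
  On \<open>A \<inter> B\<close> the variables are squared. Expanding \<open>\<Prod> (1 + (x\<^sub>i\<^sup>2 - 1))\<close> over \<open>A \<inter> B\<close>, the set
  \<open>C\<close> collects the variables for which \<open>1\<close> is chosen.
\<close>
lemma prod_monomials:
  assumes I: "finite I" and A: "A \<subseteq> I" and B: "B \<subseteq> I"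
  shows "(\<Prod>i\<in>A. x i) * (\<Prod>i\<in>B. x i) = (\<Sum>C\<in>Pow (A \<inter> B). wick I (A - C) (B - C) x)"
proof -
  let ?m = "\<lambda>i. (if i \<in> A then x i else 1) * (if i \<in> B then x i else 1)"
  let ?h = "\<lambda>i. if i \<in> A \<union> B then x i else 1"
  have 1: "(\<Prod>i\<in>A. x i) = (\<Prod>i\<in>I. if i \<in> A then x i else 1)"
    using I A by (subst prod.mono_neutral_cong_left[of I A _ x]) auto
  have 2: "(\<Prod>i\<in>B. x i) = (\<Prod>i\<in>I. if i \<in> B then x i else 1)"
    using I B by (subst prod.mono_neutral_cong_left[of I B _ x]) auto
  have "(\<Prod>i\<in>A. x i) * (\<Prod>i\<in>B. x i) = (\<Prod>i\<in>I. ?m i)"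
    unfolding 1 2 by (simp add: prod.distrib)
  also have "\<dots> = (\<Prod>i\<in>A \<inter> B. ?m i) * (\<Prod>i\<in>I - A \<inter> B. ?m i)"
    using I A by (subst mult.commute, intro prod.subset_diff) auto
  also have "(\<Prod>i\<in>A \<inter> B. ?m i) = (\<Prod>i\<in>A \<inter> B. 1 + ((x i)\<^sup>2 - 1))"
    by (intro prod.cong) (auto simp: power2_eq_square)
  also have "\<dots> = (\<Sum>C\<in>Pow (A \<inter> B). (\<Prod>i\<in>C. 1) * (\<Prod>i\<in>A \<inter> B - C. (x i)\<^sup>2 - 1))"
    using I A by (intro prod_add) (auto intro: finite_subset)
  also have "(\<Prod>i\<in>I - A \<inter> B. ?m i) = (\<Prod>i\<in>I - A \<inter> B. ?h i)"
    by (intro prod.cong) auto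
  also have "(\<Sum>C\<in>Pow (A \<inter> B). (\<Prod>i\<in>C. 1) * (\<Prod>i\<in>A \<inter> B - C. (x i)\<^sup>2 - 1)) * (\<Prod>i\<in>I - A \<inter> B. ?h i)
    = (\<Sum>C\<in>Pow (A \<inter> B). wick I (A - C) (B - C) x)"
    unfolding sum_distrib_right
  proof (intro sum.cong refl)
    fix C assume C: "C \<in> Pow (A \<inter> B)"
    let ?w = "\<lambda>i. if i \<in> (A - C) \<inter> (B - C) then (x i)\<^sup>2 - 1 else if i \<in> (A - C) \<union> (B - C) then x i else 1"
    have "wick I (A - C) (B - C) x = (\<Prod>i\<in>A \<inter> B. ?w i) * (\<Prod>i\<in>I - A \<inter> B. ?w i)"
      unfolding wick_def using I A by (subst mult.commute, intro prod.subset_diff) auto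
    also have "(\<Prod>i\<in>I - A \<inter> B. ?w i) = (\<Prod>i\<in>I - A \<inter> B. ?h i)"
      using C by (intro prod.cong) auto
    also have "(\<Prod>i\<in>A \<inter> B. ?w i) = (\<Prod>i\<in>A \<inter> B - C. (x i)\<^sup>2 - 1)"
      using C I A by (intro prod.mono_neutral_cong_right) (auto intro: finite_subset)
    finally show "(\<Prod>i\<in>C. 1) * (\<Prod>i\<in>A \<inter> B - C. (x i)\<^sup>2 - 1) * (\<Prod>i\<in>I - A \<inter> B. ?h i)
        = wick I (A - C) (B - C) x" by simp
  qed
  finally show ?thesis .
qed

text \<open>
  The product formula. In \<open>prod_monomials\<close> the pair \<open>(A, B)\<close> and the set \<open>C \<subseteq> A \<inter> B\<close> are
  traded for \<open>C\<close> and the disjoint remainders \<open>A - C\<close>, \<open>B - C\<close>.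
\<close>
lemma multilin_mult:
  assumes I: "finite I"
  shows "multilin I c x * multilin I e x = (\<Sum>r\<le>card I. wick_sum I (contr I r c e) x)"
proof -
  let ?b = "\<lambda>C A B. of_bool (C \<inter> A = {} \<and> C \<inter> B = {}) * (c (C \<union> A) * e (C \<union> B)) :: real"
  have d1: "C \<union> A - C = A" if "C \<inter> A = {}" for C A :: "nat set" using that by blast
  have d2: "C \<union> A = A" if "C \<subseteq> A" for C A :: "nat set" using that by blast
  have fin: "finite (Pow (fst p \<inter> snd p))" if "p \<in> Pow I \<times> Pow I" for p :: "nat set \<times> nat set"
  proof -
    have "fst p \<subseteq> I" using that by auto
    then have "Pow (fst p \<inter> snd p) \<subseteq> Pow I" by blast
    then show ?thesis using I finite_subset[of _ "Pow I"] by simp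
  qed
  have "multilin I c x * multilin I e x
    = (\<Sum>A\<in>Pow I. \<Sum>B\<in>Pow I. c A * e B * ((\<Prod>i\<in>A. x i) * (\<Prod>i\<in>B. x i)))"
    unfolding multilin_def sum_product by (simp add: mult_ac)
  also have "\<dots> = (\<Sum>A\<in>Pow I. \<Sum>B\<in>Pow I. \<Sum>C\<in>Pow (A \<inter> B). c A * e B * wick I (A - C) (B - C) x)"
    using I by (intro sum.cong refl) (simp add: prod_monomials sum_distrib_left)
  also have "\<dots> = (\<Sum>((A,B),C)\<in>(SIGMA p:Pow I \<times> Pow I. Pow (fst p \<inter> snd p)). c A * e B * wick I (A - C) (B - C) x)"
    using I fin by (subst sum.Sigma[symmetric]) (auto simp: sum.cartesian_product split_def)
  also have "\<dots> = (\<Sum>(C,(A,B))\<in>{(C,(A,B)). C \<subseteq> I \<and> A \<subseteq> I \<and> B \<subseteq> I \<and> C \<inter> A = {} \<and> C \<inter> B = {}}.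
       c (C \<union> A) * e (C \<union> B) * wick I A B x)"
    by (rule sum.reindex_bij_witness[where i="\<lambda>(C,(A,B)). ((C \<union> A, C \<union> B), C)" and j="\<lambda>((A,B),C). (C,(A - C, B - C))"])
       (auto simp: d1 d2, blast)
  also have "\<dots> = (\<Sum>(C,(A,B))\<in>Pow I \<times> (Pow I \<times> Pow I). ?b C A B * wick I A B x)"
    using I by (intro sum.mono_neutral_cong_left) auto
  also have "\<dots> = (\<Sum>C\<in>Pow I. \<Sum>A\<in>Pow I. \<Sum>B\<in>Pow I. ?b C A B * wick I A B x)"
    by (simp add: sum.cartesian_product split_def)
  also have "\<dots> = (\<Sum>r\<le>card I. \<Sum>C\<in>Pow I. of_bool (card C = r) * (\<Sum>A\<in>Pow I. \<Sum>B\<in>Pow I. ?b C A B * wick I A B x))"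
    by (rule sum_of_bool_card[OF I])
  also have "\<dots> = (\<Sum>r\<le>card I. wick_sum I (contr I r c e) x)"
  proof (intro sum.cong refl)
    fix r
    have "wick_sum I (contr I r c e) x
      = (\<Sum>A\<in>Pow I. \<Sum>B\<in>Pow I. \<Sum>C\<in>Pow I. of_bool (card C = r) * (?b C A B * wick I A B x))"
      unfolding wick_sum_def contr_of_bool[OF I] sum_distrib_right
      by (intro sum.cong refl) (auto simp: of_bool_def)
    also have "\<dots> = (\<Sum>A\<in>Pow I. \<Sum>C\<in>Pow I. \<Sum>B\<in>Pow I. of_bool (card C = r) * (?b C A B * wick I A B x))"
      by (rule sum.cong[OF refl], rule sum.swap)
    also have "\<dots> = (\<Sum>C\<in>Pow I. \<Sum>A\<in>Pow I. \<Sum>B\<in>Pow I. of_bool (card C = r) * (?b C A B * wick I A B x))"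
      by (rule sum.swap)
    finally show "(\<Sum>C\<in>Pow I. of_bool (card C = r) * (\<Sum>A\<in>Pow I. \<Sum>B\<in>Pow I. ?b C A B * wick I A B x))
      = wick_sum I (contr I r c e) x"
      by (simp add: sum_distrib_left)
  qed
  finally show ?thesis .
qed

text \<open>
  Contracting the derivatives over \<open>C\<close> and summing over \<open>i\<close> contracts the original coefficients over
  \<open>insert i C\<close>; each set with \<open>r + 1\<close> elements arises from \<open>r + 1\<close> choices of \<open>i\<close>.
\<close>
lemma sum_contr_deriv_coeff:
  assumes I: "finite I"
  shows "(\<Sum>i\<in>I. contr I r (deriv_coeff i c) (deriv_coeff i e) A B) = Suc r * contr I (Suc r) c e A B"
proof -
  let ?D = "\<lambda>r. {C. C \<subseteq> I \<and> card C = r \<and> C \<inter> A = {} \<and> C \<inter> B = {}}"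
  let ?g = "\<lambda>C. c (C \<union> A) * e (C \<union> B)"
  have fD: "finite (?D r)" for r using I by auto
  have ci: "card (insert i C) = Suc (card C)" if "C \<subseteq> I" "i \<notin> C" for i C
    using that finite_subset[OF _ I] by simp
  have fC: "finite C" if "C \<in> ?D r" for C r using finite_subset[OF _ I] that by simp
  have "(\<Sum>i\<in>I. contr I r (deriv_coeff i c) (deriv_coeff i e) A B)
     = (\<Sum>(i,C)\<in>I \<times> ?D r. deriv_coeff i c (C \<union> A) * deriv_coeff i e (C \<union> B))"
    unfolding contr_def by (simp add: sum.cartesian_product)
  also have "\<dots> = (\<Sum>(i,C)\<in>{(i,C). i \<in> I \<and> C \<in> ?D r \<and> i \<notin> C \<union> A \<union> B}. ?g (insert i C))"
    using I fD[of r] by (intro sum.mono_neutral_cong_right) (auto simp: deriv_coeff_def)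
  also have "\<dots> = (\<Sum>(C,i)\<in>(SIGMA C:?D (Suc r). C). ?g C)"
    by (rule sum.reindex_bij_witness[where i="\<lambda>(C,i). (i, C - {i})" and j="\<lambda>(i,C). (insert i C, i)"])
       (auto simp: insert_absorb ci)
  also have "\<dots> = (\<Sum>C\<in>?D (Suc r). \<Sum>i\<in>C. ?g C)"
    by (rule sum.Sigma[symmetric]) (use fD fC in blast)+
  also have "\<dots> = (\<Sum>C\<in>?D (Suc r). Suc r * ?g C)"
    by (intro sum.cong refl) auto
  finally show ?thesis by (simp add: contr_def sum_distrib_left)
qed

text \<open>
  Compared with the product formula, the term of order \<open>r\<close> is multiplied by \<open>r\<close>; in particular
  the order zero disappears, which is why only contractions of positive order matter for the law.
\<close>
lemma carre_du_champ_expansion: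
  assumes I: "finite I"
  shows "carre_du_champ I c e x = (\<Sum>r\<le>card I. Suc r * wick_sum I (contr I (Suc r) c e) x)"
proof -
  have "carre_du_champ I c e x
    = (\<Sum>i\<in>I. \<Sum>r\<le>card I. wick_sum I (contr I r (deriv_coeff i c) (deriv_coeff i e)) x)"
    unfolding carre_du_champ_def by (simp add: multilin_mult[OF I])
  also have "\<dots> = (\<Sum>r\<le>card I. \<Sum>i\<in>I. wick_sum I (contr I r (deriv_coeff i c) (deriv_coeff i e)) x)"
    by (rule sum.swap)
  also have "\<dots> = (\<Sum>r\<le>card I. Suc r * wick_sum I (contr I (Suc r) c e) x)"
  proof (intro sum.cong refl)
    fix r
    have "(\<Sum>i\<in>I. wick_sum I (contr I r (deriv_coeff i c) (deriv_coeff i e)) x)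
      = (\<Sum>A\<in>Pow I. \<Sum>i\<in>I. \<Sum>B\<in>Pow I. contr I r (deriv_coeff i c) (deriv_coeff i e) A B * wick I A B x)"
      unfolding wick_sum_def by (rule sum.swap)
    also have "\<dots> = (\<Sum>A\<in>Pow I. \<Sum>B\<in>Pow I. \<Sum>i\<in>I. contr I r (deriv_coeff i c) (deriv_coeff i e) A B * wick I A B x)"
      by (rule sum.cong[OF refl], rule sum.swap)
    also have "\<dots> = (\<Sum>A\<in>Pow I. \<Sum>B\<in>Pow I. (Suc r * contr I (Suc r) c e A B) * wick I A B x)"
      by (simp only: sum_distrib_right[symmetric] sum_contr_deriv_coeff[OF I])
    finally show "(\<Sum>i\<in>I. wick_sum I (contr I r (deriv_coeff i c) (deriv_coeff i e)) x)
      = Suc r * wick_sum I (contr I (Suc r) c e) x"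
      by (simp add: wick_sum_def sum_distrib_left mult.assoc)
  qed
  finally show ?thesis .
qed

lemma sqnorm_nonneg: "0 \<le> sqnorm I K"
  unfolding sqnorm_def by (intro sum_nonneg) auto

text \<open>
  Writing out the square, the contraction variables \<open>C\<close>, \<open>D\<close> and the free variables \<open>A\<close>, \<open>B\<close> can be
  summed in either order; summing over \<open>A\<close> and \<open>B\<close> first contracts \<open>c\<close> with \<open>c\<close> and \<open>e\<close> with \<open>e\<close>.
\<close>
lemma sqnorm_contr_mixed:
  assumes I: "finite I" and c: "homogeneous p c" and e: "homogeneous q e" and r: "r \<le> p" "r \<le> q"
  shows "sqnorm I (contr I r c e)
    = (\<Sum>C\<in>Pow I. \<Sum>D\<in>Pow I. of_bool (card C = r \<and> card D = r)
         * (contr I (p - r) c c C D * contr I (q - r) e e C D))"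
proof -
  let ?b = "\<lambda>C A B. of_bool (card C = r \<and> C \<inter> A = {} \<and> C \<inter> B = {}) * (c (C \<union> A) * e (C \<union> B)) :: real"
  let ?P = "Pow I"
  have contr_full: "contr I (m - r) g g C D = (\<Sum>A\<in>?P. of_bool (C \<inter> A = {} \<and> D \<inter> A = {}) * (g (C \<union> A) * g (D \<union> A)))"
    if g: "homogeneous m g" and C: "card C = r" "C \<subseteq> I" and rm: "r \<le> m" for C D m g
    unfolding contr_of_bool[OF I]
  proof (intro sum.cong refl)
    fix A assume A: "A \<in> ?P"
    have "card A = m - r" if "g (C \<union> A) \<noteq> 0" "C \<inter> A = {}"
      using that g C A I rm card_Un_disjoint[of C A]
      by (auto simp: homogeneous_def finite_subset[OF _ I])
    then show "of_bool (card A = m - r \<and> A \<inter> C = {} \<and> A \<inter> D = {}) * (g (A \<union> C) * g (A \<union> D)) =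
         of_bool (C \<inter> A = {} \<and> D \<inter> A = {}) * (g (C \<union> A) * g (D \<union> A))"
      by (cases "g (C \<union> A) = 0") (auto simp: Int_commute Un_commute)
  qed
  have "sqnorm I (contr I r c e) = (\<Sum>A\<in>?P. \<Sum>B\<in>?P. \<Sum>C\<in>?P. \<Sum>D\<in>?P. ?b C A B * ?b D A B)"
    unfolding sqnorm_def power2_eq_square contr_of_bool[OF I] sum_product ..
  also have "\<dots> = (\<Sum>C\<in>?P. \<Sum>D\<in>?P. \<Sum>A\<in>?P. \<Sum>B\<in>?P. ?b C A B * ?b D A B)"
    by (rule sum_swap_pairs)
  also have "\<dots> = (\<Sum>C\<in>?P. \<Sum>D\<in>?P. of_bool (card C = r \<and> card D = r)
         * (contr I (p - r) c c C D * contr I (q - r) e e C D))"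
  proof (intro sum.cong refl)
    fix C D assume CD: "C \<in> ?P" "D \<in> ?P"
    show "(\<Sum>A\<in>?P. \<Sum>B\<in>?P. ?b C A B * ?b D A B) = of_bool (card C = r \<and> card D = r)
         * (contr I (p - r) c c C D * contr I (q - r) e e C D)"
    proof (cases "card C = r \<and> card D = r")
      case True
      then show ?thesis
        using CD r by (subst contr_full[OF c], simp, simp, simp, subst contr_full[OF e], simp, simp, simp)
          (auto simp: sum_product of_bool_def intro!: sum.cong)
    qed auto
  qed
  finally show ?thesis .
qed

lemma sqnorm_contr_mixed_le:
  assumes I: "finite I" and c: "homogeneous p c" and e: "homogeneous q e" and r: "r \<le> p" "r \<le> q"
  shows "(sqnorm I (contr I r c e))\<^sup>2 \<le> sqnorm I (contr I (p - r) c c) * sqnorm I (contr I (q - r) e e)"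
proof -
  let ?P = "Pow I \<times> Pow I"
  let ?u = "\<lambda>z. of_bool (card (fst z) = r \<and> card (snd z) = r) * contr I (p - r) c c (fst z) (snd z)"
  let ?v = "\<lambda>z. contr I (q - r) e e (fst z) (snd z)"
  have sq: "sqnorm I K = (\<Sum>z\<in>?P. (K (fst z) (snd z))\<^sup>2)" for K
    unfolding sqnorm_def by (simp add: sum.cartesian_product split_def)
  have "sqnorm I (contr I r c e) = (\<Sum>z\<in>?P. ?u z * ?v z)"
    unfolding sqnorm_contr_mixed[OF assms] by (simp add: sum.cartesian_product split_def mult.assoc)
  then have "(sqnorm I (contr I r c e))\<^sup>2 \<le> (\<Sum>z\<in>?P. (?u z)\<^sup>2) * (\<Sum>z\<in>?P. (?v z)\<^sup>2)"
    using Cauchy_Schwarz_ineq_sum[of ?u ?v ?P] by simp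
  also have "\<dots> \<le> sqnorm I (contr I (p - r) c c) * sqnorm I (contr I (q - r) e e)"
    unfolding sq by (intro mult_right_mono sum_mono sum_nonneg) auto
  finally show ?thesis .
qed

lemma contr_0:
  "contr I 0 c e A B = c A * e B" if "finite I"
proof -
  have "{C. C \<subseteq> I \<and> card C = 0 \<and> C \<inter> A = {} \<and> C \<inter> B = {}} = {{}}"
    using that finite_subset[of _ I] by auto
  then show ?thesis by (simp add: contr_def)
qed

lemma contr_homogeneous_nonzero:
  assumes I: "finite I" and c: "homogeneous p c" and e: "homogeneous q e" and AB: "A \<subseteq> I" "B \<subseteq> I"
    and nz: "contr I r c e A B \<noteq> 0"
  shows "card A + r = p" "card B + r = q"
proof -
  obtain C where C: "C \<subseteq> I" "card C = r" "C \<inter> A = {}" "C \<inter> B = {}" "c (C \<union> A) * e (C \<union> B) \<noteq> 0"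
    using nz unfolding contr_def by (auto elim!: sum.not_neutral_contains_not_neutral)
  then have "card (C \<union> A) = p" "card (C \<union> B) = q"
    using c e by (auto simp: homogeneous_def)
  then show "card A + r = p" "card B + r = q"
    using C AB I by (auto simp: card_Un_disjoint finite_subset[OF _ I])
qed

text \<open>
  Contracting all the variables leaves the inner product of the coefficients.
\<close>
lemma contr_top:
  assumes I: "finite I" and c: "homogeneous d c" and e: "homogeneous d e" and AB: "A \<subseteq> I" "B \<subseteq> I"
  shows "contr I d c e A B = (if A = {} \<and> B = {} then inner_coeff I c e else 0)"
proof (cases "A = {} \<and> B = {}")
  case True
  have "contr I d c e {} {} = (\<Sum>C\<in>Pow I. c C * e C)"
    unfolding contr_def using I c by (intro sum.mono_neutral_cong_left) (auto simp: homogeneous_def)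
  then show ?thesis using True by (simp add: inner_coeff_def)
next
  case False
  have "contr I d c e A B = 0"
  proof (rule ccontr)
    assume "contr I d c e A B \<noteq> 0"
    from contr_homogeneous_nonzero[OF I c e AB this] have "card A = 0" "card B = 0" by auto
    then show False using False AB I by (auto dest: finite_subset)
  qed
  then show ?thesis using False by auto
qed

lemma sqnorm_contr_0: "sqnorm I (contr I 0 c c) = (inner_coeff I c c)\<^sup>2" if "finite I"
  unfolding sqnorm_def contr_0[OF that] inner_coeff_def power2_eq_square sum_product
  by (simp add: mult_ac)

lemma sqnorm_contr_top:
  assumes "finite I" "homogeneous d c"
  shows "sqnorm I (contr I d c c) = (inner_coeff I c c)\<^sup>2"
proof -
  have "sqnorm I (contr I d c c) = (\<Sum>A\<in>Pow I. \<Sum>B\<in>Pow I. if A = {} \<and> B = {} then (inner_coeff I c c)\<^sup>2 else 0)"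
    unfolding sqnorm_def using assms by (intro sum.cong refl) (auto simp: contr_top)
  also have "\<dots> = (\<Sum>A\<in>Pow I. if A = {} then (inner_coeff I c c)\<^sup>2 else 0)"
    using assms(1) by (intro sum.cong refl) (auto simp: sum.delta)
  also have "\<dots> = (inner_coeff I c c)\<^sup>2"
    using assms(1) by (auto simp: sum.delta)
  finally show ?thesis .
qed


section \<open>Gaussian product measures and orthogonality\<close>

definition gauss :: "nat set \<Rightarrow> (nat \<Rightarrow> real) measure" where
  "gauss I = PiM I (\<lambda>_. std_normal_distribution)"

lemma prob_space_std_normal: "prob_space std_normal_distribution"
  using real_dist_normal_dist by (simp add: real_distribution_def)

interpretation std_normals: product_sigma_finite "\<lambda>_::nat. std_normal_distribution"
  by (simp add: product_sigma_finite_def prob_space_imp_sigma_finite prob_space_std_normal)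

lemma prob_space_gauss: "prob_space (gauss I)"
  unfolding gauss_def by (intro prob_space_PiM prob_space_std_normal)

lemma sets_gauss [measurable_cong]: "sets (gauss I) = sets (PiM I (\<lambda>_. borel))"
  unfolding gauss_def by (intro sets_PiM_cong) auto

text \<open>
  All integrability questions for polynomials reduce to this property, which is stable under the ring
  operations.
\<close>
definition all_moments :: "'a measure \<Rightarrow> ('a \<Rightarrow> real) \<Rightarrow> bool" where
  "all_moments M u \<longleftrightarrow> u \<in> borel_measurable M \<and> (\<forall>k. integrable M (\<lambda>x. \<bar>u x\<bar> ^ k))"

lemma all_moments_measurable: "all_moments M u \<Longrightarrow> u \<in> borel_measurable M"
  by (simp add: all_moments_def)

lemma all_moments_integrable: "all_moments M u \<Longrightarrow> integrable M u"
  unfolding all_moments_def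
proof (elim conjE)
  assume u: "u \<in> borel_measurable M" and int: "\<forall>k. integrable M (\<lambda>x. \<bar>u x\<bar> ^ k)"
  from int[rule_format, of 1] show "integrable M u"
    using integrable_abs_cancel[OF _ u] by simp
qed

lemma (in finite_measure) all_moments_const: "all_moments M (\<lambda>_. a)"
  by (simp add: all_moments_def)

lemma all_moments_add:
  assumes u: "all_moments M u" and v: "all_moments M v"
  shows "all_moments M (\<lambda>x. u x + v x)"
  unfolding all_moments_def
proof (intro conjI allI)
  have [measurable]: "u \<in> borel_measurable M" "v \<in> borel_measurable M"
    using u v by (auto simp: all_moments_def)
  show "(\<lambda>x. u x + v x) \<in> borel_measurable M" by measurable
  fix k
  show "integrable M (\<lambda>x. \<bar>u x + v x\<bar> ^ k)"
  proof (rule Bochner_Integration.integrable_bound)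
    show "integrable M (\<lambda>x. 2 ^ k * (\<bar>u x\<bar> ^ k + \<bar>v x\<bar> ^ k))"
      using u v by (auto simp: all_moments_def)
    have "\<bar>a + b\<bar> ^ k \<le> 2 ^ k * (\<bar>a\<bar> ^ k + \<bar>b\<bar> ^ k)" for a b :: real
    proof -
      have "\<bar>a + b\<bar> ^ k \<le> (2 * max \<bar>a\<bar> \<bar>b\<bar>) ^ k" by (intro power_mono) auto
      also have "\<dots> = 2 ^ k * (max \<bar>a\<bar> \<bar>b\<bar>) ^ k" by (simp add: power_mult_distrib)
      also have "(max \<bar>a\<bar> \<bar>b\<bar>) ^ k \<le> \<bar>a\<bar> ^ k + \<bar>b\<bar> ^ k" by (auto simp: max_def)
      finally show ?thesis by simp
    qed
    from order_trans[OF this abs_ge_self]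
    show "AE x in M. norm (\<bar>u x + v x\<bar> ^ k) \<le> norm (2 ^ k * (\<bar>u x\<bar> ^ k + \<bar>v x\<bar> ^ k))"
      by (intro AE_I2) (simp only: real_norm_def power_abs abs_abs)
  qed measurable
qed

lemma all_moments_mult:
  assumes u: "all_moments M u" and v: "all_moments M v"
  shows "all_moments M (\<lambda>x. u x * v x)"
  unfolding all_moments_def
proof (intro conjI allI)
  have [measurable]: "u \<in> borel_measurable M" "v \<in> borel_measurable M"
    using u v by (auto simp: all_moments_def)
  show "(\<lambda>x. u x * v x) \<in> borel_measurable M" by measurable
  fix k
  show "integrable M (\<lambda>x. \<bar>u x * v x\<bar> ^ k)"
  proof (rule Bochner_Integration.integrable_bound)
    show "integrable M (\<lambda>x. \<bar>u x\<bar> ^ (2*k) + \<bar>v x\<bar> ^ (2*k))"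
      using u v by (auto simp: all_moments_def)
    have "\<bar>a * b\<bar> ^ k \<le> \<bar>a\<bar> ^ (2*k) + \<bar>b\<bar> ^ (2*k)" for a b :: real
    proof -
      have "2 * (\<bar>a\<bar> ^ k * \<bar>b\<bar> ^ k) \<le> (\<bar>a\<bar> ^ k)\<^sup>2 + (\<bar>b\<bar> ^ k)\<^sup>2"
        using sum_squares_bound[of "\<bar>a\<bar> ^ k" "\<bar>b\<bar> ^ k"] by simp
      then have "2 * \<bar>a * b\<bar> ^ k \<le> \<bar>a\<bar> ^ (2*k) + \<bar>b\<bar> ^ (2*k)"
        by (simp add: abs_mult power_mult_distrib power_mult[symmetric] mult.commute[of 2 k])
      moreover have "0 \<le> \<bar>a * b\<bar> ^ k" by simp
      ultimately show ?thesis by linarith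
    qed
    from order_trans[OF this abs_ge_self]
    show "AE x in M. norm (\<bar>u x * v x\<bar> ^ k) \<le> norm (\<bar>u x\<bar> ^ (2*k) + \<bar>v x\<bar> ^ (2*k))"
      by (intro AE_I2) (simp only: real_norm_def power_abs abs_abs)
  qed measurable
qed

lemma (in finite_measure) all_moments_sum:
  "(\<And>i. i \<in> S \<Longrightarrow> all_moments M (u i)) \<Longrightarrow> all_moments M (\<lambda>x. \<Sum>i\<in>S. u i x)"
  by (induction S rule: infinite_finite_induct) (auto intro: all_moments_add all_moments_const)

lemma (in finite_measure) all_moments_prod:
  "(\<And>i. i \<in> S \<Longrightarrow> all_moments M (u i)) \<Longrightarrow> all_moments M (\<lambda>x. \<Prod>i\<in>S. u i x)"
  by (induction S rule: infinite_finite_induct) (auto intro: all_moments_mult all_moments_const)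

lemma (in finite_measure) all_moments_power:
  "all_moments M u \<Longrightarrow> all_moments M (\<lambda>x. u x ^ k)"
  by (induction k) (auto intro: all_moments_mult all_moments_const)

lemma (in finite_measure) all_moments_diff:
  "all_moments M u \<Longrightarrow> all_moments M v \<Longrightarrow> all_moments M (\<lambda>x. u x - v x)"
  using all_moments_add[of M u "\<lambda>x. (-1) * v x"] all_moments_mult[OF all_moments_const[of "-1"], of v]
  by simp

lemma all_moments_std_normal: "all_moments std_normal_distribution (\<lambda>x. x)"
  unfolding all_moments_def
  using integrable_abs[OF integrable_std_normal_distribution_moment]
  by (auto simp: power_abs)

lemma finite_gauss: "finite_measure (gauss I)"
  by (rule prob_space.finite_measure[OF prob_space_gauss])

lemma all_moments_coord:
  assumes "finite I" "i \<in> I"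
  shows "all_moments (gauss I) (\<lambda>x. x i)"
  unfolding all_moments_def
proof (intro conjI allI)
  show [measurable]: "(\<lambda>x. x i) \<in> borel_measurable (gauss I)"
    using assms by measurable
  fix k
  have "integrable (gauss I) (\<lambda>x. \<Prod>j\<in>I. if j = i then \<bar>x j\<bar> ^ k else 1)"
    unfolding gauss_def
  proof (rule std_normals.product_integrable_prod[OF assms(1), where f="\<lambda>j y. if j = i then \<bar>y\<bar> ^ k else 1"])
    fix j
    have "integrable std_normal_distribution (\<lambda>y::real. 1::real)"
      using prob_space.finite_measure[OF prob_space_std_normal] by (simp add: finite_measure.integrable_const)
    then show "integrable std_normal_distribution (\<lambda>y. if j = i then \<bar>y\<bar> ^ k else 1)"
      using all_moments_std_normal by (cases "j = i") (auto simp: all_moments_def)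
  qed
  then show "integrable (gauss I) (\<lambda>x. \<bar>x i\<bar> ^ k)"
    using assms by (simp add: prod.delta)
qed

lemmas gauss_const = finite_measure.all_moments_const[OF finite_gauss]
lemmas gauss_sum = finite_measure.all_moments_sum[OF finite_gauss]
lemmas gauss_prod = finite_measure.all_moments_prod[OF finite_gauss]
lemmas gauss_power = finite_measure.all_moments_power[OF finite_gauss]
lemmas gauss_diff = finite_measure.all_moments_diff[OF finite_gauss]
lemmas gauss_moments = all_moments_add all_moments_mult gauss_const gauss_sum gauss_prod gauss_power gauss_diff

lemma all_moments_multilin:
  assumes "finite I" "J \<subseteq> I"
  shows "all_moments (gauss I) (multilin J c)"
  unfolding multilin_def[abs_def]
  by (intro gauss_moments all_moments_coord) (use assms in auto)

lemma all_moments_wick: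
  assumes "finite I"
  shows "all_moments (gauss I) (wick I A B)"
proof -
  have "all_moments (gauss I) (\<lambda>x. if i \<in> A \<inter> B then (x i)\<^sup>2 - 1 else if i \<in> A \<union> B then x i else 1)"
    if "i \<in> I" for i
  proof -
    note x = all_moments_coord[OF assms that]
    consider "i \<in> A \<inter> B" | "i \<notin> A \<inter> B" "i \<in> A \<union> B" | "i \<notin> A \<union> B" by blast
    then show ?thesis
    proof cases
      case 1
      then show ?thesis using gauss_diff[OF gauss_power[OF x, of 2] gauss_const, of 1] by simp
    next
      case 2
      then show ?thesis using x by (simp only: if_True if_False)
    next
      case 3
      then show ?thesis using gauss_const[of I 1] by simp
    qed
  qed
  then show ?thesis unfolding wick_def[abs_def] by (rule gauss_prod)
qed

lemma all_moments_wick_sum: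
  assumes "finite I"
  shows "all_moments (gauss I) (wick_sum I K)"
  unfolding wick_sum_def[abs_def] by (intro gauss_moments all_moments_wick assms)

lemma std_normal_moments:
  "has_bochner_integral std_normal_distribution (\<lambda>y. 1::real) 1"
  "has_bochner_integral std_normal_distribution (\<lambda>y. y) (0::real)"
  "has_bochner_integral std_normal_distribution (\<lambda>y. y\<^sup>2) (1::real)"
  "has_bochner_integral std_normal_distribution (\<lambda>y. y ^ 3) (0::real)"
  "has_bochner_integral std_normal_distribution (\<lambda>y. y ^ 4) (3::real)"
  "has_bochner_integral std_normal_distribution (\<lambda>y. y ^ 5) (0::real)"
  "has_bochner_integral std_normal_distribution (\<lambda>y. y ^ 6) (15::real)"
proof -
  note int = has_bochner_integral_integrable[OF integrable_std_normal_distribution_moment]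
  note odd = integral_std_normal_distribution_moment_odd and even = std_normal_distribution_even_moments(1)
  show "has_bochner_integral std_normal_distribution (\<lambda>y. 1::real) 1"
    using int[of 0] prob_space.prob_space[OF prob_space_std_normal] by simp
  show "has_bochner_integral std_normal_distribution (\<lambda>y. y) (0::real)"
    "has_bochner_integral std_normal_distribution (\<lambda>y. y ^ 3) (0::real)"
    "has_bochner_integral std_normal_distribution (\<lambda>y. y ^ 5) (0::real)"
    using int[of 1] int[of 3] int[of 5] odd[of 1] odd[of 3] odd[of 5] by simp_all
  show "has_bochner_integral std_normal_distribution (\<lambda>y. y\<^sup>2) (1::real)"
    "has_bochner_integral std_normal_distribution (\<lambda>y. y ^ 4) (3::real)"
    "has_bochner_integral std_normal_distribution (\<lambda>y. y ^ 6) (15::real)"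
    using int[of 2] int[of 4] int[of 6] even[of 1] even[of 2] even[of 3] by (simp_all add: fact_numeral)
qed

text \<open>
  One factor of \<open>wick\<close>, with the memberships of its index as Boolean parameters.
\<close>
definition hermite_factor :: "bool \<Rightarrow> bool \<Rightarrow> real \<Rightarrow> real" where
  "hermite_factor a b y = (if a \<and> b then y\<^sup>2 - 1 else if a \<or> b then y else 1)"

lemma integral_hermite_factor:
  "has_bochner_integral std_normal_distribution (\<lambda>y. hermite_factor a b y * hermite_factor c d y)
    (if (a \<and> b) = (c \<and> d) \<and> (a \<or> b) = (c \<or> d) then (if a \<and> b then 2 else 1) else 0)"
proof -
  note m = std_normal_moments
  have h22: "has_bochner_integral std_normal_distribution (\<lambda>y. (y\<^sup>2 - 1) * (y\<^sup>2 - 1)) (2::real)"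
  proof -
    have "has_bochner_integral std_normal_distribution (\<lambda>y. y^4 - y\<^sup>2 - (y\<^sup>2 - 1)) (3 - 1 - (1 - 1::real))"
      by (intro has_bochner_integral_diff m)
    then show ?thesis by (simp add: algebra_simps power2_eq_square power4_eq_xxxx)
  qed
  have h21: "has_bochner_integral std_normal_distribution (\<lambda>y. (y\<^sup>2 - 1) * y) (0::real)"
  proof -
    have "has_bochner_integral std_normal_distribution (\<lambda>y. y^3 - y) (0 - 0::real)"
      by (intro has_bochner_integral_diff m)
    then show ?thesis by (simp add: algebra_simps power2_eq_square power3_eq_cube)
  qed
  have h20: "has_bochner_integral std_normal_distribution (\<lambda>y. (y\<^sup>2 - 1)) (0::real)"
    using has_bochner_integral_diff[OF m(3) m(1)] by simp
  show ?thesis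
    using m h22 h21 h20
    by (cases a; cases b; cases c; cases d) (simp_all add: hermite_factor_def mult.commute power2_eq_square)
qed

text \<open>
  Hermite polynomials are orthogonal, so only equal multi-indices contribute; the value is the
  factorial \<open>\<Prod>\<^sub>i n(i)!\<close>, and \<open>n(i) = 2\<close> exactly on \<open>A \<inter> B\<close>.
\<close>
lemma integral_wick_wick:
  assumes I: "finite I" and sub: "A \<subseteq> I" "B \<subseteq> I" "C \<subseteq> I" "D \<subseteq> I"
  shows "(LINT x|gauss I. wick I A B x * wick I C D x)
    = (if A \<inter> B = C \<inter> D \<and> A \<union> B = C \<union> D then 2 ^ card (A \<inter> B) else 0)"
proof -
  let ?f = "\<lambda>i y. hermite_factor (i \<in> A) (i \<in> B) y * hermite_factor (i \<in> C) (i \<in> D) y"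
  let ?v = "\<lambda>i. if (i \<in> A \<and> i \<in> B) = (i \<in> C \<and> i \<in> D) \<and> (i \<in> A \<or> i \<in> B) = (i \<in> C \<or> i \<in> D)
         then (if i \<in> A \<and> i \<in> B then 2 else 1) else 0 :: real"
  have "(LINT x|gauss I. wick I A B x * wick I C D x) = (LINT x|gauss I. (\<Prod>i\<in>I. ?f i (x i)))"
    unfolding wick_def hermite_factor_def Un_iff Int_iff prod.distrib ..
  also have "\<dots> = (\<Prod>i\<in>I. integral\<^sup>L std_normal_distribution (?f i))"
    unfolding gauss_def
    by (rule std_normals.product_integral_prod[OF I]) (rule integrable.intros[OF integral_hermite_factor])
  also have "\<dots> = (\<Prod>i\<in>I. ?v i)"
    by (intro prod.cong refl has_bochner_integral_integral_eq integral_hermite_factor)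
  also have "\<dots> = (if A \<inter> B = C \<inter> D \<and> A \<union> B = C \<union> D then 2 ^ card (A \<inter> B) else 0)"
  proof (cases "A \<inter> B = C \<inter> D \<and> A \<union> B = C \<union> D")
    case True
    then have "(\<Prod>i\<in>I. ?v i) = (\<Prod>i\<in>I. if i \<in> A \<inter> B then 2 else 1)"
      by (intro prod.cong refl) auto
    also have "\<dots> = (\<Prod>i\<in>A \<inter> B. 2)"
      using I sub by (intro prod.mono_neutral_cong_right) auto
    finally show ?thesis using True by simp
  next
    case False
    have "\<exists>i\<in>I. \<not> ((i \<in> A \<and> i \<in> B) = (i \<in> C \<and> i \<in> D) \<and> (i \<in> A \<or> i \<in> B) = (i \<in> C \<or> i \<in> D))"
    proof (rule ccontr)
      assume *: "\<not> ?thesis"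
      have "A \<inter> B = C \<inter> D" "A \<union> B = C \<union> D" using * sub by blast+
      then show False using False by simp
    qed
    then obtain i where "i \<in> I" and i: "\<not> ((i \<in> A \<and> i \<in> B) = (i \<in> C \<and> i \<in> D) \<and> (i \<in> A \<or> i \<in> B) = (i \<in> C \<or> i \<in> D))"
      by (elim bexE)
    moreover have "?v i = 0" using i by (rule if_not_P)
    ultimately have "(\<Prod>i\<in>I. ?v i) = 0" using I by (intro prod_zero) blast+
    then show ?thesis using False by (simp only: if_False)
  qed
  finally show ?thesis .
qed

text \<open>
  A pair \<open>(S, T)\<close> encodes a way to redistribute the elements of \<open>A\<close> and \<open>B\<close> into two new sets
  \<open>S \<union> T\<close> and \<open>(A - S) \<union> (B - T)\<close> without collisions. These are the Gaussian pairings between the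
  variables of \<open>wick I A B\<close> and those of another Wick monomial.
\<close>
definition splits :: "nat set \<Rightarrow> nat set \<Rightarrow> (nat set \<times> nat set) set" where
  "splits A B = {(S, T). S \<subseteq> A \<and> T \<subseteq> B \<and> S \<inter> T = {} \<and> (A - S) \<inter> (B - T) = {}}"

lemma finite_splits: "finite A \<Longrightarrow> finite B \<Longrightarrow> finite (splits A B)"
  by (rule finite_subset[of _ "Pow A \<times> Pow B"]) (auto simp: splits_def)

lemma card_splits_le:
  assumes "finite A" "finite B"
  shows "card (splits A B) \<le> 2 ^ (card A + card B)"
proof -
  have "card (splits A B) \<le> card (Pow A \<times> Pow B)"
    by (rule card_mono) (use assms in \<open>auto simp: splits_def\<close>)
  then show ?thesis using assms by (simp add: card_cartesian_product card_Pow power_add)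
qed

text \<open>
  Outside \<open>A \<inter> B\<close> the pair \<open>(S, T)\<close> is determined by \<open>C\<close>, while each element of \<open>A \<inter> B\<close>
  belongs to exactly one of \<open>S\<close> and \<open>T\<close>, freely chosen. So the scalar product of two Wick monomials
  counts the redistributions of one into the other.
\<close>
lemma card_splits_into:
  assumes "finite A" "finite B"
  shows "card {(S, T) \<in> splits A B. C = S \<union> T \<and> D = (A - S) \<union> (B - T)}
    = (if A \<inter> B = C \<inter> D \<and> A \<union> B = C \<union> D then 2 ^ card (A \<inter> B) else 0)" (is "card ?X = _")
proof (cases "A \<inter> B = C \<inter> D \<and> A \<union> B = C \<union> D")
  case True
  have "bij_betw (\<lambda>(S, T). S \<inter> (A \<inter> B)) ?X (Pow (A \<inter> B))"
  proof (rule bij_betw_byWitness[where f'="\<lambda>U. (C \<inter> (A - B) \<union> U, C \<inter> (B - A) \<union> (A \<inter> B - U))"])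
    show "\<forall>a\<in>?X. (case case a of (S, T) \<Rightarrow> S \<inter> (A \<inter> B) of
         U \<Rightarrow> (C \<inter> (A - B) \<union> U, C \<inter> (B - A) \<union> (A \<inter> B - U))) = a"
      by (auto simp: splits_def)
    show "\<forall>U\<in>Pow (A \<inter> B). (case (C \<inter> (A - B) \<union> U, C \<inter> (B - A) \<union> (A \<inter> B - U)) of (S, T) \<Rightarrow> S \<inter> (A \<inter> B)) = U"
      by auto
    show "(\<lambda>(S, T). S \<inter> (A \<inter> B)) ` ?X \<subseteq> Pow (A \<inter> B)" by auto
    show "(\<lambda>U. (C \<inter> (A - B) \<union> U, C \<inter> (B - A) \<union> (A \<inter> B - U))) ` Pow (A \<inter> B) \<subseteq> ?X"
    proof (intro image_subsetI)
      fix U assume U: "U \<in> Pow (A \<inter> B)"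
      have AB: "A \<inter> B \<subseteq> C" "A \<inter> B \<subseteq> D" "C \<subseteq> A \<union> B" "D \<subseteq> A \<union> B" "A \<union> B \<subseteq> C \<union> D" "C \<inter> D \<subseteq> A \<inter> B"
        using True by blast+
      show "(C \<inter> (A - B) \<union> U, C \<inter> (B - A) \<union> (A \<inter> B - U)) \<in> ?X"
        unfolding splits_def using U AB by blast
    qed
  qed
  then have "card ?X = card (Pow (A \<inter> B))" by (rule bij_betw_same_card)
  also have "\<dots> = 2 ^ card (A \<inter> B)"
    using assms by (intro card_Pow) simp
  finally show ?thesis by (simp only: True simp_thms if_True)
next
  case False
  have "?X = {}"
  proof (rule ccontr)
    assume "?X \<noteq> {}"
    then obtain S T where "(S, T) \<in> splits A B" "C = S \<union> T" "D = (A - S) \<union> (B - T)" by auto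
    then have "A \<inter> B = C \<inter> D \<and> A \<union> B = C \<union> D" unfolding splits_def by blast
    then show False using False by simp
  qed
  then show ?thesis using False by (simp only: card.empty if_False)
qed

lemma sum_integral_wick:
  assumes I: "finite I" and AB: "A \<subseteq> I" "B \<subseteq> I"
  shows "(\<Sum>C\<in>Pow I. \<Sum>D\<in>Pow I. \<psi> C D * (LINT x|gauss I. wick I A B x * wick I C D x))
    = (\<Sum>(S, T)\<in>splits A B. \<psi> (S \<union> T) ((A - S) \<union> (B - T)))"
proof -
  have fin: "finite A" "finite B" using AB I by (auto intro: finite_subset)
  have e: "(LINT x|gauss I. wick I A B x * wick I C D x)
     = (\<Sum>z\<in>splits A B. of_bool (C = fst z \<union> snd z \<and> D = (A - fst z) \<union> (B - snd z)))"
    if "C \<subseteq> I" "D \<subseteq> I" for C D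
  proof -
    have "(\<Sum>z\<in>splits A B. of_bool (C = fst z \<union> snd z \<and> D = (A - fst z) \<union> (B - snd z)) :: real)
      = real (card (splits A B \<inter> {z. C = fst z \<union> snd z \<and> D = (A - fst z) \<union> (B - snd z)}))"
      using finite_splits[OF fin] by (simp add: of_bool_def sum.If_cases)
    also have "splits A B \<inter> {z. C = fst z \<union> snd z \<and> D = (A - fst z) \<union> (B - snd z)}
      = {(S, T) \<in> splits A B. C = S \<union> T \<and> D = (A - S) \<union> (B - T)}" by auto
    finally show ?thesis
      unfolding card_splits_into[OF fin] integral_wick_wick[OF I AB that] by simp
  qed
  have "(\<Sum>C\<in>Pow I. \<Sum>D\<in>Pow I. \<psi> C D * (LINT x|gauss I. wick I A B x * wick I C D x))
    = (\<Sum>C\<in>Pow I. \<Sum>D\<in>Pow I. \<Sum>z\<in>splits A B. \<psi> C D * of_bool (C = fst z \<union> snd z \<and> D = (A - fst z) \<union> (B - snd z)))"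
    by (intro sum.cong refl) (simp add: e sum_distrib_left)
  also have "\<dots> = (\<Sum>C\<in>Pow I. \<Sum>z\<in>splits A B. \<Sum>D\<in>Pow I. \<psi> C D * of_bool (C = fst z \<union> snd z \<and> D = (A - fst z) \<union> (B - snd z)))"
    by (rule sum.cong[OF refl], rule sum.swap)
  also have "\<dots> = (\<Sum>z\<in>splits A B. \<Sum>C\<in>Pow I. \<Sum>D\<in>Pow I. \<psi> C D * of_bool (C = fst z \<union> snd z \<and> D = (A - fst z) \<union> (B - snd z)))"
    by (rule sum.swap)
  also have "\<dots> = (\<Sum>z\<in>splits A B. \<psi> (fst z \<union> snd z) ((A - fst z) \<union> (B - snd z)))"
  proof (rule sum.cong[OF refl])
    fix z assume z: "z \<in> splits A B"
    let ?X = "fst z \<union> snd z" and ?Y = "(A - fst z) \<union> (B - snd z)"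
    have XY: "?X \<in> Pow I" "?Y \<in> Pow I" using z AB by (auto simp: splits_def)
    have "(\<Sum>D\<in>Pow I. \<psi> C D * of_bool (C = ?X \<and> D = ?Y)) = (if C = ?X then \<psi> ?X ?Y else 0)" for C
    proof -
      have "(\<Sum>D\<in>Pow I. \<psi> C D * of_bool (C = ?X \<and> D = ?Y)) = (\<Sum>D\<in>Pow I. if D = ?Y then (if C = ?X then \<psi> ?X ?Y else 0) else 0)"
        by (intro sum.cong refl) auto
      then show ?thesis using XY I by (simp add: sum.delta)
    qed
    then show "(\<Sum>C\<in>Pow I. \<Sum>D\<in>Pow I. \<psi> C D * of_bool (C = ?X \<and> D = ?Y)) = \<psi> ?X ?Y"
      using XY I by (simp add: sum.delta)
  qed
  finally show ?thesis by (simp add: split_def)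
qed

lemma integral_wick_sum_mult:
  assumes I: "finite I"
  shows "(LINT x|gauss I. wick_sum I K x * wick_sum I L x)
    = (\<Sum>A\<in>Pow I. \<Sum>B\<in>Pow I. K A B * (\<Sum>C\<in>Pow I. \<Sum>D\<in>Pow I. L C D * (LINT x|gauss I. wick I A B x * wick I C D x)))"
proof -
  have int: "integrable (gauss I) (\<lambda>x. wick I A B x * wick I C D x)" for A B C D
    by (intro all_moments_integrable all_moments_mult all_moments_wick I)
  have "wick_sum I K x * wick_sum I L x = (\<Sum>A\<in>Pow I. \<Sum>B\<in>Pow I. \<Sum>C\<in>Pow I. \<Sum>D\<in>Pow I.
     (K A B * L C D) * (wick I A B x * wick I C D x))" for x
    unfolding wick_sum_def sum_distrib_right by (simp add: sum_distrib_left mult_ac)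
  then have "(LINT x|gauss I. wick_sum I K x * wick_sum I L x) = (\<Sum>A\<in>Pow I. \<Sum>B\<in>Pow I. \<Sum>C\<in>Pow I. \<Sum>D\<in>Pow I.
     (K A B * L C D) * (LINT x|gauss I. wick I A B x * wick I C D x))"
    using int by (simp add: integral_sum integrable_sum)
  then show ?thesis by (simp add: sum_distrib_left mult.assoc)
qed

lemma integral_wick_sum_splits:
  assumes I: "finite I"
  shows "(LINT x|gauss I. wick_sum I K x * wick_sum I L x)
    = (\<Sum>A\<in>Pow I. \<Sum>B\<in>Pow I. K A B * (\<Sum>(S, T)\<in>splits A B. L (S \<union> T) ((A - S) \<union> (B - T))))"
  unfolding integral_wick_sum_mult[OF I] by (intro sum.cong refl) (simp add: sum_integral_wick[OF I])

lemma card_split_parts: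
  assumes "finite A" "finite B" "(S, T) \<in> splits A B"
  shows "card (S \<union> T) + card ((A - S) \<union> (B - T)) = card A + card B"
proof -
  have ST: "S \<subseteq> A" "T \<subseteq> B" "S \<inter> T = {}" "(A - S) \<inter> (B - T) = {}"
    using assms(3) by (auto simp: splits_def)
  then have fin: "finite S" "finite T" using assms finite_subset by blast+
  have "card (S \<union> T) = card S + card T" "card ((A - S) \<union> (B - T)) = card (A - S) + card (B - T)"
    using ST fin assms by (auto intro!: card_Un_disjoint)
  moreover have "card S + card (A - S) = card A" "card T + card (B - T) = card B"
    using ST fin assms by (auto simp: card_Diff_subset card_mono)
  ultimately show ?thesis by simp
qed

lemma wick_sum_orthogonal:
  assumes I: "finite I" and "s \<noteq> t"
    and K: "\<And>A B. A \<subseteq> I \<Longrightarrow> B \<subseteq> I \<Longrightarrow> K A B \<noteq> 0 \<Longrightarrow> card A + card B = s"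
    and L: "\<And>A B. A \<subseteq> I \<Longrightarrow> B \<subseteq> I \<Longrightarrow> L A B \<noteq> 0 \<Longrightarrow> card A + card B = t"
  shows "(LINT x|gauss I. wick_sum I K x * wick_sum I L x) = 0"
  unfolding integral_wick_sum_splits[OF I]
proof (intro sum.neutral ballI)
  fix A B assume AB: "A \<in> Pow I" "B \<in> Pow I"
  then have fin: "finite A" "finite B" using I by (auto dest: finite_subset)
  show "K A B * (\<Sum>(S, T)\<in>splits A B. L (S \<union> T) ((A - S) \<union> (B - T))) = 0"
  proof (cases "K A B = 0")
    case False
    then have s: "card A + card B = s" using K AB by auto
    have "L (S \<union> T) ((A - S) \<union> (B - T)) = 0" if "(S, T) \<in> splits A B" for S T
    proof (rule ccontr)
      assume "L (S \<union> T) ((A - S) \<union> (B - T)) \<noteq> 0"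
      moreover have "S \<union> T \<subseteq> I" "(A - S) \<union> (B - T) \<subseteq> I" using that AB by (auto simp: splits_def)
      ultimately have "card (S \<union> T) + card ((A - S) \<union> (B - T)) = t" by (intro L)
      then show False using card_split_parts[OF fin that] s \<open>s \<noteq> t\<close> by simp
    qed
    then show ?thesis by (auto intro!: sum.neutral)
  qed simp
qed

text \<open>
  Different pairs \<open>(A, B)\<close> may have the same multi-index, so the second moment is not the
  squared norm of the kernel. Bounding \<open>K(A, B) K(C, D)\<close> by half the sum of the squares leaves the
  number of redistributions of \<open>(A, B)\<close>, at most \<open>2\<^sup>s\<close>.
\<close>
lemma wick_sum_sq_le:
  assumes I: "finite I"
    and K: "\<And>A B. A \<subseteq> I \<Longrightarrow> B \<subseteq> I \<Longrightarrow> K A B \<noteq> 0 \<Longrightarrow> card A + card B = s"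
  shows "(LINT x|gauss I. (wick_sum I K x)\<^sup>2) \<le> 2 ^ s * sqnorm I K"
proof -
  let ?P = "Pow I"
  let ?e = "\<lambda>A B C D. (LINT x|gauss I. wick I A B x * wick I C D x)"
  have e_nonneg: "0 \<le> ?e A B C D" if "A \<subseteq> I" "B \<subseteq> I" "C \<subseteq> I" "D \<subseteq> I" for A B C D
    by (simp add: integral_wick_wick[OF I that])
  have half: "(\<Sum>A\<in>?P. \<Sum>B\<in>?P. \<Sum>C\<in>?P. \<Sum>D\<in>?P. (K A B)\<^sup>2 * ?e A B C D) \<le> 2 ^ s * sqnorm I K"
  proof -
    have "(\<Sum>C\<in>?P. \<Sum>D\<in>?P. (K A B)\<^sup>2 * ?e A B C D) \<le> 2 ^ s * (K A B)\<^sup>2" if AB: "A \<in> ?P" "B \<in> ?P" for A B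
    proof (cases "K A B = 0")
      case False
      have fin: "finite A" "finite B" using AB I by (auto dest: finite_subset)
      have "(\<Sum>C\<in>?P. \<Sum>D\<in>?P. (K A B)\<^sup>2 * ?e A B C D) = (\<Sum>(S, T)\<in>splits A B. (K A B)\<^sup>2)"
        using AB by (intro sum_integral_wick[OF I, where \<psi>="\<lambda>_ _. (K A B)\<^sup>2"]) auto
      also have "\<dots> = real (card (splits A B)) * (K A B)\<^sup>2" by simp
      also have "\<dots> \<le> 2 ^ (card A + card B) * (K A B)\<^sup>2"
        using card_splits_le[OF fin] by (intro mult_right_mono) (simp_all flip: of_nat_power add: of_nat_le_iff[where 'a=real, symmetric] del: of_nat_le_iff)
      finally show ?thesis using K[of A B] AB False by simp
    qed simp
    then show ?thesis unfolding sqnorm_def sum_distrib_left by (intro sum_mono) auto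
  qed
  have "(LINT x|gauss I. (wick_sum I K x)\<^sup>2) = (\<Sum>A\<in>?P. \<Sum>B\<in>?P. \<Sum>C\<in>?P. \<Sum>D\<in>?P. K A B * K C D * ?e A B C D)"
    unfolding power2_eq_square integral_wick_sum_mult[OF I] by (simp add: sum_distrib_left mult.assoc)
  also have "\<dots> \<le> (\<Sum>A\<in>?P. \<Sum>B\<in>?P. \<Sum>C\<in>?P. \<Sum>D\<in>?P. ((K A B)\<^sup>2 * ?e A B C D + (K C D)\<^sup>2 * ?e A B C D) / 2)"
  proof (intro sum_mono)
    fix A B C D assume "A \<in> ?P" "B \<in> ?P" "C \<in> ?P" "D \<in> ?P"
    then have "0 \<le> ?e A B C D" by (intro e_nonneg) auto
    moreover have "K A B * K C D \<le> ((K A B)\<^sup>2 + (K C D)\<^sup>2) / 2"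
      using sum_squares_bound[of "K A B" "K C D"] by simp
    ultimately have "K A B * K C D * ?e A B C D \<le> ((K A B)\<^sup>2 + (K C D)\<^sup>2) / 2 * ?e A B C D"
      by (intro mult_right_mono)
    then show "K A B * K C D * ?e A B C D \<le> ((K A B)\<^sup>2 * ?e A B C D + (K C D)\<^sup>2 * ?e A B C D) / 2"
      by (simp add: algebra_simps add_divide_distrib)
  qed
  also have "\<dots> = ((\<Sum>A\<in>?P. \<Sum>B\<in>?P. \<Sum>C\<in>?P. \<Sum>D\<in>?P. (K A B)\<^sup>2 * ?e A B C D)
      + (\<Sum>A\<in>?P. \<Sum>B\<in>?P. \<Sum>C\<in>?P. \<Sum>D\<in>?P. (K C D)\<^sup>2 * ?e A B C D)) / 2"
    by (simp add: sum.distrib flip: sum_divide_distrib)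
  also have "(\<Sum>A\<in>?P. \<Sum>B\<in>?P. \<Sum>C\<in>?P. \<Sum>D\<in>?P. (K C D)\<^sup>2 * ?e A B C D)
      = (\<Sum>A\<in>?P. \<Sum>B\<in>?P. \<Sum>C\<in>?P. \<Sum>D\<in>?P. (K A B)\<^sup>2 * ?e A B C D)" (is "_ = ?H")
    by (subst sum_swap_pairs) (simp add: mult.commute)
  also have "(?H + ?H) / 2 = ?H" by simp
  finally show ?thesis using half by (rule order_trans)
qed

text \<open>
  The part of highest degree of \<open>F\<^sup>2\<close> sees all contractions. With \<open>S' = A - S\<close> and \<open>T' = B - T\<close>, the
  second moment is the sum of \<open>c(S \<union> S') c(T \<union> T') c(S \<union> T) c(S' \<union> T')\<close>. For fixed \<open>S'\<close> and \<open>T\<close>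
  the sums over \<open>S\<close> and over \<open>T'\<close> are the same, so the total is a sum of squares of contractions.
\<close>
lemma wick_square_norm:
  assumes I: "finite I" and c: "homogeneous d c"
  shows "(LINT x|gauss I. (wick_sum I (contr I 0 c c) x)\<^sup>2) = (\<Sum>r\<le>card I. sqnorm I (contr I r c c))"
proof -
  let ?P = "Pow I"
  let ?g = "\<lambda>S S' T. of_bool (S \<inter> S' = {} \<and> S \<inter> T = {}) * (c (S \<union> S') * c (S \<union> T)) :: real"
  have fin: "finite A" if "A \<in> ?P" for A using that I by (auto dest: finite_subset)
  have finS: "finite (splits A B)" if "A \<in> ?P" "B \<in> ?P" for A B
    using fin[OF that(1)] fin[OF that(2)] by (rule finite_splits)
  have "(LINT x|gauss I. (wick_sum I (contr I 0 c c) x)\<^sup>2)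
     = (\<Sum>A\<in>?P. \<Sum>B\<in>?P. \<Sum>z\<in>splits A B. c A * c B * (c (fst z \<union> snd z) * c ((A - fst z) \<union> (B - snd z))))"
    unfolding power2_eq_square integral_wick_sum_splits[OF I] contr_0[OF I] by (simp add: sum_distrib_left split_def)
  also have "\<dots> = (\<Sum>p\<in>?P\<times>?P. \<Sum>z\<in>splits (fst p) (snd p). c (fst p) * c (snd p) * (c (fst z \<union> snd z) * c ((fst p - fst z) \<union> (snd p - snd z))))"
    by (simp add: sum.cartesian_product split_def)
  also have "\<dots> = (\<Sum>(p,z)\<in>(SIGMA p:?P\<times>?P. splits (fst p) (snd p)). c (fst p) * c (snd p) * (c (fst z \<union> snd z) * c ((fst p - fst z) \<union> (snd p - snd z))))"
    by (rule sum.Sigma) (use I finS in auto)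
  also have "\<dots> = (\<Sum>((S',T),(S,T'))\<in>{((S',T),(S,T')). S' \<subseteq> I \<and> T \<subseteq> I \<and> S \<subseteq> I \<and> T' \<subseteq> I \<and>
       S \<inter> S' = {} \<and> S \<inter> T = {} \<and> T' \<inter> S' = {} \<and> T' \<inter> T = {}}. c (S \<union> S') * c (S \<union> T) * (c (T' \<union> S') * c (T' \<union> T)))"
    (is "_ = sum ?h ?H")
  proof (rule sum.reindex_bij_witness[where j="\<lambda>(p,z). ((fst p - fst z, snd z), (fst z, snd p - snd z))"
      and i="\<lambda>((S',T),(S,T')). ((S \<union> S', T \<union> T'), (S, T))"], goal_cases)
    case (1 a) then show ?case by (auto simp: splits_def)
  next
    case (2 a) then show ?case by (auto simp: splits_def, blast+)
  next
    case (3 b) then show ?case by auto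
  next
    case (4 b) then show ?case by (auto simp: splits_def)
  next
    case (5 a)
    then obtain A B S T where a: "a = ((A, B), (S, T))" and st: "S \<subseteq> A" "T \<subseteq> B"
      by (auto simp: splits_def)
    then have "S \<union> (A - S) = A" "(B - T) \<union> T = B" "(B - T) \<union> (A - S) = (A - S) \<union> (B - T)" by auto
    then show ?case by (simp add: a)
  qed
  also have "\<dots> = (\<Sum>((S',T),(S,T'))\<in>(?P\<times>?P)\<times>(?P\<times>?P). ?g S S' T * ?g T' S' T)"
    using I by (intro sum.mono_neutral_cong_left) auto
  also have "\<dots> = (\<Sum>p\<in>?P\<times>?P. \<Sum>q\<in>?P\<times>?P. ?g (fst q) (fst p) (snd p) * ?g (snd q) (fst p) (snd p))"
    by (simp add: sum.cartesian_product split_def)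
  also have "\<dots> = (\<Sum>p\<in>?P\<times>?P. (\<Sum>S\<in>?P. ?g S (fst p) (snd p))\<^sup>2)"
    unfolding power2_eq_square sum_product
    by (rule sum.cong[OF refl]) (simp add: sum.cartesian_product split_def)
  also have "\<dots> = (\<Sum>S'\<in>?P. \<Sum>T\<in>?P. (\<Sum>S\<in>?P. ?g S S' T)\<^sup>2)"
    by (simp add: sum.cartesian_product split_def)
  also have "\<dots> = (\<Sum>S'\<in>?P. \<Sum>T\<in>?P. \<Sum>r\<le>card I. (contr I r c c S' T)\<^sup>2)"
  proof (intro sum.cong refl)
    fix S' T assume ST: "S' \<in> ?P" "T \<in> ?P"
    have "(\<Sum>S\<in>?P. ?g S S' T) = (\<Sum>r\<le>card I. \<Sum>S\<in>?P. of_bool (card S = r) * ?g S S' T)"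
      by (rule sum_of_bool_card[OF I])
    also have "\<dots> = (\<Sum>r\<le>card I. contr I r c c S' T)"
      unfolding contr_of_bool[OF I] by (intro sum.cong refl) (auto simp: of_bool_def)
    \<comment> \<open>By homogeneity only the order \<open>d - card S'\<close> contributes, so squaring commutes with the sum.\<close>
    also have "\<dots>\<^sup>2 = (\<Sum>r\<le>card I. (contr I r c c S' T)\<^sup>2)"
    proof -
      have z: "contr I r c c S' T = 0" if "r \<noteq> d - card S'" for r
        using contr_homogeneous_nonzero(1)[OF I c c, of S' T r] ST that
        by (cases "contr I r c c S' T = 0") auto
      show ?thesis
      proof (cases "d - card S' \<le> card I")
        case True
        have eq: "(\<Sum>r\<le>card I. u r) = u (d - card S')" if "\<And>r. r \<noteq> d - card S' \<Longrightarrow> u r = (0::real)" for u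
        proof -
          have "(\<Sum>r\<le>card I. u r) = (\<Sum>r\<in>{d - card S'}. u r)"
            by (rule sum.mono_neutral_right) (use that True in auto)
          then show ?thesis by simp
        qed
        have "(\<Sum>r\<le>card I. (contr I r c c S' T)\<^sup>2) = (contr I (d - card S') c c S' T)\<^sup>2"
          by (rule eq) (simp add: z)
        moreover have "(\<Sum>r\<le>card I. contr I r c c S' T) = contr I (d - card S') c c S' T"
          by (rule eq) (rule z)
        ultimately show ?thesis by simp
      next
        case False
        then have "contr I r c c S' T = 0" if "r \<le> card I" for r using that by (intro z) auto
        then show ?thesis by simp
      qed
    qed
    finally show "(\<Sum>S\<in>?P. ?g S S' T)\<^sup>2 = (\<Sum>r\<le>card I. (contr I r c c S' T)\<^sup>2)" .
  qed
  also have "\<dots> = (\<Sum>S'\<in>?P. \<Sum>r\<le>card I. \<Sum>T\<in>?P. (contr I r c c S' T)\<^sup>2)"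
    by (rule sum.cong[OF refl], rule sum.swap)
  also have "\<dots> = (\<Sum>r\<le>card I. \<Sum>S'\<in>?P. \<Sum>T\<in>?P. (contr I r c c S' T)\<^sup>2)"
    by (rule sum.swap)
  finally show ?thesis by (simp add: sqnorm_def)
qed


section \<open>Moment estimates\<close>

lemma wick_empty: "wick I {} {} x = 1"
  by (simp add: wick_def)

lemma integral_wick:
  assumes "finite I" "A \<subseteq> I" "B \<subseteq> I"
  shows "(LINT x|gauss I. wick I A B x) = of_bool (A = {} \<and> B = {})"
  using integral_wick_wick[OF assms, of "{}" "{}"] by (auto simp: wick_empty)

lemma integral_multilin_mult:
  assumes I: "finite I"
  shows "(LINT x|gauss I. multilin I c x * multilin I e x) = inner_coeff I c e"
proof -
  have "(LINT x|gauss I. multilin I c x * multilin I e x)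
     = (\<Sum>r\<le>card I. LINT x|gauss I. wick_sum I (contr I r c e) x)"
    unfolding multilin_mult[OF I]
    by (intro Bochner_Integration.integral_sum all_moments_integrable all_moments_wick_sum I)
  also have "\<dots> = (\<Sum>r\<le>card I. contr I r c e {} {})"
  proof (rule sum.cong[OF refl])
    fix r
    have "(LINT x|gauss I. wick_sum I (contr I r c e) x)
      = (\<Sum>A\<in>Pow I. LINT x|gauss I. (\<Sum>B\<in>Pow I. contr I r c e A B * wick I A B x))"
      unfolding wick_sum_def
      by (intro Bochner_Integration.integral_sum all_moments_integrable gauss_moments all_moments_wick I)
    also have "\<dots> = (\<Sum>A\<in>Pow I. \<Sum>B\<in>Pow I. LINT x|gauss I. (contr I r c e A B * wick I A B x))"
      by (intro sum.cong refl Bochner_Integration.integral_sum all_moments_integrable gauss_moments all_moments_wick I)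
    also have "\<dots> = (\<Sum>A\<in>Pow I. \<Sum>B\<in>Pow I. if B = {} then (if A = {} then contr I r c e A B else 0) else 0)"
      by (intro sum.cong refl) (simp add: integral_wick[OF I])
    also have "\<dots> = (\<Sum>A\<in>Pow I. if A = {} then contr I r c e {} {} else 0)"
      using I by (intro sum.cong refl) (simp add: sum.delta)
    also have "\<dots> = contr I r c e {} {}"
      using I by (simp add: sum.delta)
    finally show "(LINT x|gauss I. wick_sum I (contr I r c e) x) = contr I r c e {} {}" .
  qed
  also have "\<dots> = (\<Sum>r\<le>card I. \<Sum>C\<in>Pow I. of_bool (card C = r) * (c C * e C))"
    by (simp add: contr_of_bool[OF I])
  also have "\<dots> = inner_coeff I c e"
    unfolding inner_coeff_def by (rule sum_of_bool_card[OF I, symmetric])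
  finally show ?thesis .
qed

lemma contr_degree:
  assumes I: "finite I" and c: "homogeneous p c" and e: "homogeneous q e"
    and AB: "A \<subseteq> I" "B \<subseteq> I" and nz: "contr I r c e A B \<noteq> 0"
  shows "card A + card B = p + q - 2 * r"
  using contr_homogeneous_nonzero[OF I c e AB nz] by simp

lemma contr_eq_0:
  assumes I: "finite I" and c: "homogeneous p c" and e: "homogeneous q e"
    and AB: "A \<subseteq> I" "B \<subseteq> I" and r: "r > p \<or> r > q"
  shows "contr I r c e A B = 0"
  using contr_homogeneous_nonzero[OF I c e AB, of r] r by fastforce

lemma wick_sum_cong:
  assumes "\<And>A B. A \<subseteq> I \<Longrightarrow> B \<subseteq> I \<Longrightarrow> K A B = L A B"
  shows "wick_sum I K x = wick_sum I L x"
  unfolding wick_sum_def using assms by (intro sum.cong refl) auto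

lemma wick_sum_contr_top:
  assumes I: "finite I" and c: "homogeneous d c" and e: "homogeneous d e"
  shows "wick_sum I (contr I d c e) x = inner_coeff I c e"
proof -
  let ?v = "inner_coeff I c e"
  have "wick_sum I (contr I d c e) x = wick_sum I (\<lambda>A B. if A = {} \<and> B = {} then ?v else 0) x"
    by (rule wick_sum_cong) (rule contr_top[OF I c e])
  also have "\<dots> = (\<Sum>A\<in>Pow I. \<Sum>B\<in>Pow I. if B = {} then (if A = {} then ?v else 0) else 0)"
    unfolding wick_sum_def by (intro sum.cong refl) (auto simp: wick_empty)
  also have "\<dots> = ?v" using I by (simp add: sum.delta)
  finally show ?thesis .
qed

lemma wick_sum_contr_eq_0:
  assumes I: "finite I" and c: "homogeneous p c" and e: "homogeneous q e" and r: "r > p \<or> r > q"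
  shows "wick_sum I (contr I r c e) x = 0"
proof -
  have "wick_sum I (contr I r c e) x = wick_sum I (\<lambda>_ _. 0) x"
    by (rule wick_sum_cong) (rule contr_eq_0[OF I c e _ _ r])
  then show ?thesis by (simp add: wick_sum_def)
qed

lemma integral_wick_sum_contr_orthogonal:
  assumes I: "finite I" and c: "homogeneous p c" and e: "homogeneous q e" and "r \<noteq> s"
  shows "(LINT x|gauss I. wick_sum I (contr I r c e) x * wick_sum I (contr I s c e) x) = 0"
proof (cases "r > p \<or> r > q \<or> s > p \<or> s > q")
  case True
  then have "wick_sum I (contr I r c e) x * wick_sum I (contr I s c e) x = 0" for x
    using wick_sum_contr_eq_0[OF I c e] by auto
  then show ?thesis by (simp only: Bochner_Integration.integral_zero)
next
  case False
  show ?thesis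
    by (rule wick_sum_orthogonal[OF I, of "p + q - 2 * r" "p + q - 2 * s"])
      (use False \<open>r \<noteq> s\<close> in \<open>auto intro!: contr_degree[OF I c e]\<close>)
qed

lemma integral_square_orthogonal:
  fixes u :: "'b \<Rightarrow> (nat \<Rightarrow> real) \<Rightarrow> real"
  assumes R: "finite R" and u: "\<And>r. r \<in> R \<Longrightarrow> all_moments (gauss I) (u r)"
    and orth: "\<And>r s. r \<in> R \<Longrightarrow> s \<in> R \<Longrightarrow> r \<noteq> s \<Longrightarrow> (LINT x|gauss I. u r x * u s x) = 0"
  shows "(LINT x|gauss I. (\<Sum>r\<in>R. u r x)\<^sup>2) = (\<Sum>r\<in>R. LINT x|gauss I. (u r x)\<^sup>2)"
proof -
  have "(LINT x|gauss I. (\<Sum>r\<in>R. u r x)\<^sup>2) = (LINT x|gauss I. (\<Sum>r\<in>R. \<Sum>s\<in>R. u r x * u s x))"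
    by (simp add: power2_eq_square sum_product)
  also have "\<dots> = (\<Sum>r\<in>R. LINT x|gauss I. (\<Sum>s\<in>R. u r x * u s x))"
    by (intro Bochner_Integration.integral_sum all_moments_integrable gauss_sum all_moments_mult u)
  also have "\<dots> = (\<Sum>r\<in>R. \<Sum>s\<in>R. LINT x|gauss I. u r x * u s x)"
    by (intro sum.cong refl Bochner_Integration.integral_sum all_moments_integrable all_moments_mult u)
  also have "\<dots> = (\<Sum>r\<in>R. \<Sum>s\<in>R. if s = r then LINT x|gauss I. (u r x)\<^sup>2 else 0)"
    by (intro sum.cong refl) (auto simp: orth power2_eq_square)
  also have "\<dots> = (\<Sum>r\<in>R. LINT x|gauss I. (u r x)\<^sup>2)"
    using R by (simp add: sum.delta)
  finally show ?thesis .
qed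

text \<open>
  The order zero alone contributes \<open>2 (E F\<^sup>2)\<^sup>2\<close> and the contractions, the constant term of order \<open>d\<close>
  contributes the third \<open>(E F\<^sup>2)\<^sup>2\<close>, and the remaining orders are nonnegative.
\<close>
lemma fourth_moment_lower_bound:
  assumes I: "finite I" and c: "homogeneous d c" and d: "1 \<le> d"
  shows "3 * (inner_coeff I c c)\<^sup>2 + (\<Sum>r\<in>{1..<d}. sqnorm I (contr I r c c))
    \<le> (LINT x|gauss I. (multilin I c x) ^ 4)"
proof (cases "d \<le> card I")
  case True
  let ?W = "\<lambda>r. wick_sum I (contr I r c c)"
  let ?v = "inner_coeff I c c"
  interpret prob_space "gauss I" by (rule prob_space_gauss)
  have "(LINT x|gauss I. (multilin I c x) ^ 4) = (LINT x|gauss I. (\<Sum>r\<le>card I. ?W r x)\<^sup>2)"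
    by (simp add: power4_eq_xxxx power2_eq_square multilin_mult[OF I, symmetric] mult.assoc)
  also have "\<dots> = (\<Sum>r\<le>card I. LINT x|gauss I. (?W r x)\<^sup>2)"
    by (rule integral_square_orthogonal)
      (auto intro!: all_moments_wick_sum[OF I] integral_wick_sum_contr_orthogonal[OF I c c])
  finally have m4: "(LINT x|gauss I. (multilin I c x) ^ 4) = (\<Sum>r\<le>card I. LINT x|gauss I. (?W r x)\<^sup>2)" .
  have "(\<Sum>r\<in>{0, d}. LINT x|gauss I. (?W r x)\<^sup>2) \<le> (\<Sum>r\<le>card I. LINT x|gauss I. (?W r x)\<^sup>2)"
    using True by (intro sum_mono2) auto
  moreover have "?W d x = ?v" for x by (rule wick_sum_contr_top[OF I c c])
  then have "(\<Sum>r\<in>{0, d}. LINT x|gauss I. (?W r x)\<^sup>2) = (LINT x|gauss I. (?W 0 x)\<^sup>2) + ?v\<^sup>2"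
    using d by (simp add: prob_space)
  moreover have "(LINT x|gauss I. (?W 0 x)\<^sup>2) = (\<Sum>r\<le>card I. sqnorm I (contr I r c c))"
    by (rule wick_square_norm[OF I c])
  moreover have "(\<Sum>r\<in>insert 0 (insert d {1..<d}). sqnorm I (contr I r c c)) \<le> (\<Sum>r\<le>card I. sqnorm I (contr I r c c))"
    using True by (intro sum_mono2) (auto simp: sqnorm_nonneg)
  moreover have "(\<Sum>r\<in>insert 0 (insert d {1..<d}). sqnorm I (contr I r c c))
      = ?v\<^sup>2 + ?v\<^sup>2 + (\<Sum>r\<in>{1..<d}. sqnorm I (contr I r c c))"
    using d by (simp add: sqnorm_contr_0[OF I] sqnorm_contr_top[OF I c])
  ultimately show ?thesis unfolding m4 by linarith
next
  case False
  have z: "c A = 0" if "A \<subseteq> I" for A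
    using card_mono[OF I that] False c by (auto simp: homogeneous_def)
  have "contr I r c c A B = 0" if "A \<subseteq> I" for r A B
    unfolding contr_def using z that by (intro sum.neutral) auto
  then show ?thesis by (simp add: inner_coeff_def z sqnorm_def multilin_def)
qed

text \<open>
  If \<open>p = q\<close>, the term of order \<open>p\<close> is the constant that is subtracted; if \<open>p \<noteq> q\<close>, that
  constant is zero and no order is exceptional. The other terms are orthogonal.
\<close>
lemma carre_du_champ_variance:
  assumes I: "finite I" and c: "homogeneous p c" and e: "homogeneous q e" and p: "1 \<le> p" and q: "1 \<le> q"
  shows "(LINT x|gauss I. (carre_du_champ I c e x - p * inner_coeff I c e)\<^sup>2)
    \<le> (\<Sum>r\<in>{r. 1 \<le> r \<and> r \<le> p \<and> r \<le> q \<and> \<not> (r = p \<and> r = q)}.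
         (real r)\<^sup>2 * 2 ^ (p + q) * sqnorm I (contr I r c e))"
proof -
  let ?W = "\<lambda>r. wick_sum I (contr I r c e)"
  let ?R = "{r. 1 \<le> r \<and> r \<le> p \<and> r \<le> q \<and> \<not> (r = p \<and> r = q)}"
  have finR: "finite ?R" by (rule finite_subset[of _ "{..p}"]) auto
  have zero_big: "?W r x = 0" if "r > card I" for r x
  proof -
    have "contr I r c e A B = 0" for A B
      unfolding contr_def using that card_mono[OF I] by (intro sum.neutral) (auto simp: not_le[symmetric])
    then show ?thesis by (simp add: wick_sum_def)
  qed
  have expand: "carre_du_champ I c e x - p * inner_coeff I c e = (\<Sum>r\<in>?R. r * ?W r x)" for x
  proof -
    have "carre_du_champ I c e x = (\<Sum>r\<le>card I. real (Suc r) * ?W (Suc r) x)"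
      by (rule carre_du_champ_expansion[OF I])
    also have "\<dots> = (\<Sum>r\<in>{1..Suc (card I)}. r * ?W r x)"
      by (rule sum.reindex_bij_witness[where i="\<lambda>r. r - 1" and j=Suc]) auto
    also have "\<dots> = (\<Sum>r\<in>{1..p + Suc (card I)}. r * ?W r x)"
      by (rule sum.mono_neutral_left) (auto simp: zero_big)
    \<comment> \<open>The order \<open>p\<close> lies in \<open>?R\<close> if \<open>p < q\<close>, is the constant if \<open>p = q\<close>, and vanishes if \<open>p > q\<close>.\<close>
    also have "\<dots> = (\<Sum>r\<in>?R \<union> {p}. r * ?W r x)"
    proof (rule sum.mono_neutral_right)
      show "\<forall>r\<in>{1..p + Suc (card I)} - (?R \<union> {p}). r * ?W r x = 0"
      proof
        fix r assume "r \<in> {1..p + Suc (card I)} - (?R \<union> {p})"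
        then have "r > p \<or> r > q" by auto
        from wick_sum_contr_eq_0[OF I c e this] show "r * ?W r x = 0" by simp
      qed
    qed (use p in auto)
    also have "\<dots> = (\<Sum>r\<in>?R. r * ?W r x) + p * inner_coeff I c e"
    proof (cases "p = q")
      case True
      have "?W p x = inner_coeff I c e"
        using wick_sum_contr_top[OF I c, of e] e True by simp
      moreover have "p \<notin> ?R" using True by simp
      ultimately show ?thesis using finR by simp
    next
      case False
      have "inner_coeff I c e = 0"
        unfolding inner_coeff_def using c e False by (intro sum.neutral) (auto simp: homogeneous_def)
      moreover have "(\<Sum>r\<in>?R \<union> {p}. r * ?W r x) = (\<Sum>r\<in>?R. r * ?W r x)"
      proof (cases "p \<in> ?R")
        case True
        then show ?thesis by (simp add: insert_absorb)
      next
        case pR: False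
        then have "p > q" using p False by auto
        then have "?W p x = 0" using wick_sum_contr_eq_0[OF I c e] by blast
        then show ?thesis using pR finR by simp
      qed
      ultimately show ?thesis by simp
    qed
    finally show ?thesis by simp
  qed
  have "(LINT x|gauss I. (carre_du_champ I c e x - p * inner_coeff I c e)\<^sup>2)
     = (LINT x|gauss I. (\<Sum>r\<in>?R. r * ?W r x)\<^sup>2)"
    by (simp only: expand)
  also have "\<dots> = (\<Sum>r\<in>?R. LINT x|gauss I. (r * ?W r x)\<^sup>2)"
  proof (rule integral_square_orthogonal[OF finR])
    show "all_moments (gauss I) (\<lambda>x. r * ?W r x)" for r :: nat
      by (intro gauss_moments all_moments_wick_sum I)
    fix r s :: nat assume "r \<noteq> s"
    from integral_wick_sum_contr_orthogonal[OF I c e this]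
    have "(LINT x|gauss I. (real r * real s) * (?W r x * ?W s x)) = 0" by simp
    then show "(LINT x|gauss I. (r * ?W r x) * (s * ?W s x)) = 0" by (simp add: mult_ac)
  qed
  also have "\<dots> = (\<Sum>r\<in>?R. (real r)\<^sup>2 * (LINT x|gauss I. (?W r x)\<^sup>2))"
    by (simp add: power_mult_distrib)
  also have "\<dots> \<le> (\<Sum>r\<in>?R. (real r)\<^sup>2 * 2 ^ (p + q) * sqnorm I (contr I r c e))"
  proof (rule sum_mono)
    fix r
    have "(LINT x|gauss I. (?W r x)\<^sup>2) \<le> 2 ^ (p + q - 2 * r) * sqnorm I (contr I r c e)"
      by (rule wick_sum_sq_le[OF I]) (rule contr_degree[OF I c e])
    also have "\<dots> \<le> 2 ^ (p + q) * sqnorm I (contr I r c e)"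
      by (intro mult_right_mono power_increasing sqnorm_nonneg) auto
    finally show "(real r)\<^sup>2 * (LINT x|gauss I. (?W r x)\<^sup>2) \<le> (real r)\<^sup>2 * 2 ^ (p + q) * sqnorm I (contr I r c e)"
      by (simp add: mult.assoc mult_left_mono)
  qed
  finally show ?thesis .
qed

lemma multilin_insert:
  assumes I: "finite I" and i: "i \<notin> I"
  shows "multilin (insert i I) c x = multilin I c x + x i * multilin I (\<lambda>A. c (insert i A)) x"
proof -
  have "multilin (insert i I) c x = multilin I c x + (\<Sum>A\<in>insert i ` Pow I. c A * (\<Prod>j\<in>A. x j))"
    unfolding multilin_def Pow_insert using I i by (intro sum.union_disjoint) auto
  also have "(\<Sum>A\<in>insert i ` Pow I. c A * (\<Prod>j\<in>A. x j)) = (\<Sum>A\<in>Pow I. c (insert i A) * (\<Prod>j\<in>insert i A. x j))"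
    using i by (intro sum.reindex_cong[where l="insert i"]) (auto intro!: inj_onI)
  also have "\<dots> = (\<Sum>A\<in>Pow I. x i * (c (insert i A) * (\<Prod>j\<in>A. x j)))"
  proof (intro sum.cong refl)
    fix A assume "A \<in> Pow I"
    then have "finite A" "i \<notin> A" using I i by (auto dest: finite_subset)
    then show "c (insert i A) * (\<Prod>j\<in>insert i A. x j) = x i * (c (insert i A) * (\<Prod>j\<in>A. x j))"
      by simp
  qed
  finally show ?thesis by (simp add: multilin_def sum_distrib_left)
qed

lemma multilin_fun_upd: "i \<notin> I \<Longrightarrow> multilin I c (x(i := y)) = multilin I c x"
  unfolding multilin_def by (intro sum.cong refl arg_cong2[of _ _ _ _ "(*)"] prod.cong) auto

lemma gauss_integral_insert:
  fixes f :: "(nat \<Rightarrow> real) \<Rightarrow> 'b::{banach, second_countable_topology}"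
  assumes "finite I" "i \<notin> I" "integrable (gauss (insert i I)) f"
  shows "integral\<^sup>L (gauss (insert i I)) f = (LINT x|gauss I. (LINT y|std_normal_distribution. f (x(i := y))))"
  using assms unfolding gauss_def by (rule std_normals.product_integral_insert)

lemma std_normal_sixth_power:
  "(LINT y|std_normal_distribution. (a + y * b) ^ 6) = a^6 + 15 * (a^4 * b\<^sup>2) + 45 * (a\<^sup>2 * b^4) + 15 * b^6"
proof -
  let ?M = std_normal_distribution
  have "has_bochner_integral ?M (\<lambda>y. a^6 * 1 + 6 * a^5 * b * y + 15 * a^4 * b^2 * y^2 + 20 * a^3 * b^3 * y^3
      + 15 * a^2 * b^4 * y^4 + 6 * a * b^5 * y^5 + b^6 * y^6)
    (a^6 * 1 + 6 * a^5 * b * 0 + 15 * a^4 * b^2 * 1 + 20 * a^3 * b^3 * 0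
      + 15 * a^2 * b^4 * 3 + 6 * a * b^5 * 0 + b^6 * 15)"
    by (intro has_bochner_integral_add has_bochner_integral_mult_right std_normal_moments)
  moreover have "(a + y * b) ^ 6 = a^6 * 1 + 6 * a^5 * b * y + 15 * a^4 * b^2 * y^2 + 20 * a^3 * b^3 * y^3
      + 15 * a^2 * b^4 * y^4 + 6 * a * b^5 * y^5 + b^6 * y^6" for y
    by algebra
  ultimately show ?thesis by (simp add: has_bochner_integral_integral_eq)
qed

text \<open>
  The parameter \<open>s\<close> is optimised later; this replaces Hoelder's inequality for the mixed moments.
\<close>
lemma amgm_weighted:
  fixes u v s :: real
  assumes "0 \<le> u" "0 \<le> v" "0 < s"
  shows "u\<^sup>2 * v \<le> (2 * s * u ^ 3 + v ^ 3 / s\<^sup>2) / 3"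
proof -
  \<comment> \<open>In terms of \<open>w = v / s\<close> the two sides differ by \<open>s (u - w)\<^sup>2 (2 u + w) / 3\<close>.\<close>
  define w where "w = v / s"
  have v: "v = s * w" and w: "0 \<le> w" using assms by (auto simp: w_def)
  have "0 \<le> s * ((u - w)\<^sup>2 * (2 * u + w))" using assms w by (intro mult_nonneg_nonneg) auto
  moreover have "v ^ 3 / s\<^sup>2 = s * w ^ 3" using assms unfolding v by (simp add: field_simps power2_eq_square power3_eq_cube)
  ultimately show ?thesis unfolding v by (simp add: algebra_simps power2_eq_square power3_eq_cube)
qed

lemma inner_coeff_insert:
  assumes I: "finite I" and i: "i \<notin> I"
  shows "inner_coeff (insert i I) c e = inner_coeff I c e + inner_coeff I (\<lambda>A. c (insert i A)) (\<lambda>A. e (insert i A))"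
proof -
  have "inner_coeff (insert i I) c e = inner_coeff I c e + (\<Sum>A\<in>insert i ` Pow I. c A * e A)"
    unfolding inner_coeff_def Pow_insert using I i by (intro sum.union_disjoint) auto
  also have "(\<Sum>A\<in>insert i ` Pow I. c A * e A) = (\<Sum>A\<in>Pow I. c (insert i A) * e (insert i A))"
    using i by (intro sum.reindex_cong[where l="insert i"]) (auto intro!: inj_onI)
  finally show ?thesis by (simp add: inner_coeff_def)
qed

lemma inner_coeff_nonneg: "0 \<le> inner_coeff I c c"
  unfolding inner_coeff_def by (intro sum_nonneg) auto

lemma inner_coeff_eq_0D:
  assumes "finite I" "inner_coeff I c c = 0" "A \<subseteq> I"
  shows "c A = 0"
  using assms unfolding inner_coeff_def by (subst (asm) sum_nonneg_eq_0_iff) auto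

lemma multilin_eq_0:
  assumes "\<And>A. A \<subseteq> I \<Longrightarrow> c A = 0"
  shows "multilin I c x = 0"
  unfolding multilin_def using assms by (intro sum.neutral) auto

text \<open>
  Hypercontractivity, by induction on the number of variables. Splitting off one variable,
  \<open>F = A + x\<^sub>i B\<close>, the expectation in \<open>x\<^sub>i\<close> is \<open>A\<^sup>6 + 15 A\<^sup>4 B\<^sup>2 + 45 A\<^sup>2 B\<^sup>4 + 15 B\<^sup>6\<close>, and \<open>B\<close> has smaller
  degree. The constant is \<open>5\<^sup>3\<close> because the induction closes as soon as
  \<open>a\<^sup>3 + 15 a\<^sup>2 (b/5) + 45 a (b/5)\<^sup>2 + 15 (b/5)\<^sup>3 \<le> (a + b)\<^sup>3\<close>.
\<close>
lemma sixth_moment_bound: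
  assumes "finite I" and "\<And>A. A \<subseteq> I \<Longrightarrow> c A \<noteq> 0 \<Longrightarrow> card A \<le> d"
  shows "(LINT x|gauss I. multilin I c x ^ 6) \<le> 125 ^ d * inner_coeff I c c ^ 3"
  using assms
proof (induction I arbitrary: c d rule: finite_induct)
  case empty
  interpret prob_space "gauss {}" by (rule prob_space_gauss)
  have "(LINT x|gauss {}. multilin {} c x ^ 6) = c {} ^ 6"
    by (simp add: multilin_def prob_space)
  also have "\<dots> = 1 * inner_coeff {} c c ^ 3"
    by (simp add: inner_coeff_def power_mult_distrib flip: power_add)
  also have "\<dots> \<le> 125 ^ d * inner_coeff {} c c ^ 3"
    by (intro mult_right_mono zero_le_power inner_coeff_nonneg) simp
  finally show ?case .
next
  case (insert i I)
  note I = insert.hyps(1) and i = insert.hyps(2)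
  let ?c' = "\<lambda>A. c (insert i A)"
  let ?A = "multilin I c" and ?B = "multilin I ?c'"
  let ?a = "inner_coeff I c c" and ?b = "inner_coeff I ?c' ?c'"
  let ?E = "\<lambda>u. (LINT x|gauss I. u x :: real)"
  let ?K = "125 ^ d :: real"
  have mA: "all_moments (gauss I) ?A" and mB: "all_moments (gauss I) ?B"
    using I by (auto intro!: all_moments_multilin)
  have degA: "card A \<le> d" if "A \<subseteq> I" "c A \<noteq> 0" for A
    using insert.prems[of A] that by auto
  have EA: "?E (\<lambda>x. ?A x ^ 6) \<le> ?K * ?a ^ 3"
    using degA by (rule insert.IH)
  have EB: "?E (\<lambda>x. ?B x ^ 6) \<le> ?K * (?b / 5) ^ 3"
  proof (cases "?b = 0")
    case True
    from inner_coeff_eq_0D[OF I this] have "?B x = 0" for x by (intro multilin_eq_0) auto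
    then show ?thesis using True by simp
  next
    case False
    then obtain A where A: "A \<subseteq> I" "?c' A \<noteq> 0"
      unfolding inner_coeff_def by (auto elim!: sum.not_neutral_contains_not_neutral)
    have deg': "card A + 1 \<le> d" if "A \<subseteq> I" "?c' A \<noteq> 0" for A
    proof -
      have "card (insert i A) = Suc (card A)"
        using that i finite_subset[OF that(1) I] by (intro card_insert_disjoint) auto
      moreover have "card (insert i A) \<le> d" using that by (intro insert.prems) auto
      ultimately show ?thesis by simp
    qed
    then obtain d' where d': "d = Suc d'" using A by (cases d) fastforce+
    have "?E (\<lambda>x. ?B x ^ 6) \<le> 125 ^ d' * ?b ^ 3"
      using deg' d' by (intro insert.IH) auto
    also have "\<dots> = ?K * (?b / 5) ^ 3" unfolding d' by (simp add: power_divide)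
    finally show ?thesis .
  qed
  have int: "integrable (gauss I) (\<lambda>x. ?A x ^ k * ?B x ^ l)" for k l
    by (intro all_moments_integrable gauss_moments mA mB)
  have int6: "integrable (gauss I) (\<lambda>x. ?A x ^ 6)" "integrable (gauss I) (\<lambda>x. ?B x ^ 6)"
    using int[of 6 0] int[of 0 6] by auto
  have ab: "0 \<le> ?a" "0 \<le> ?b" by (rule inner_coeff_nonneg)+
  have mixed: "?E (\<lambda>x. ?A x ^ 4 * ?B x ^ 2) \<le> ?K * (?a\<^sup>2 * (?b / 5)) \<and> ?E (\<lambda>x. ?A x ^ 2 * ?B x ^ 4) \<le> ?K * (?a * (?b / 5)\<^sup>2)"
  proof (cases "?a = 0 \<or> ?b = 0")
    case True
    then have "(\<forall>x. ?A x = 0) \<or> (\<forall>x. ?B x = 0)"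
      using inner_coeff_eq_0D[OF I, of c] inner_coeff_eq_0D[OF I, of ?c'] multilin_eq_0[of I c] multilin_eq_0[of I ?c'] by blast
    then have "?A x ^ 4 * ?B x ^ 2 = 0" "?A x ^ 2 * ?B x ^ 4 = 0" for x by auto
    then have "?E (\<lambda>x. ?A x ^ 4 * ?B x ^ 2) = 0" "?E (\<lambda>x. ?A x ^ 2 * ?B x ^ 4) = 0"
      by (simp_all only: Bochner_Integration.integral_zero)
    then show ?thesis using ab by simp
  next
    case False
    \<comment> \<open>This weight makes the two terms of the weighted inequality proportional to the same monomial in \<open>a\<close> and \<open>b\<close>.\<close>
    define s where "s = (?b / 5) / ?a"
    have pos: "0 < ?a" "0 < ?b" "0 < s" using False ab by (auto simp: s_def)
    have holder: "?E (\<lambda>x. u x ^ 4 * v x ^ 2) \<le> (2 * t * ?E (\<lambda>x. u x ^ 6) + ?E (\<lambda>x. v x ^ 6) / t\<^sup>2) / 3"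
      if t: "0 < t" and uv: "all_moments (gauss I) u" "all_moments (gauss I) v" for u v t
    proof -
      have i1: "integrable (gauss I) (\<lambda>x. u x ^ 6)" "integrable (gauss I) (\<lambda>x. v x ^ 6)"
        "integrable (gauss I) (\<lambda>x. u x ^ 4 * v x ^ 2)"
        by (intro all_moments_integrable gauss_moments uv)+
      have "?E (\<lambda>x. u x ^ 4 * v x ^ 2) \<le> ?E (\<lambda>x. (2 * t * u x ^ 6 + v x ^ 6 / t\<^sup>2) / 3)"
      proof (rule integral_mono)
        fix x
        show "u x ^ 4 * v x ^ 2 \<le> (2 * t * u x ^ 6 + v x ^ 6 / t\<^sup>2) / 3"
          using amgm_weighted[of "(u x)\<^sup>2" "(v x)\<^sup>2" t] t by (simp flip: power_mult)
      qed (use i1 in simp_all)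
      then show ?thesis using i1 by simp
    qed
    have "?E (\<lambda>x. ?A x ^ 4 * ?B x ^ 2) \<le> (2 * s * (?K * ?a ^ 3) + (?K * (?b / 5) ^ 3) / s\<^sup>2) / 3"
      using EA EB pos
      by (intro order_trans[OF holder[OF pos(3) mA mB]] divide_right_mono add_mono mult_left_mono) auto
    also have "\<dots> = ?K * (?a\<^sup>2 * (?b / 5))"
      using pos unfolding s_def by (simp add: field_simps power2_eq_square power3_eq_cube)
    finally have 1: "?E (\<lambda>x. ?A x ^ 4 * ?B x ^ 2) \<le> ?K * (?a\<^sup>2 * (?b / 5))" .
    have "?E (\<lambda>x. ?B x ^ 4 * ?A x ^ 2) \<le> (2 * (1/s) * (?K * (?b / 5) ^ 3) + (?K * ?a ^ 3) / (1/s)\<^sup>2) / 3"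
      using EA EB pos
      by (intro order_trans[OF holder[OF _ mB mA, of "1/s"]] divide_right_mono add_mono mult_left_mono) auto
    also have "\<dots> = ?K * (?a * (?b / 5)\<^sup>2)"
      using pos unfolding s_def by (simp add: field_simps power2_eq_square power3_eq_cube)
    finally show ?thesis using 1 by (simp add: mult.commute)
  qed
  have "(LINT x|gauss (insert i I). multilin (insert i I) c x ^ 6)
    = (LINT x|gauss I. (LINT y|std_normal_distribution. multilin (insert i I) c (x(i := y)) ^ 6))"
    by (intro gauss_integral_insert I i all_moments_integrable gauss_moments all_moments_multilin)
      (use I in auto)
  also have "\<dots> = ?E (\<lambda>x. ?A x ^ 6 + 15 * (?A x ^ 4 * ?B x ^ 2) + 45 * (?A x ^ 2 * ?B x ^ 4) + 15 * ?B x ^ 6)"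
    by (simp add: multilin_insert[OF I i] multilin_fun_upd[OF i] std_normal_sixth_power)
  also have "\<dots> = ?E (\<lambda>x. ?A x ^ 6) + 15 * ?E (\<lambda>x. ?A x ^ 4 * ?B x ^ 2) + 45 * ?E (\<lambda>x. ?A x ^ 2 * ?B x ^ 4) + 15 * ?E (\<lambda>x. ?B x ^ 6)"
    using int int6 by simp
  also have "\<dots> \<le> ?K * ?a ^ 3 + 15 * (?K * (?a\<^sup>2 * (?b / 5))) + 45 * (?K * (?a * (?b / 5)\<^sup>2)) + 15 * (?K * (?b / 5) ^ 3)"
    using mixed EA EB by (intro add_mono mult_left_mono) auto
  also have "\<dots> \<le> ?K * (?a + ?b) ^ 3"
  proof -
    have "?a ^ 3 + 15 * (?a\<^sup>2 * (?b / 5)) + 45 * (?a * (?b / 5)\<^sup>2) + 15 * (?b / 5) ^ 3 \<le> (?a + ?b) ^ 3"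
    proof -
      have "0 \<le> ?a * ?b\<^sup>2" "0 \<le> ?b ^ 3" using ab by auto
      then show ?thesis by (simp add: power2_eq_square power3_eq_cube algebra_simps)
    qed
    then have "?K * (?a ^ 3 + 15 * (?a\<^sup>2 * (?b / 5)) + 45 * (?a * (?b / 5)\<^sup>2) + 15 * (?b / 5) ^ 3) \<le> ?K * (?a + ?b) ^ 3"
      by (intro mult_left_mono) auto
    then show ?thesis by (simp add: algebra_simps)
  qed
  finally show ?case by (simp add: inner_coeff_insert[OF I i])
qed


section \<open>Characteristic functions and integration by parts\<close>

lemma norm_integral_le:
  fixes f :: "'a \<Rightarrow> 'b::{banach, second_countable_topology}"
  assumes "integrable M f" "integrable M g" "\<And>x. norm (f x) \<le> g x"
  shows "norm (integral\<^sup>L M f) \<le> integral\<^sup>L M g"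
  using assms by (intro order_trans[OF integral_norm_bound] integral_mono) auto

lemma has_vector_derivative_quadratic_error:
  fixes f :: "real \<Rightarrow> complex"
  assumes "\<And>h. norm (f (t + h) - f t - h *\<^sub>R D) \<le> C * h\<^sup>2"
  shows "(f has_vector_derivative D) (at t)"
  unfolding has_vector_derivative_def has_derivative_at
proof
  show "bounded_linear (\<lambda>h. h *\<^sub>R D)" by (rule bounded_linear_scaleR_left)
  show "(\<lambda>h. norm (f (t + h) - f t - h *\<^sub>R D) / norm h) \<midarrow>0\<rightarrow> 0"
  proof (rule Lim_null_comparison)
    show "\<forall>\<^sub>F h in at 0. norm (norm (f (t + h) - f t - h *\<^sub>R D) / norm h) \<le> C * \<bar>h\<bar>"
    proof (rule eventually_at_ball'[of 1, THEN eventually_mono])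
      fix h :: real assume "h \<in> ball 0 1 \<and> h \<noteq> 0 \<and> h \<in> UNIV"
      then have "h \<noteq> 0" by simp
      then show "norm (norm (f (t + h) - f t - h *\<^sub>R D) / norm h) \<le> C * \<bar>h\<bar>"
        using assms[of h] by (simp add: field_simps power2_eq_square)
    qed simp
    have "((\<lambda>h. C * \<bar>h\<bar>) \<longlongrightarrow> C * \<bar>0\<bar>) (at (0::real))"
      by (intro tendsto_intros)
    then show "((\<lambda>h. C * \<bar>h\<bar>) \<longlongrightarrow> 0) (at (0::real))" by simp
  qed
qed

lemma (in prob_space) integrable_times_iexp:
  assumes u: "integrable M u" and v: "v \<in> borel_measurable M"
  shows "integrable M (\<lambda>x. complex_of_real (u x) * iexp (v x))"
proof (rule Bochner_Integration.integrable_bound)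
  have [measurable]: "u \<in> borel_measurable M" "v \<in> borel_measurable M" using u v by auto
  show "integrable M u" by fact
  show "(\<lambda>x. complex_of_real (u x) * iexp (v x)) \<in> borel_measurable M" by measurable
qed (auto simp: norm_mult)

lemma (in prob_space) has_vector_derivative_expectation_iexp:
  assumes u: "all_moments M u"
  shows "((\<lambda>t. CLINT x|M. iexp (t * u x)) has_vector_derivative
           (CLINT x|M. \<i> * (u x * iexp (t * u x)))) (at t)"
proof (rule has_vector_derivative_quadratic_error)
  fix h :: real
  have [measurable]: "u \<in> borel_measurable M" using u by (rule all_moments_measurable)
  have u2: "integrable M (\<lambda>x. (u x)\<^sup>2)"
    by (intro all_moments_integrable all_moments_power u)
  have i1: "integrable M (\<lambda>x. iexp (s * u x))" for s
    using integrable_times_iexp[of "\<lambda>_. 1" "\<lambda>x. s * u x"] by simp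
  have i2: "integrable M (\<lambda>x. \<i> * (u x * iexp (t * u x)))"
    using integrable_times_iexp[OF all_moments_integrable[OF u], of "\<lambda>x. t * u x"]
    by (intro integrable_mult_right) simp
  have i3: "integrable M (\<lambda>x. h *\<^sub>R (\<i> * (u x * iexp (t * u x))))"
    using i2 by (rule integrable_scaleR_right)
  have "(CLINT x|M. iexp ((t + h) * u x)) - (CLINT x|M. iexp (t * u x)) - h *\<^sub>R (CLINT x|M. \<i> * (u x * iexp (t * u x)))
     = (CLINT x|M. iexp ((t + h) * u x) - iexp (t * u x) - h *\<^sub>R (\<i> * (u x * iexp (t * u x))))"
    by (simp only: Bochner_Integration.integral_diff[OF Bochner_Integration.integrable_diff[OF i1 i1] i3]
        Bochner_Integration.integral_diff[OF i1 i1] integral_scaleR_right)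
  also have "norm \<dots> \<le> (LINT x|M. (h\<^sup>2 / 2) * (u x)\<^sup>2)"
  proof (rule norm_integral_le)
    show "integrable M (\<lambda>x. iexp ((t + h) * u x) - iexp (t * u x) - h *\<^sub>R (\<i> * (u x * iexp (t * u x))))"
      by (intro Bochner_Integration.integrable_diff i1 i3)
    show "integrable M (\<lambda>x. (h\<^sup>2 / 2) * (u x)\<^sup>2)" using u2 by simp
    fix x
    have "iexp ((t + h) * u x) - iexp (t * u x) - h *\<^sub>R (\<i> * (u x * iexp (t * u x)))
       = iexp (t * u x) * (iexp (h * u x) - (\<Sum>k\<le>1. (\<i> * (h * u x)) ^ k / fact k))"
      by (simp add: algebra_simps exp_add[symmetric] scaleR_conv_of_real)
    then have "norm (iexp ((t + h) * u x) - iexp (t * u x) - h *\<^sub>R (\<i> * (u x * iexp (t * u x))))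
       = norm (iexp (h * u x) - (\<Sum>k\<le>1. (\<i> * (h * u x)) ^ k / fact k))"
      by (simp only: norm_mult norm_exp_i_times mult_1)
    also have "\<dots> \<le> \<bar>h * u x\<bar> ^ 2 / 2"
      using iexp_approx1[of "h * u x" 1] by (simp add: numeral_2_eq_2)
    finally show "norm (iexp ((t + h) * u x) - iexp (t * u x) - h *\<^sub>R (\<i> * (u x * iexp (t * u x)))) \<le> (h\<^sup>2 / 2) * (u x)\<^sup>2"
      by (simp add: power_mult_distrib)
  qed
  also have "\<dots> = (LINT x|M. (u x)\<^sup>2) / 2 * h\<^sup>2" by simp
  finally show "norm ((CLINT x|M. iexp ((t + h) * u x)) - (CLINT x|M. iexp (t * u x))
      - h *\<^sub>R (CLINT x|M. \<i> * (u x * iexp (t * u x)))) \<le> (LINT x|M. (u x)\<^sup>2) / 2 * h\<^sup>2" .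
qed

lemma std_normal_iexp: "(CLINT y|std_normal_distribution. iexp (t * y)) = exp (- (t\<^sup>2) / 2)"
  using fun_cong[OF char_std_normal_distribution, of t] by (simp add: char_def)

text \<open>
  Both sides compute the derivative of the characteristic function \<open>exp (- t\<^sup>2 / 2)\<close>, one by
  differentiation under the integral.
\<close>
lemma std_normal_stein:
  "(CLINT y|std_normal_distribution. y * iexp (t * y)) = \<i> * t * (CLINT y|std_normal_distribution. iexp (t * y))"
proof -
  interpret prob_space std_normal_distribution by (rule prob_space_std_normal)
  have 1: "((\<lambda>t. CLINT y|std_normal_distribution. iexp (t * y)) has_vector_derivative
      (CLINT y|std_normal_distribution. \<i> * (y * iexp (t * y)))) (at t)"
    by (rule has_vector_derivative_expectation_iexp[OF all_moments_std_normal])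
  have "((\<lambda>t. exp (- (t\<^sup>2) / 2)) has_real_derivative (- t * exp (- (t\<^sup>2) / 2))) (at t)"
    by (auto intro!: derivative_eq_intros)
  then have "((\<lambda>t. complex_of_real (exp (- (t\<^sup>2) / 2))) has_vector_derivative
      complex_of_real (- t * exp (- (t\<^sup>2) / 2))) (at t)"
    by (intro has_vector_derivative_of_real) (simp add: has_real_derivative_iff_has_vector_derivative)
  then have 2: "((\<lambda>t. CLINT y|std_normal_distribution. iexp (t * y)) has_vector_derivative
      complex_of_real (- t * exp (- (t\<^sup>2) / 2))) (at t)"
    by (simp only: std_normal_iexp)
  from vector_derivative_unique_at[OF 1 2]
  have "\<i> * (CLINT y|std_normal_distribution. y * iexp (t * y)) = complex_of_real (- t * exp (- (t\<^sup>2) / 2))"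
    by simp
  then have "\<i> * (\<i> * (CLINT y|std_normal_distribution. y * iexp (t * y))) = \<i> * complex_of_real (- t * exp (- (t\<^sup>2) / 2))"
    by simp
  then have "(CLINT y|std_normal_distribution. y * iexp (t * y)) = \<i> * complex_of_real (t * exp (- (t\<^sup>2) / 2))"
    by (simp flip: mult.assoc)
  then show ?thesis by (subst std_normal_iexp) (simp only: of_real_mult mult.assoc)
qed

lemma euler_identity:
  assumes I: "finite I" and c: "homogeneous d c"
  shows "d * multilin I c x = (\<Sum>i\<in>I. x i * multilin I (deriv_coeff i c) x)"
proof -
  let ?g = "\<lambda>A. c A * (\<Prod>j\<in>A. x j)"
  have fin: "finite A" if "A \<subseteq> I" for A using that I by (rule finite_subset)
  have "(\<Sum>i\<in>I. x i * multilin I (deriv_coeff i c) x)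
     = (\<Sum>(i,A)\<in>I \<times> Pow I. x i * (deriv_coeff i c A * (\<Prod>j\<in>A. x j)))"
    unfolding multilin_def by (simp add: sum_distrib_left sum.cartesian_product)
  also have "\<dots> = (\<Sum>(i,A)\<in>{(i,A). i \<in> I \<and> A \<subseteq> I \<and> i \<notin> A}. ?g (insert i A))"
    using I fin by (intro sum.mono_neutral_cong_right) (auto simp: deriv_coeff_def)
  also have "\<dots> = (\<Sum>(A,i)\<in>(SIGMA A:Pow I. A). ?g A)"
    by (rule sum.reindex_bij_witness[where i="\<lambda>(A,i). (i, A - {i})" and j="\<lambda>(i,A). (insert i A, i)"])
      (auto simp: insert_absorb)
  also have "\<dots> = (\<Sum>A\<in>Pow I. \<Sum>i\<in>A. ?g A)"
    by (rule sum.Sigma[symmetric]) (use I fin in auto)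
  also have "\<dots> = (\<Sum>A\<in>Pow I. d * ?g A)"
    using c by (intro sum.cong refl) (auto simp: homogeneous_def)
  finally show ?thesis by (simp add: multilin_def sum_distrib_left)
qed

lemma multilin_deriv_coeff:
  assumes "finite I" "i \<in> I"
  shows "multilin I (deriv_coeff i c) x = multilin (I - {i}) (\<lambda>A. c (insert i A)) x"
  unfolding multilin_def using assms
  by (intro sum.mono_neutral_cong_right) (auto simp: deriv_coeff_def)

text \<open>
  As \<open>F\<close> is affine in \<open>x\<^sub>i\<close> with slope \<open>\<partial>\<^sub>i F\<close>, and neither \<open>\<partial>\<^sub>i F\<close> nor \<open>\<partial>\<^sub>i F\<^sub>c\<close> depends on \<open>x\<^sub>i\<close>, the
  one-dimensional identity applies to the inner integral over \<open>x\<^sub>i\<close>.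
\<close>
lemma gauss_integration_by_parts:
  assumes I: "finite I" and i: "i \<in> I"
  shows "(CLINT x|gauss I. (x i * multilin I (deriv_coeff i c) x) * iexp (t * multilin I f x))
    = \<i> * t * (CLINT x|gauss I. (multilin I (deriv_coeff i c) x * multilin I (deriv_coeff i f) x) * iexp (t * multilin I f x))"
proof -
  interpret prob_space "gauss I" by (rule prob_space_gauss)
  define J where "J = I - {i}"
  have J: "finite J" "i \<notin> J" and IJ: "I = insert i J" using I i by (auto simp: J_def)
  let ?P = "multilin J (\<lambda>A. c (insert i A))" and ?F0 = "multilin J f" and ?F1 = "multilin J (\<lambda>A. f (insert i A))"
  have d: "multilin I (deriv_coeff i g) x = multilin J (\<lambda>A. g (insert i A)) x" for g x
    unfolding J_def using I i by (rule multilin_deriv_coeff)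
  have split: "multilin I f (x(i := y)) = ?F0 x + y * ?F1 x" for x y
    unfolding IJ by (simp add: multilin_insert[OF J] multilin_fun_upd[OF J(2)])
  have mm: "all_moments (gauss I) (multilin J g)" for g
    by (rule all_moments_multilin[OF I]) (auto simp: J_def)
  have mF [measurable]: "multilin I f \<in> borel_measurable (gauss I)"
    using I by (auto intro: all_moments_measurable all_moments_multilin)
  have int1: "integrable (gauss I) (\<lambda>x. complex_of_real (x i * ?P x) * iexp (t * multilin I f x))"
    by (intro integrable_times_iexp all_moments_integrable all_moments_mult mm all_moments_coord[OF I i]) simp
  have int2: "integrable (gauss I) (\<lambda>x. complex_of_real (?P x * ?F1 x) * iexp (t * multilin I f x))"
    by (intro integrable_times_iexp all_moments_integrable all_moments_mult mm) simp
  have inner: "(CLINT y|std_normal_distribution. complex_of_real (y * p) * iexp (t * (a + y * b)))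
     = \<i> * t * (CLINT y|std_normal_distribution. complex_of_real (p * b) * iexp (t * (a + y * b)))" for p a b
  proof -
    have e: "iexp (t * (a + y * b)) = iexp (t * a) * iexp (t * b * y)" for y
      by (simp add: algebra_simps flip: exp_add)
    have "(CLINT y|std_normal_distribution. complex_of_real (y * p) * iexp (t * (a + y * b)))
      = (CLINT y|std_normal_distribution. (complex_of_real p * iexp (t * a)) * (y * iexp (t * b * y)))"
      unfolding e by (simp add: mult_ac)
    also have "\<dots> = (complex_of_real p * iexp (t * a)) * (\<i> * complex_of_real (t * b) * (CLINT y|std_normal_distribution. iexp (t * b * y)))"
      by (simp only: integral_mult_right_zero std_normal_stein)
    also have "\<dots> = \<i> * t * (CLINT y|std_normal_distribution. (complex_of_real (p * b) * iexp (t * a)) * iexp (t * b * y))"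
      by (simp only: integral_mult_right_zero) (simp add: mult_ac)
    finally show ?thesis unfolding e by (simp only: mult.assoc)
  qed
  have "(CLINT x|gauss I. (x i * ?P x) * iexp (t * multilin I f x))
     = (CLINT x|gauss J. (CLINT y|std_normal_distribution. complex_of_real (y * ?P x) * iexp (t * (?F0 x + y * ?F1 x))))"
    using int1 unfolding IJ
    by (subst gauss_integral_insert[OF J]) (simp_all add: split[unfolded IJ] multilin_fun_upd[OF J(2)])
  also have "\<dots> = (CLINT x|gauss J. \<i> * t * (CLINT y|std_normal_distribution. complex_of_real (?P x * ?F1 x) * iexp (t * (?F0 x + y * ?F1 x))))"
    by (simp only: inner)
  also have "\<dots> = \<i> * t * (CLINT x|gauss J. (CLINT y|std_normal_distribution. complex_of_real (?P x * ?F1 x) * iexp (t * (?F0 x + y * ?F1 x))))"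
    by (rule integral_mult_right_zero)
  also have "(CLINT x|gauss J. (CLINT y|std_normal_distribution. complex_of_real (?P x * ?F1 x) * iexp (t * (?F0 x + y * ?F1 x))))
     = (CLINT x|gauss I. complex_of_real (?P x * ?F1 x) * iexp (t * multilin I f x))"
    using int2 unfolding IJ
    by (subst gauss_integral_insert[OF J]) (simp_all add: split[unfolded IJ] multilin_fun_upd[OF J(2)])
  finally show ?thesis unfolding d by simp
qed

lemma all_moments_carre_du_champ:
  assumes "finite I"
  shows "all_moments (gauss I) (carre_du_champ I c e)"
  unfolding carre_du_champ_def[abs_def]
  by (intro gauss_sum all_moments_mult all_moments_multilin assms subset_refl)

lemma stein_multilin:
  assumes I: "finite I" and c: "homogeneous d c"
  shows "d * (CLINT x|gauss I. multilin I c x * iexp (t * multilin I f x))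
    = \<i> * t * (CLINT x|gauss I. carre_du_champ I c f x * iexp (t * multilin I f x))"
proof -
  interpret prob_space "gauss I" by (rule prob_space_gauss)
  have mm: "all_moments (gauss I) (multilin I g)" for g
    by (rule all_moments_multilin[OF I]) simp
  have [measurable]: "multilin I f \<in> borel_measurable (gauss I)"
    by (rule all_moments_measurable[OF mm])
  have int: "integrable (gauss I) (\<lambda>x. complex_of_real (u x) * iexp (t * multilin I f x))" if "all_moments (gauss I) u" for u
    by (intro integrable_times_iexp all_moments_integrable that) simp
  have "d * (CLINT x|gauss I. multilin I c x * iexp (t * multilin I f x))
     = (CLINT x|gauss I. complex_of_real (d * multilin I c x) * iexp (t * multilin I f x))"
    by (simp add: mult.assoc)
  also have "\<dots> = (CLINT x|gauss I. (\<Sum>i\<in>I. complex_of_real (x i * multilin I (deriv_coeff i c) x) * iexp (t * multilin I f x)))"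
    unfolding euler_identity[OF I c] by (simp add: sum_distrib_right)
  also have "\<dots> = (\<Sum>i\<in>I. CLINT x|gauss I. complex_of_real (x i * multilin I (deriv_coeff i c) x) * iexp (t * multilin I f x))"
    by (intro Bochner_Integration.integral_sum int all_moments_mult mm all_moments_coord I)
  also have "\<dots> = (\<Sum>i\<in>I. \<i> * t * (CLINT x|gauss I. complex_of_real (multilin I (deriv_coeff i c) x * multilin I (deriv_coeff i f) x) * iexp (t * multilin I f x)))"
    by (intro sum.cong refl) (use gauss_integration_by_parts[OF I] in simp)
  also have "\<dots> = \<i> * t * (CLINT x|gauss I. (\<Sum>i\<in>I. complex_of_real (multilin I (deriv_coeff i c) x * multilin I (deriv_coeff i f) x) * iexp (t * multilin I f x)))"
    unfolding sum_distrib_left[symmetric]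
    by (subst Bochner_Integration.integral_sum; (rule refl | intro int all_moments_mult mm))
  finally show ?thesis by (simp add: carre_du_champ_def sum_distrib_right)
qed

lemma multilin_sum: "multilin I (\<lambda>A. \<Sum>j\<in>J. a j * c j A) x = (\<Sum>j\<in>J. a j * multilin I (c j) x)"
proof -
  have "multilin I (\<lambda>A. \<Sum>j\<in>J. a j * c j A) x = (\<Sum>A\<in>Pow I. \<Sum>j\<in>J. a j * (c j A * (\<Prod>i\<in>A. x i)))"
    by (simp add: multilin_def sum_distrib_right mult.assoc)
  also have "\<dots> = (\<Sum>j\<in>J. \<Sum>A\<in>Pow I. a j * (c j A * (\<Prod>i\<in>A. x i)))" by (rule sum.swap)
  finally show ?thesis by (simp add: multilin_def sum_distrib_left)
qed

lemma deriv_coeff_sum: "deriv_coeff i (\<lambda>A. \<Sum>j\<in>J. a j * c j A) = (\<lambda>A. \<Sum>j\<in>J. a j * deriv_coeff i (c j) A)"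
  by (auto simp: deriv_coeff_def)

lemma carre_du_champ_sum:
  "carre_du_champ I e (\<lambda>A. \<Sum>j\<in>J. a j * c j A) x = (\<Sum>j\<in>J. a j * carre_du_champ I e (c j) x)"
proof -
  have "carre_du_champ I e (\<lambda>A. \<Sum>j\<in>J. a j * c j A) x
     = (\<Sum>i\<in>I. \<Sum>j\<in>J. a j * (multilin I (deriv_coeff i e) x * multilin I (deriv_coeff i (c j)) x))"
    unfolding carre_du_champ_def deriv_coeff_sum multilin_sum by (simp add: sum_distrib_left mult_ac)
  also have "\<dots> = (\<Sum>j\<in>J. \<Sum>i\<in>I. a j * (multilin I (deriv_coeff i e) x * multilin I (deriv_coeff i (c j)) x))"
    by (rule sum.swap)
  finally show ?thesis by (simp add: carre_du_champ_def sum_distrib_left)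
qed

text \<open>
  Stein's method for the characteristic function \<open>\<phi>\<close> of \<open>F = \<Sum>\<^sub>j a\<^sub>j F\<^sub>j\<close>. With \<open>\<Gamma>\<close> the double sum
  on the right, \<open>\<phi>'(t) = - t E[\<Gamma> exp (\<i> t F)]\<close>, hence the derivative of \<open>\<phi>(t) exp (\<sigma>2 t\<^sup>2 / 2)\<close> on
  \<open>[0, 1]\<close> is at most \<open>exp (\<sigma>2 / 2) E\<bar>\<Gamma> - \<sigma>2\<bar>\<close>. Only \<open>t = 1\<close> is needed, since \<open>t\<close> can be absorbed
  in the coefficients \<open>a\<^sub>j\<close>.
\<close>
lemma char_function_gaussian_bound:
  fixes d :: "'m \<Rightarrow> nat" and c :: "'m \<Rightarrow> nat set \<Rightarrow> real"
  assumes I: "finite I" and J: "finite J" and c: "\<And>j. j \<in> J \<Longrightarrow> homogeneous (d j) (c j)"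
    and d: "\<And>j. j \<in> J \<Longrightarrow> 1 \<le> d j" and \<sigma>: "0 \<le> \<sigma>2"
  shows "norm ((CLINT x|gauss I. iexp (\<Sum>j\<in>J. a j * multilin I (c j) x)) - complex_of_real (exp (- \<sigma>2 / 2)))
    \<le> (LINT x|gauss I. \<bar>(\<Sum>j\<in>J. \<Sum>k\<in>J. a j * a k / d j * carre_du_champ I (c j) (c k) x) - \<sigma>2\<bar>)"
proof -
  interpret prob_space "gauss I" by (rule prob_space_gauss)
  let ?f = "\<lambda>A. \<Sum>j\<in>J. a j * c j A"
  let ?F = "multilin I ?f"
  define \<Gamma> where "\<Gamma> x = (\<Sum>j\<in>J. \<Sum>k\<in>J. a j * a k / d j * carre_du_champ I (c j) (c k) x)" for x
  define \<delta> where "\<delta> = (LINT x|gauss I. \<bar>\<Gamma> x - \<sigma>2\<bar>)"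
  define \<phi> where "\<phi> t = (CLINT x|gauss I. iexp (t * ?F x))" for t :: real
  have mm: "all_moments (gauss I) (multilin I g)" for g
    by (rule all_moments_multilin[OF I]) simp
  have mG: "all_moments (gauss I) \<Gamma>"
    unfolding \<Gamma>_def[abs_def]
    by (intro gauss_moments all_moments_carre_du_champ I)
  have [measurable]: "?F \<in> borel_measurable (gauss I)" "\<Gamma> \<in> borel_measurable (gauss I)"
    using mm mG by (auto intro: all_moments_measurable)
  have int: "integrable (gauss I) (\<lambda>x. complex_of_real (u x) * iexp (t * ?F x))" if "all_moments (gauss I) u" for u t
    by (intro integrable_times_iexp all_moments_integrable that) simp
  have stein: "(CLINT x|gauss I. ?F x * iexp (t * ?F x)) = \<i> * t * (CLINT x|gauss I. \<Gamma> x * iexp (t * ?F x))" for t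
  proof -
    have "(CLINT x|gauss I. ?F x * iexp (t * ?F x))
       = (CLINT x|gauss I. (\<Sum>j\<in>J. complex_of_real (a j * multilin I (c j) x) * iexp (t * ?F x)))"
      by (simp add: multilin_sum sum_distrib_right)
    also have "\<dots> = (\<Sum>j\<in>J. CLINT x|gauss I. complex_of_real (a j * multilin I (c j) x) * iexp (t * ?F x))"
      by (intro Bochner_Integration.integral_sum int gauss_moments mm)
    also have "\<dots> = (\<Sum>j\<in>J. \<i> * t * (CLINT x|gauss I. complex_of_real (a j / d j * carre_du_champ I (c j) ?f x) * iexp (t * ?F x)))"
    proof (intro sum.cong refl)
      fix j assume j: "j \<in> J"
      let ?L = "CLINT x|gauss I. multilin I (c j) x * iexp (t * ?F x)"
      let ?R = "CLINT x|gauss I. carre_du_champ I (c j) ?f x * iexp (t * ?F x)"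
      have "complex_of_real (real (d j)) * ?L = \<i> * t * ?R"
        using stein_multilin[OF I c[OF j], of t ?f] by simp
      then have L: "?L = \<i> * t * ?R / d j"
        using d[OF j] by (simp add: field_simps)
      have "(CLINT x|gauss I. complex_of_real (a j * multilin I (c j) x) * iexp (t * ?F x)) = a j * ?L"
        by (simp only: of_real_mult mult.assoc integral_mult_right_zero)
      also have "\<dots> = \<i> * t * (complex_of_real (a j / d j) * ?R)"
        unfolding L by simp
      also have "complex_of_real (a j / d j) * ?R = (CLINT x|gauss I. complex_of_real (a j / d j * carre_du_champ I (c j) ?f x) * iexp (t * ?F x))"
        by (simp only: of_real_mult mult.assoc integral_mult_right_zero)
      finally show "(CLINT x|gauss I. complex_of_real (a j * multilin I (c j) x) * iexp (t * ?F x))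
        = \<i> * t * (CLINT x|gauss I. complex_of_real (a j / d j * carre_du_champ I (c j) ?f x) * iexp (t * ?F x))" .
    qed
    also have "\<dots> = \<i> * t * (CLINT x|gauss I. (\<Sum>j\<in>J. complex_of_real (a j / d j * carre_du_champ I (c j) ?f x) * iexp (t * ?F x)))"
      unfolding sum_distrib_left[symmetric]
      by (subst Bochner_Integration.integral_sum; (rule refl | intro int gauss_moments all_moments_carre_du_champ I))
    also have "(CLINT x|gauss I. (\<Sum>j\<in>J. complex_of_real (a j / d j * carre_du_champ I (c j) ?f x) * iexp (t * ?F x)))
      = (CLINT x|gauss I. \<Gamma> x * iexp (t * ?F x))"
    proof (intro Bochner_Integration.integral_cong refl)
      fix x
      have G: "\<Gamma> x = (\<Sum>j\<in>J. a j / d j * carre_du_champ I (c j) ?f x)"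
        unfolding \<Gamma>_def carre_du_champ_sum by (simp add: sum_distrib_left mult_ac)
      have "complex_of_real (\<Gamma> x) = (\<Sum>j\<in>J. complex_of_real (a j / d j * carre_du_champ I (c j) ?f x))"
        by (subst G) (rule of_real_sum)
      then show "(\<Sum>j\<in>J. complex_of_real (a j / d j * carre_du_champ I (c j) ?f x) * iexp (t * ?F x)) = \<Gamma> x * iexp (t * ?F x)"
        by (simp add: sum_distrib_right)
    qed
    finally show ?thesis .
  qed
  have d\<phi>: "(\<phi> has_vector_derivative - t * (CLINT x|gauss I. \<Gamma> x * iexp (t * ?F x))) (at t)" for t
  proof -
    have "(CLINT x|gauss I. \<i> * (?F x * iexp (t * ?F x))) = \<i> * (\<i> * t * (CLINT x|gauss I. \<Gamma> x * iexp (t * ?F x)))"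
      by (simp only: integral_mult_right_zero stein)
    also have "\<dots> = - t * (CLINT x|gauss I. \<Gamma> x * iexp (t * ?F x))"
      by (simp flip: mult.assoc)
    finally show ?thesis
      unfolding \<phi>_def[abs_def] using has_vector_derivative_expectation_iexp[OF mm, of ?f t] by simp
  qed
  have near: "norm ((CLINT x|gauss I. \<Gamma> x * iexp (t * ?F x)) - \<sigma>2 * \<phi> t) \<le> \<delta>" for t
  proof -
    have "(CLINT x|gauss I. \<Gamma> x * iexp (t * ?F x)) - \<sigma>2 * \<phi> t
       = (CLINT x|gauss I. \<Gamma> x * iexp (t * ?F x) - \<sigma>2 * iexp (t * ?F x))"
      unfolding \<phi>_def using int[OF mG] int[OF gauss_const[of I \<sigma>2]] int[OF gauss_const[of I 1]] by simp
    also have "norm \<dots> \<le> (LINT x|gauss I. \<bar>\<Gamma> x - \<sigma>2\<bar>)"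
    proof (rule norm_integral_le)
      show "integrable (gauss I) (\<lambda>x. \<Gamma> x * iexp (t * ?F x) - \<sigma>2 * iexp (t * ?F x))"
        using int[OF mG] int[OF gauss_const[of I \<sigma>2]] by simp
      show "integrable (gauss I) (\<lambda>x. \<bar>\<Gamma> x - \<sigma>2\<bar>)"
        by (intro integrable_abs all_moments_integrable gauss_moments mG)
      fix x
      have "\<Gamma> x * iexp (t * ?F x) - \<sigma>2 * iexp (t * ?F x) = complex_of_real (\<Gamma> x - \<sigma>2) * iexp (t * ?F x)"
        by (simp add: algebra_simps)
      then show "norm (\<Gamma> x * iexp (t * ?F x) - \<sigma>2 * iexp (t * ?F x)) \<le> \<bar>\<Gamma> x - \<sigma>2\<bar>"
        by (simp only: norm_mult norm_of_real norm_exp_i_times)  simp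
    qed
    finally show ?thesis by (simp add: \<delta>_def)
  qed
  define g where "g t = complex_of_real (exp (\<sigma>2 * t\<^sup>2 / 2))" for t :: real
  have dg: "(g has_vector_derivative complex_of_real (\<sigma>2 * t * exp (\<sigma>2 * t\<^sup>2 / 2))) (at t)" for t
  proof -
    have "((\<lambda>t. exp (\<sigma>2 * t\<^sup>2 / 2)) has_real_derivative (\<sigma>2 * t * exp (\<sigma>2 * t\<^sup>2 / 2))) (at t)"
      by (auto intro!: derivative_eq_intros)
    then show ?thesis unfolding g_def[abs_def]
      by (intro has_vector_derivative_of_real) (simp add: has_real_derivative_iff_has_vector_derivative)
  qed
  define D where "D t = \<phi> t * complex_of_real (\<sigma>2 * t * exp (\<sigma>2 * t\<^sup>2 / 2)) + (- t * (CLINT x|gauss I. \<Gamma> x * iexp (t * ?F x))) * g t" for t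
  have dprod: "((\<lambda>t. \<phi> t * g t) has_vector_derivative D t) (at t)" for t
    unfolding D_def by (rule has_vector_derivative_mult[OF d\<phi> dg])
  have D_le: "norm (D t) \<le> exp (\<sigma>2 / 2) * \<delta>" if t: "t \<in> {0..1}" for t
  proof -
    have "D t = complex_of_real (- t * exp (\<sigma>2 * t\<^sup>2 / 2)) * ((CLINT x|gauss I. \<Gamma> x * iexp (t * ?F x)) - \<sigma>2 * \<phi> t)"
      by (simp add: D_def g_def algebra_simps)
    then have "norm (D t) = t * exp (\<sigma>2 * t\<^sup>2 / 2) * norm ((CLINT x|gauss I. \<Gamma> x * iexp (t * ?F x)) - \<sigma>2 * \<phi> t)"
      using t by (simp only: norm_mult norm_of_real) (simp add: abs_mult)
    also have "\<dots> \<le> (1 * exp (\<sigma>2 / 2)) * \<delta>"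
    proof (intro mult_mono near)
      have "\<sigma>2 * t\<^sup>2 \<le> \<sigma>2" using t \<sigma> by (intro mult_left_le) (auto intro: power_le_one)
      then show "exp (\<sigma>2 * t\<^sup>2 / 2) \<le> exp (\<sigma>2 / 2)" by simp
    qed (use t in auto)
    finally show ?thesis by simp
  qed
  have "norm (\<phi> 1 * g 1 - \<phi> 0 * g 0) \<le> exp (\<sigma>2 / 2) * \<delta> * norm (1 - 0 :: real)"
  proof (rule differentiable_bound[of "{0..1}"])
    fix t :: real assume t: "t \<in> {0..1}"
    show "((\<lambda>t. \<phi> t * g t) has_derivative (\<lambda>h. h *\<^sub>R D t)) (at t within {0..1})"
      using dprod[of t] unfolding has_vector_derivative_def by (rule has_derivative_at_withinI)
    show "onorm (\<lambda>h. h *\<^sub>R D t) \<le> exp (\<sigma>2 / 2) * \<delta>"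
      using D_le[OF t] by (intro onorm_le) (simp add: mult.commute mult_left_mono)
  qed auto
  then have b: "norm (\<phi> 1 * g 1 - 1) \<le> exp (\<sigma>2 / 2) * \<delta>"
    by (simp add: \<phi>_def g_def prob_space)
  have "\<phi> 1 - complex_of_real (exp (- \<sigma>2 / 2)) = complex_of_real (exp (- \<sigma>2 / 2)) * (\<phi> 1 * g 1 - 1)"
    by (simp add: g_def algebra_simps flip: of_real_mult exp_add)
  then have "norm (\<phi> 1 - complex_of_real (exp (- \<sigma>2 / 2))) = exp (- \<sigma>2 / 2) * norm (\<phi> 1 * g 1 - 1)"
    by (simp only: norm_mult norm_of_real) simp
  also have "\<dots> \<le> exp (- \<sigma>2 / 2) * (exp (\<sigma>2 / 2) * \<delta>)"
    using b by (intro mult_left_mono) auto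
  also have "\<dots> = \<delta>" by (simp flip: mult.assoc exp_add)
  finally show ?thesis by (simp add: \<phi>_def \<delta>_def \<Gamma>_def multilin_sum)
qed


section \<open>Convergence in law from characteristic functions\<close>

text \<open>
  On the cube of radius \<open>R\<close> the map \<open>x \<mapsto> (sin (b x\<^sub>j))\<^sub>j\<close> is injective with inverse
  \<open>arcsin / b\<close>. So \<open>h\<close> agrees there with a continuous function of the sines, and this function is
  bounded on all of the space by the bound of \<open>h\<close>.
\<close>
lemma sin_cube_approximation:
  fixes h :: "real ^ 'm::finite \<Rightarrow> real" and R :: real
  assumes h: "continuous_on UNIV h" and R: "0 < R"
  defines "b \<equiv> pi / (2 * R)"
  defines "S \<equiv> {y :: real ^ 'm. \<forall>j. \<bar>y $ j\<bar> \<le> 1}"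
  defines "k \<equiv> \<lambda>y :: real ^ 'm. h (\<chi> j. arcsin (y $ j) / b)"
  shows "compact S" "continuous_on S k" "\<And>x. (\<chi> j. sin (b * x $ j)) \<in> S"
    "\<And>x. (\<And>j. \<bar>x $ j\<bar> \<le> R) \<Longrightarrow> k (\<chi> j. sin (b * x $ j)) = h x"
proof -
  have b: "0 < b" using R by (simp add: b_def)
  have "S = cbox (\<chi> j. -1) (\<chi> j. 1)"
    unfolding S_def by (auto simp: mem_box_cart abs_le_iff minus_le_iff)
  then show "compact S" by simp
  have "continuous_on S (\<lambda>y. \<chi> j. arcsin (y $ j) / b)"
    by (intro continuous_intros) (use b in \<open>auto simp: S_def abs_le_iff minus_le_iff\<close>)
  then show "continuous_on S k"
    unfolding k_def by (intro continuous_on_compose2[OF h]) auto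
  show "(\<chi> j. sin (b * x $ j)) \<in> S" for x :: "real ^ 'm"
    by (simp add: S_def)
  fix x :: "real ^ 'm" assume x: "\<And>j. \<bar>x $ j\<bar> \<le> R"
  have "arcsin (sin (b * x $ j)) = b * x $ j" for j
  proof (rule arcsin_sin)
    have "\<bar>b * x $ j\<bar> \<le> b * R" using x[of j] b by (simp add: abs_mult)
    also have "b * R = pi / 2" using R by (simp add: b_def)
    finally show "- (pi / 2) \<le> b * x $ j" "b * x $ j \<le> pi / 2" by linarith+
  qed
  then show "k (\<chi> j. sin (b * x $ j)) = h x" using b by (simp add: k_def vec_nth_inverse)
qed

text \<open>
  The second moments make large values unlikely, so \<open>h\<close> may be replaced by a function of
  \<open>sin (b x\<^sub>j)\<close>, which by the theorem of Stone and Weierstrass is uniformly close to a polynomial in these sines.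
  Unlike for approximation on a cube by a polynomial in \<open>x\<close>, the error is uniform on the whole space.
\<close>
theorem converges_in_law_of_char:
  fixes X :: "nat \<Rightarrow> 'a \<Rightarrow> real ^ 'm::finite" and \<mu> :: "(real ^ 'm) measure"
  assumes M: "prob_space M" and \<mu>: "prob_space \<mu>" and sets_\<mu>: "sets \<mu> = sets borel"
    and X: "\<And>n. X n \<in> borel_measurable M"
    and char: "\<And>a. (\<lambda>n. CLINT \<omega>|M. iexp (a \<bullet> X n \<omega>)) \<longlonglongrightarrow> (CLINT x|\<mu>. iexp (a \<bullet> x))"
    and intX: "\<And>n j. integrable M (\<lambda>\<omega>. (X n \<omega> $ j)\<^sup>2)"
    and bndX: "\<And>n j. (LINT \<omega>|M. (X n \<omega> $ j)\<^sup>2) \<le> C"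
    and int\<mu>: "\<And>j. integrable \<mu> (\<lambda>x. (x $ j)\<^sup>2)"
    and bnd\<mu>: "\<And>j. (LINT x|\<mu>. (x $ j)\<^sup>2) \<le> C"
  shows "converges_in_law M X \<mu>"
  unfolding converges_in_law_def
proof (intro allI impI)
  fix h :: "real ^ 'm \<Rightarrow> real"
  assume "continuous_on UNIV h \<and> bounded (range h)"
  then have h: "continuous_on UNIV h" and "bounded (range h)" by auto
  then obtain B0 where B0: "\<And>x. \<bar>h x\<bar> \<le> B0" unfolding bounded_iff by auto
  define B where "B = B0 + 1"
  have B: "\<bar>h x\<bar> \<le> B" for x using B0[of x] by (simp add: B_def)
  have Bpos: "0 < B" using B0[of 0] by (simp add: B_def)
  interpret M: prob_space M by fact
  interpret \<mu>: prob_space \<mu> by fact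
  have [measurable_cong]: "sets \<mu> = sets borel" by (rule sets_\<mu>)
  note X[measurable]
  have meas: "(\<lambda>\<omega>. g (X n \<omega>)) \<in> borel_measurable M" "g \<in> borel_measurable \<mu>"
    if "continuous_on UNIV g" for g :: "real ^ 'm \<Rightarrow> 'z::{second_countable_topology, banach}" and n
  proof -
    have [measurable]: "g \<in> borel_measurable borel" using that by (rule borel_measurable_continuous_onI)
    show "(\<lambda>\<omega>. g (X n \<omega>)) \<in> borel_measurable M" "g \<in> borel_measurable \<mu>" by measurable
  qed
  have int: "integrable M (\<lambda>\<omega>. g (X n \<omega>))" "integrable \<mu> g"
    if g: "continuous_on UNIV g" "bounded (range g)" for g :: "real ^ 'm \<Rightarrow> 'z::{second_countable_topology, banach}" and n
  proof -
    obtain K where K: "\<And>x. norm (g x) \<le> K" using g(2) unfolding bounded_iff by auto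
    show "integrable M (\<lambda>\<omega>. g (X n \<omega>))" "integrable \<mu> g"
      using meas[OF g(1)] K
      by (auto intro!: M.integrable_const_bound[where B=K] \<mu>.integrable_const_bound[where B=K])
  qed
  define conv :: "(real ^ 'm \<Rightarrow> complex) \<Rightarrow> bool" where
    "conv u \<longleftrightarrow> continuous_on UNIV u \<and> bounded (range u) \<and>
       (\<lambda>n. CLINT \<omega>|M. u (X n \<omega>)) \<longlonglongrightarrow> (CLINT x|\<mu>. u x)" for u
  have conv_add: "conv (\<lambda>x. u x + v x)" if "conv u" "conv v" for u v
    using that unfolding conv_def
    by (auto intro!: continuous_intros bounded_plus_comp tendsto_add simp: int Bochner_Integration.integral_add)
  have conv_cmult: "conv (\<lambda>x. w * u x)" if "conv u" for w u
  proof -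
    have "bounded (range (\<lambda>x. w * u x))"
      using that unfolding conv_def by (auto simp: image_image[symmetric, of "(*) w" u] intro!: bounded_linear_image bounded_linear_mult_right)
    then show ?thesis using that unfolding conv_def
      by (auto intro!: continuous_intros tendsto_mult_left)
  qed
  have main: "\<exists>N. \<forall>n\<ge>N. \<bar>(LINT \<omega>|M. h (X n \<omega>)) - (LINT x|\<mu>. h x)\<bar> < \<epsilon>" if \<epsilon>: "0 < \<epsilon>" for \<epsilon> :: real
  proof -
    \<comment> \<open>The radius is chosen such that replacing \<open>h\<close> outside the cube costs at most \<open>\<epsilon> / 8\<close>; adding \<open>1\<close> keeps it positive.\<close>
    define D where "D = real CARD('m) * C + 1"
    have "0 \<le> C" using order_trans[OF Bochner_Integration.integral_nonneg bnd\<mu>] by auto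
    then have D: "0 < D" by (simp add: D_def add_nonneg_pos)
    define R where "R = sqrt (16 * B * D / \<epsilon>)"
    have R: "0 < R" using Bpos D \<epsilon> by (simp add: R_def)
    have R2: "R\<^sup>2 = 16 * B * D / \<epsilon>" using Bpos D \<epsilon> by (simp add: R_def)
    define b where "b = pi / (2 * R)"
    define S where "S = {y :: real ^ 'm. \<forall>j. \<bar>y $ j\<bar> \<le> 1}"
    define k where "k = (\<lambda>y :: real ^ 'm. h (\<chi> j. arcsin (y $ j) / b))"
    define s where "s x = (\<chi> j. sin (b * x $ j))" for x :: "real ^ 'm"
    note cube = sin_cube_approximation[OF h R, folded b_def, folded S_def k_def]
    have s_cont: "continuous_on UNIV s" unfolding s_def[abs_def] by (intro continuous_intros)
    have sS: "s x \<in> S" for x unfolding s_def by (rule cube(3))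
    \<comment> \<open>Convergence of expectations is not stable under products of functions, but the property of preserving the convergence of all Fourier transforms upon multiplication is.\<close>
    define good :: "(real ^ 'm \<Rightarrow> real) \<Rightarrow> bool" where
      "good g \<longleftrightarrow> continuous_on UNIV g \<and>
        (\<forall>u. (\<forall>a. conv (\<lambda>x. u x * iexp (a \<bullet> x))) \<longrightarrow> (\<forall>a. conv (\<lambda>x. complex_of_real (g (s x)) * u x * iexp (a \<bullet> x))))" for g
    have goodD: "conv (\<lambda>x. complex_of_real (f (s x)) * w x * iexp (a \<bullet> x))"
      if "good f" "\<forall>a. conv (\<lambda>x. w x * iexp (a \<bullet> x))" for f w a
      using that unfolding good_def by blast
    have "\<exists>g. good g \<and> (\<forall>y\<in>S. \<bar>k y - g y\<bar> < \<epsilon> / 8)"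
    proof (rule Stone_Weierstrass_HOL[OF cube(1)])
      show "good (\<lambda>x. c)" for c
        unfolding good_def by (auto intro!: continuous_intros simp: mult.assoc conv_cmult)
      show "continuous_on S g" if "good g" for g
        using that unfolding good_def by (auto intro: continuous_on_subset)
      show "good (\<lambda>x. f x + g x)" if "good f \<and> good g" for f g
        using that unfolding good_def by (auto intro!: continuous_intros conv_add simp: distrib_right)
      show "good (\<lambda>x. f x * g x)" if fg: "good f \<and> good g" for f g
        unfolding good_def
      proof (intro conjI allI impI)
        show "continuous_on UNIV (\<lambda>x. f x * g x)" using fg unfolding good_def by (auto intro!: continuous_intros)
        fix u a assume u: "\<forall>a. conv (\<lambda>x. u x * iexp (a \<bullet> x))"
        have "\<forall>a. conv (\<lambda>x. (complex_of_real (g (s x)) * u x) * iexp (a \<bullet> x))"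
          using fg u unfolding good_def by blast
        then have "\<forall>a. conv (\<lambda>x. complex_of_real (f (s x)) * (complex_of_real (g (s x)) * u x) * iexp (a \<bullet> x))"
          using goodD[of f "\<lambda>x. complex_of_real (g (s x)) * u x"] fg by simp
        then show "conv (\<lambda>x. complex_of_real (f (s x) * g (s x)) * u x * iexp (a \<bullet> x))"
          by (simp add: mult.assoc)
      qed
      have coord: "good (\<lambda>y. y $ j)" for j
        unfolding good_def
      proof (intro conjI allI impI)
        show "continuous_on UNIV (\<lambda>y :: real ^ 'm. y $ j)" by (intro continuous_intros)
        fix u a assume u: "\<forall>a. conv (\<lambda>x. u x * iexp (a \<bullet> x))"
        \<comment> \<open>Multiplication by a sine shifts the frequency \<open>a\<close> by \<open>b\<close> in both directions of the axis \<open>j\<close>.\<close>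
        have "complex_of_real (s x $ j) * u x * iexp (a \<bullet> x)
          = (-\<i>/2) * (u x * iexp ((a + axis j b) \<bullet> x)) + (\<i>/2) * (u x * iexp ((a - axis j b) \<bullet> x))" for x
        proof -
          have "(p - q) / (2 * \<i>) = (-\<i>/2) * p + (\<i>/2) * q" for p q :: complex
            by (simp add: complex_eq_iff Re_divide Im_divide field_simps)
          moreover have "complex_of_real (s x $ j) = (iexp (b * x $ j) - iexp (- (b * x $ j))) / (2 * \<i>)"
            unfolding s_def by (simp add: sin_exp_eq sin_of_real[symmetric])
          ultimately have "complex_of_real (s x $ j) = (-\<i>/2) * iexp (b * x $ j) + (\<i>/2) * iexp (- (b * x $ j))"
            by simp
          moreover have "iexp ((a + axis j b) \<bullet> x) = iexp (b * x $ j) * iexp (a \<bullet> x)"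
            "iexp ((a - axis j b) \<bullet> x) = iexp (- (b * x $ j)) * iexp (a \<bullet> x)"
            by (simp_all add: inner_add_left inner_diff_left inner_axis' algebra_simps flip: exp_add)
          ultimately show ?thesis by (simp only: algebra_simps)
        qed
        then show "conv (\<lambda>x. complex_of_real (s x $ j) * u x * iexp (a \<bullet> x))"
          by (simp only:) (rule conv_add[OF conv_cmult conv_cmult]; rule u[rule_format])
      qed
      show "\<exists>f. good f \<and> f x \<noteq> f y" if "x \<in> S \<and> y \<in> S \<and> x \<noteq> y" for x y
      proof -
        have "x \<noteq> y" using that by blast
        then have "\<exists>j. x $ j \<noteq> y $ j" by (simp add: vec_eq_iff)
        then obtain j where "x $ j \<noteq> y $ j" ..
        then show ?thesis using coord[of j] by (intro exI[of _ "\<lambda>y. y $ j"]) auto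
      qed
      show "continuous_on S k" by (rule cube(2))
      show "0 < \<epsilon> / 8" using \<epsilon> by simp
    qed
    then obtain g where g: "good g" and gk: "\<And>y. y \<in> S \<Longrightarrow> \<bar>k y - g y\<bar> < \<epsilon> / 8" by auto
    have "\<forall>a. conv (\<lambda>x. 1 * iexp (a \<bullet> x))"
    proof
      fix a :: "real ^ 'm"
      have "continuous_on UNIV (\<lambda>x. 1 * iexp (a \<bullet> x))" by (intro continuous_intros)
      moreover have "bounded (range (\<lambda>x. 1 * iexp (a \<bullet> x)))"
        by (auto simp: bounded_iff intro!: exI[of _ 1])
      ultimately show "conv (\<lambda>x. 1 * iexp (a \<bullet> x))" using char[of a] by (simp add: conv_def)
    qed
    then have "conv (\<lambda>x. complex_of_real (g (s x)) * 1 * iexp (0 \<bullet> x))"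
      by (rule goodD[OF g])
    then have "(\<lambda>n. CLINT \<omega>|M. complex_of_real (g (s (X n \<omega>)))) \<longlonglongrightarrow> (CLINT x|\<mu>. complex_of_real (g (s x)))"
      by (simp add: conv_def)
    then have lim: "(\<lambda>n. LINT \<omega>|M. g (s (X n \<omega>))) \<longlonglongrightarrow> (LINT x|\<mu>. g (s x))"
      by (simp add: tendsto_of_real_iff)
    have gs_cont: "continuous_on UNIV (\<lambda>x. g (s x))"
      using g unfolding good_def by (auto intro: continuous_on_compose2[OF _ s_cont])
    have "compact (g ` S)"
      using g cube(1) unfolding good_def by (intro compact_continuous_image) (auto intro: continuous_on_subset)
    then have gs_bdd: "bounded (range (\<lambda>x. g (s x)))"
      by (rule bounded_subset[OF compact_imp_bounded]) (use sS in auto)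
    have point: "\<bar>h x - g (s x)\<bar> \<le> 2 * B / R\<^sup>2 * (\<Sum>j\<in>UNIV. (x $ j)\<^sup>2) + \<epsilon> / 8" for x
    proof -
      have "\<bar>h x - k (s x)\<bar> \<le> 2 * B / R\<^sup>2 * (\<Sum>j\<in>UNIV. (x $ j)\<^sup>2)"
      proof (cases "\<forall>j. \<bar>x $ j\<bar> \<le> R")
        case True
        then have "k (s x) = h x" using cube(4)[of x] unfolding s_def k_def by simp
        then show ?thesis using Bpos by (auto intro!: mult_nonneg_nonneg sum_nonneg divide_nonneg_nonneg)
      next
        case False
        then obtain j where "R < \<bar>x $ j\<bar>" by (auto simp: not_le)
        then have "R\<^sup>2 \<le> (x $ j)\<^sup>2" using R by (simp add: abs_le_square_iff[symmetric])
        also have "\<dots> \<le> (\<Sum>j\<in>UNIV. (x $ j)\<^sup>2)" by (rule member_le_sum) auto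
        finally have "2 * B * R\<^sup>2 \<le> 2 * B * (\<Sum>j\<in>UNIV. (x $ j)\<^sup>2)" using Bpos by (intro mult_left_mono) auto
        then have "2 * B \<le> 2 * B / R\<^sup>2 * (\<Sum>j\<in>UNIV. (x $ j)\<^sup>2)" using R by (simp add: field_simps)
        moreover have "\<bar>h x - k (s x)\<bar> \<le> 2 * B"
          using B[of x] B[of "\<chi> j. arcsin (s x $ j) / b"] by (auto simp: k_def)
        ultimately show ?thesis by linarith
      qed
      then show ?thesis using gk[OF sS[of x]] by linarith
    qed
    have eps: "2 * B / R\<^sup>2 * (real CARD('m) * C) \<le> \<epsilon> / 8"
    proof -
      have "2 * B / R\<^sup>2 * (real CARD('m) * C) \<le> 2 * B / R\<^sup>2 * D"
        using Bpos by (intro mult_left_mono) (auto simp: D_def)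
      also have "\<dots> = \<epsilon> / 8" unfolding R2 using Bpos D \<epsilon> by (simp add: field_simps)
      finally show ?thesis .
    qed
    have close: "\<bar>(LINT z|L. h (Y z)) - (LINT z|L. g (s (Y z)))\<bar> \<le> \<epsilon> / 4"
      if L: "prob_space L" and ih: "integrable L (\<lambda>z. h (Y z))" and ig: "integrable L (\<lambda>z. g (s (Y z)))"
        and i2: "\<And>j. integrable L (\<lambda>z. (Y z $ j)\<^sup>2)" and b2: "\<And>j. (LINT z|L. (Y z $ j)\<^sup>2) \<le> C"
      for L :: "'z measure" and Y
    proof -
      interpret L: prob_space L by fact
      have "\<bar>(LINT z|L. h (Y z)) - (LINT z|L. g (s (Y z)))\<bar> = \<bar>LINT z|L. h (Y z) - g (s (Y z))\<bar>"
        using ih ig by simp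
      also have "\<dots> \<le> (LINT z|L. 2 * B / R\<^sup>2 * (\<Sum>j\<in>UNIV. (Y z $ j)\<^sup>2) + \<epsilon> / 8)"
        unfolding real_norm_def[symmetric]
        by (rule norm_integral_le) (use ih ig i2 point in \<open>auto intro!: Bochner_Integration.integrable_add integrable_mult_right Bochner_Integration.integrable_sum\<close>)
      also have "\<dots> = 2 * B / R\<^sup>2 * (\<Sum>j\<in>UNIV. LINT z|L. (Y z $ j)\<^sup>2) + \<epsilon> / 8"
        using i2 by (simp add: Bochner_Integration.integrable_sum L.prob_space)
      also have "\<dots> \<le> 2 * B / R\<^sup>2 * (\<Sum>j\<in>(UNIV::'m set). C) + \<epsilon> / 8"
        using Bpos by (intro add_mono mult_left_mono sum_mono b2) auto
      also have "\<dots> \<le> \<epsilon> / 4" using eps by simp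
      finally show ?thesis .
    qed
    have h_bdd: "bounded (range h)" by fact
    obtain N where N: "\<And>n. n \<ge> N \<Longrightarrow> \<bar>(LINT \<omega>|M. g (s (X n \<omega>))) - (LINT x|\<mu>. g (s x))\<bar> < \<epsilon> / 4"
      using LIMSEQ_D[OF lim, of "\<epsilon> / 4"] \<epsilon> by auto
    have "\<bar>(LINT \<omega>|M. h (X n \<omega>)) - (LINT x|\<mu>. h x)\<bar> < \<epsilon>" if "n \<ge> N" for n
    proof -
      have 1: "\<bar>(LINT \<omega>|M. h (X n \<omega>)) - (LINT \<omega>|M. g (s (X n \<omega>)))\<bar> \<le> \<epsilon> / 4"
        by (rule close[OF M]) (intro int h h_bdd gs_cont gs_bdd intX bndX)+
      have 2: "\<bar>(LINT x|\<mu>. h x) - (LINT x|\<mu>. g (s x))\<bar> \<le> \<epsilon> / 4"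
        by (rule close[OF \<mu>, of "\<lambda>x. x"]) (intro int h h_bdd gs_cont gs_bdd int\<mu> bnd\<mu>)+
      show ?thesis using 1 2 N[OF that] \<epsilon> by linarith
    qed
    then show ?thesis by blast
  qed
  show "(\<lambda>n. LINT \<omega>|M. h (X n \<omega>)) \<longlonglongrightarrow> (LINT x|\<mu>. h x)"
    by (rule LIMSEQ_I) (use main in auto)
qed

text \<open>
  Cholesky factorisation by induction on the index set: the Schur complement \<open>W\<close> of the entry \<open>(p, p)\<close> is again
  positive semidefinite. If that entry vanishes, so does its row.
\<close>
lemma gram_representation:
  fixes V :: "'i \<Rightarrow> 'i \<Rightarrow> real"
  assumes "finite J" and "\<And>i j. V i j = V j i"
    and "\<And>x. 0 \<le> (\<Sum>i\<in>J. \<Sum>j\<in>J. x i * x j * V i j)"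
  shows "\<exists>u. \<forall>i\<in>J. \<forall>j\<in>J. V i j = (\<Sum>k\<in>J. u i k * u j k)"
  using assms
proof (induction J arbitrary: V rule: finite_induct)
  case empty
  then show ?case by simp
next
  case (insert p J)
  note J = insert.hyps(1) and p = insert.hyps(2) and sym = insert.prems(1) and psd = insert.prems(2)
  have quad: "(\<Sum>i\<in>insert p J. \<Sum>j\<in>insert p J. x i * x j * V i j)
    = (x p)\<^sup>2 * V p p + 2 * x p * (\<Sum>j\<in>J. x j * V p j) + (\<Sum>i\<in>J. \<Sum>j\<in>J. x i * x j * V i j)" for x
  proof -
    have "(\<Sum>i\<in>J. x i * x p * V i p) = x p * (\<Sum>j\<in>J. x j * V p j)"
      by (simp add: sum_distrib_left sym[of _ p] mult_ac)
    moreover have "(\<Sum>j\<in>J. x p * x j * V p j) = x p * (\<Sum>j\<in>J. x j * V p j)"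
      by (simp add: sum_distrib_left mult_ac)
    ultimately show ?thesis
      using J p by (simp add: sum.distrib power2_eq_square)
  qed
  have upd: "(\<Sum>i\<in>J. \<Sum>j\<in>J. (x(p := y)) i * (x(p := y)) j * V i j) = (\<Sum>i\<in>J. \<Sum>j\<in>J. x i * x j * V i j)"
    "(\<Sum>j\<in>J. (x(p := y)) j * V p j) = (\<Sum>j\<in>J. x j * V p j)" for x y
    using p by (auto intro!: sum.cong)
  have Q: "0 \<le> y\<^sup>2 * V p p + 2 * y * (\<Sum>j\<in>J. x j * V p j) + (\<Sum>i\<in>J. \<Sum>j\<in>J. x i * x j * V i j)" for x y
    using psd[of "x(p := y)"] unfolding quad upd by simp
  have Vpp: "0 \<le> V p p" using Q[of 1 "\<lambda>_. 0"] by simp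
  define W where "W i j = V i j - V p i * V p j / V p p" for i j
  have W0: "V p j = 0" if "V p p = 0" "j \<in> J" for j
  proof (rule ccontr)
    assume nz: "V p j \<noteq> 0"
    let ?x = "\<lambda>i. if i = j then 1 else 0 :: real"
    have "(\<Sum>i\<in>J. ?x i * V p i) = V p j" using J that(2) by (simp add: if_distrib[of "\<lambda>z. z * _"] sum.delta cong: if_cong)
    moreover have "(\<Sum>i\<in>J. \<Sum>l\<in>J. ?x i * ?x l * V i l) = V j j"
      using J that(2) by (simp add: if_distrib[of "\<lambda>z. z * _"] if_distrib[of "\<lambda>z. _ * z"] sum.delta cong: if_cong)
    ultimately have "0 \<le> 2 * y * V p j + V j j" for y
      using Q[of y ?x] that(1) by simp
    \<comment> \<open>The quadratic form is affine in \<open>y\<close> with nonzero slope; at this point it equals \<open>- 1\<close>.\<close>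
    from this[of "- (V j j + 1) / (2 * V p j)"] nz show False by (simp add: field_simps)
  qed
  have "\<exists>u. \<forall>i\<in>J. \<forall>j\<in>J. W i j = (\<Sum>k\<in>J. u i k * u j k)"
  proof (rule insert.IH)
    show "W i j = W j i" for i j using sym by (simp add: W_def mult.commute)
    fix x :: "'i \<Rightarrow> real"
    let ?l = "\<Sum>j\<in>J. x j * V p j"
    have "(\<Sum>i\<in>J. \<Sum>j\<in>J. x i * x j * W i j) = (\<Sum>i\<in>J. \<Sum>j\<in>J. x i * x j * V i j) - ?l * ?l / V p p"
      unfolding sum_product W_def
      by (simp add: sum_subtractf[symmetric] sum_divide_distrib right_diff_distrib mult_ac)
    also have "\<dots> \<ge> 0"
    proof (cases "V p p = 0")
      case True
      then show ?thesis using Q[of 0 x] by simp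
    next
      case False
      \<comment> \<open>This value of the coordinate \<open>p\<close> minimises the full form, and the minimum is the form of \<open>W\<close>.\<close>
      then show ?thesis using Q[of "- ?l / V p p" x] by (simp add: power2_eq_square field_simps)
    qed
    finally show "0 \<le> (\<Sum>i\<in>J. \<Sum>j\<in>J. x i * x j * W i j)" .
  qed
  then obtain u where u: "\<And>i j. i \<in> J \<Longrightarrow> j \<in> J \<Longrightarrow> W i j = (\<Sum>k\<in>J. u i k * u j k)" by blast
  define v where "v i k = (if k = p then (if V p p = 0 then 0 else V p i / sqrt (V p p)) else if i = p then 0 else u i k)" for i k
  have "V i j = (\<Sum>k\<in>insert p J. v i k * v j k)" if ij: "i \<in> insert p J" "j \<in> insert p J" for i j
  proof -
    have "(\<Sum>k\<in>insert p J. v i k * v j k) = v i p * v j p + (\<Sum>k\<in>J. v i k * v j k)"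
      using J p by simp
    also have "(\<Sum>k\<in>J. v i k * v j k) = (if i = p \<or> j = p then 0 else W i j)"
    proof (cases "i = p \<or> j = p")
      case True
      have "(\<Sum>k\<in>J. v i k * v j k) = 0"
        by (rule sum.neutral) (use True p in \<open>auto simp: v_def\<close>)
      then show ?thesis using True by simp
    next
      case False
      then have "i \<in> J" "j \<in> J" using ij by auto
      moreover have "(\<Sum>k\<in>J. v i k * v j k) = (\<Sum>k\<in>J. u i k * u j k)"
        using False p by (intro sum.cong refl) (auto simp: v_def)
      ultimately show ?thesis using u False by simp
    qed
    also have "v i p * v j p = (if V p p = 0 then 0 else V p i * V p j / V p p)"
      using Vpp by (simp add: v_def)
    finally have e: "(\<Sum>k\<in>insert p J. v i k * v j k)
      = (if V p p = 0 then 0 else V p i * V p j / V p p) + (if i = p \<or> j = p then 0 else W i j)" .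
    show ?thesis
    proof (cases "V p p = 0")
      case True
      then have "V p i = 0" "V p j = 0" using W0 ij by auto
      then show ?thesis unfolding e using True sym[of i p] by (auto simp: W_def)
    next
      case False
      then show ?thesis unfolding e using sym[of i p] by (auto simp: W_def)
    qed
  qed
  then show ?case by blast
qed


section \<open>Gaussian laws on Euclidean space\<close>

lemma (in prob_space) expectation_abs_le_sqrt:
  fixes u :: "'a \<Rightarrow> real"
  assumes "all_moments M u"
  shows "(LINT x|M. \<bar>u x\<bar>) \<le> sqrt (LINT x|M. (u x)\<^sup>2)"
proof -
  have i: "integrable M (\<lambda>x. \<bar>u x\<bar>)" "integrable M (\<lambda>x. (u x)\<^sup>2)"
    using all_moments_integrable[OF assms] all_moments_integrable[OF all_moments_power[OF assms, of 2]] by auto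
  have "0 \<le> variance (\<lambda>x. \<bar>u x\<bar>)" by (rule variance_positive)
  then have "(LINT x|M. \<bar>u x\<bar>)\<^sup>2 \<le> (LINT x|M. (u x)\<^sup>2)"
    using i by (subst (asm) variance_eq) auto
  then show ?thesis by (intro real_le_rsqrt) 
qed

lemma stein_discrepancy_bound:
  fixes d :: "'m \<Rightarrow> nat" and c :: "'m \<Rightarrow> nat set \<Rightarrow> real"
  assumes I: "finite I" and d: "\<And>j. j \<in> J \<Longrightarrow> 1 \<le> d j"
  shows "(LINT x|gauss I. \<bar>(\<Sum>j\<in>J. \<Sum>k\<in>J. a j * a k / d j * carre_du_champ I (c j) (c k) x)
        - (\<Sum>j\<in>J. \<Sum>k\<in>J. a j * a k * V j k)\<bar>)
    \<le> (\<Sum>j\<in>J. \<Sum>k\<in>J. \<bar>a j * a k\<bar> *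
         (sqrt (LINT x|gauss I. (carre_du_champ I (c j) (c k) x - d j * inner_coeff I (c j) (c k))\<^sup>2)
          + \<bar>inner_coeff I (c j) (c k) - V j k\<bar>))"
proof -
  interpret prob_space "gauss I" by (rule prob_space_gauss)
  define \<Delta> where "\<Delta> j k x = carre_du_champ I (c j) (c k) x - d j * inner_coeff I (c j) (c k)" for j k x
  have m: "all_moments (gauss I) (\<Delta> j k)" for j k
    unfolding \<Delta>_def[abs_def] by (intro gauss_moments all_moments_carre_du_champ I)
  have i: "integrable (gauss I) (\<lambda>x. \<bar>\<Delta> j k x\<bar>)" for j k
    by (intro integrable_abs all_moments_integrable m)
  have point: "\<bar>(\<Sum>j\<in>J. \<Sum>k\<in>J. a j * a k / d j * carre_du_champ I (c j) (c k) x) - (\<Sum>j\<in>J. \<Sum>k\<in>J. a j * a k * V j k)\<bar>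
    \<le> (\<Sum>j\<in>J. \<Sum>k\<in>J. \<bar>a j * a k\<bar> * (\<bar>\<Delta> j k x\<bar> + \<bar>inner_coeff I (c j) (c k) - V j k\<bar>))" for x
    unfolding sum_subtractf[symmetric]
  proof (intro order_trans[OF sum_abs] sum_mono)
    fix j k assume j: "j \<in> J"
    let ?\<Gamma> = "carre_du_champ I (c j) (c k) x" and ?i = "inner_coeff I (c j) (c k)"
    have dj: "1 \<le> real (d j)" using d[OF j] by simp
    have "a j * a k / d j * ?\<Gamma> - a j * a k * V j k = (a j * a k) * (\<Delta> j k x / d j + (?i - V j k))"
      using dj unfolding \<Delta>_def by (simp add: field_simps)
    also have "\<bar>\<dots>\<bar> \<le> \<bar>a j * a k\<bar> * (\<bar>\<Delta> j k x / d j\<bar> + \<bar>?i - V j k\<bar>)"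
      unfolding abs_mult[of "a j * a k"] by (intro mult_left_mono abs_triangle_ineq) simp
    also have "\<dots> \<le> \<bar>a j * a k\<bar> * (\<bar>\<Delta> j k x\<bar> + \<bar>?i - V j k\<bar>)"
    proof (intro mult_left_mono add_right_mono)
      show "\<bar>\<Delta> j k x / d j\<bar> \<le> \<bar>\<Delta> j k x\<bar>"
        using mult_left_mono[OF dj, of "\<bar>\<Delta> j k x\<bar>"] dj by (simp add: divide_le_eq)
    qed simp
    finally show "\<bar>a j * a k / d j * ?\<Gamma> - a j * a k * V j k\<bar> \<le> \<bar>a j * a k\<bar> * (\<bar>\<Delta> j k x\<bar> + \<bar>?i - V j k\<bar>)" .
  qed
  have "(LINT x|gauss I. \<bar>(\<Sum>j\<in>J. \<Sum>k\<in>J. a j * a k / d j * carre_du_champ I (c j) (c k) x)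
        - (\<Sum>j\<in>J. \<Sum>k\<in>J. a j * a k * V j k)\<bar>)
     \<le> (LINT x|gauss I. (\<Sum>j\<in>J. \<Sum>k\<in>J. \<bar>a j * a k\<bar> * (\<bar>\<Delta> j k x\<bar> + \<bar>inner_coeff I (c j) (c k) - V j k\<bar>)))"
  proof (rule integral_mono[OF _ _ point])
    show "integrable (gauss I) (\<lambda>x. \<bar>(\<Sum>j\<in>J. \<Sum>k\<in>J. a j * a k / d j * carre_du_champ I (c j) (c k) x) - (\<Sum>j\<in>J. \<Sum>k\<in>J. a j * a k * V j k)\<bar>)"
      by (intro integrable_abs all_moments_integrable gauss_moments all_moments_carre_du_champ I)
    show "integrable (gauss I) (\<lambda>x. \<Sum>j\<in>J. \<Sum>k\<in>J. \<bar>a j * a k\<bar> * (\<bar>\<Delta> j k x\<bar> + \<bar>inner_coeff I (c j) (c k) - V j k\<bar>))"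
      by (intro Bochner_Integration.integrable_sum integrable_mult_right Bochner_Integration.integrable_add i integrable_const)
  qed
  also have "\<dots> = (\<Sum>j\<in>J. \<Sum>k\<in>J. \<bar>a j * a k\<bar> * ((LINT x|gauss I. \<bar>\<Delta> j k x\<bar>) + \<bar>inner_coeff I (c j) (c k) - V j k\<bar>))"
    by (simp add: Bochner_Integration.integral_sum i prob_space)
  also have "\<dots> \<le> (\<Sum>j\<in>J. \<Sum>k\<in>J. \<bar>a j * a k\<bar> * (sqrt (LINT x|gauss I. (\<Delta> j k x)\<^sup>2) + \<bar>inner_coeff I (c j) (c k) - V j k\<bar>))"
    by (intro sum_mono mult_left_mono add_right_mono expectation_abs_le_sqrt m) simp
  finally show ?thesis by (simp only: \<Delta>_def)
qed

lemma char_function_multilin_bound: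
  fixes d :: "'m \<Rightarrow> nat" and c :: "'m \<Rightarrow> nat set \<Rightarrow> real"
  assumes I: "finite I" and J: "finite J" and c: "\<And>j. j \<in> J \<Longrightarrow> homogeneous (d j) (c j)"
    and d: "\<And>j. j \<in> J \<Longrightarrow> 1 \<le> d j" and V: "0 \<le> (\<Sum>j\<in>J. \<Sum>k\<in>J. a j * a k * V j k)"
  shows "norm ((CLINT x|gauss I. iexp (\<Sum>j\<in>J. a j * multilin I (c j) x))
        - complex_of_real (exp (- (\<Sum>j\<in>J. \<Sum>k\<in>J. a j * a k * V j k) / 2)))
    \<le> (\<Sum>j\<in>J. \<Sum>k\<in>J. \<bar>a j * a k\<bar> *
         (sqrt (LINT x|gauss I. (carre_du_champ I (c j) (c k) x - d j * inner_coeff I (c j) (c k))\<^sup>2)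
          + \<bar>inner_coeff I (c j) (c k) - V j k\<bar>))"
proof (rule order_trans)
  show "norm ((CLINT x|gauss I. iexp (\<Sum>j\<in>J. a j * multilin I (c j) x))
        - complex_of_real (exp (- (\<Sum>j\<in>J. \<Sum>k\<in>J. a j * a k * V j k) / 2)))
    \<le> (LINT x|gauss I. \<bar>(\<Sum>j\<in>J. \<Sum>k\<in>J. a j * a k / d j * carre_du_champ I (c j) (c k) x)
        - (\<Sum>j\<in>J. \<Sum>k\<in>J. a j * a k * V j k)\<bar>)"
    by (rule char_function_gaussian_bound[where d=d and c=c and J=J and I=I and a=a]) (fact I J c d V)+
  show "(LINT x|gauss I. \<bar>(\<Sum>j\<in>J. \<Sum>k\<in>J. a j * a k / d j * carre_du_champ I (c j) (c k) x)
        - (\<Sum>j\<in>J. \<Sum>k\<in>J. a j * a k * V j k)\<bar>)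
    \<le> (\<Sum>j\<in>J. \<Sum>k\<in>J. \<bar>a j * a k\<bar> *
         (sqrt (LINT x|gauss I. (carre_du_champ I (c j) (c k) x - d j * inner_coeff I (c j) (c k))\<^sup>2)
          + \<bar>inner_coeff I (c j) (c k) - V j k\<bar>))"
    by (rule stein_discrepancy_bound[where d=d and c=c and J=J and I=I and a=a and V=V]) (fact I d)+
qed

text \<open>
  The constant \<open>1\<close> is the multilinear polynomial of degree zero, orthogonal to \<open>F\<close>.
\<close>
lemma integral_multilin_eq_0:
  assumes I: "finite I" and c: "homogeneous d c" and d: "1 \<le> d"
  shows "(LINT x|gauss I. multilin I c x) = 0"
proof -
  have one: "multilin I (\<lambda>A. of_bool (A = {})) x = 1" for x
  proof -
    have "multilin I (\<lambda>A. of_bool (A = {})) x = (\<Sum>A\<in>Pow I. if A = {} then 1 else 0)"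
      unfolding multilin_def by (intro sum.cong refl) auto
    then show ?thesis using I by (simp add: sum.delta)
  qed
  have "c {} = 0" using c d by (auto simp: homogeneous_def)
  then have "inner_coeff I c (\<lambda>A. of_bool (A = {})) = 0"
    unfolding inner_coeff_def by (intro sum.neutral) auto
  then show ?thesis using integral_multilin_mult[OF I, of c "\<lambda>A. of_bool (A = {})"] by (simp add: one)
qed

lemma measurable_vec_lambda:
  fixes u :: "'m::finite \<Rightarrow> 'a \<Rightarrow> real"
  assumes "\<And>j. u j \<in> borel_measurable M"
  shows "(\<lambda>x. \<chi> j. u j x) \<in> borel_measurable M"
  by (rule borel_measurable_euclidean_space[THEN iffD2])
    (use assms in \<open>auto simp: Basis_vec_def inner_axis\<close>)

lemma gaussian_law_real_scaled:
  assumes "0 \<le> \<sigma>"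
  shows "gaussian_law_real (distr std_normal_distribution borel (\<lambda>y. \<sigma> * y))"
proof (cases "\<sigma> = 0")
  case True
  interpret prob_space std_normal_distribution by (rule prob_space_std_normal)
  have "distr std_normal_distribution borel (\<lambda>y. 0) = return borel (0::real)"
    by (rule measure_eqI) (auto simp: emeasure_distr emeasure_space_1[simplified] indicator_def)
  moreover have "(\<lambda>y. \<sigma> * y) = (\<lambda>y. 0)" using True by auto
  ultimately show ?thesis unfolding gaussian_law_real_def by (intro disjI1 exI[of _ 0]) (simp only:)
next
  case False
  then have \<sigma>: "0 < \<sigma>" using assms by simp
  interpret prob_space std_normal_distribution by (rule prob_space_std_normal)
  have "distributed std_normal_distribution lborel (\<lambda>x. x) std_normal_density"
    by (auto simp: distributed_def intro!: measure_eqI simp: distr_id2)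
  from normal_density_affine[OF this, of \<sigma> 0]
  have "distributed std_normal_distribution lborel (\<lambda>y. \<sigma> * y) (normal_density 0 \<sigma>)"
    using \<sigma> by simp
  then have "distr std_normal_distribution lborel (\<lambda>y. \<sigma> * y) = density lborel (normal_density 0 \<sigma>)"
    by (simp add: distributed_def)
  moreover have "distr std_normal_distribution lborel (\<lambda>y. \<sigma> * y) = distr std_normal_distribution borel (\<lambda>y. \<sigma> * y)"
    by (rule distr_cong) auto
  ultimately show ?thesis unfolding gaussian_law_real_def using \<sigma> by metis
qed

lemma char_scaled_std_normal:
  "char (distr std_normal_distribution borel (\<lambda>y. \<sigma> * y)) t = complex_of_real (exp (- ((t * \<sigma>)\<^sup>2) / 2))"
proof -
  have "char (distr std_normal_distribution borel (\<lambda>y. \<sigma> * y)) t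
    = (CLINT y|std_normal_distribution. iexp (t * (\<sigma> * y)))"
    unfolding char_def by (rule integral_distr) auto
  then show ?thesis by (simp only: mult.assoc[symmetric] std_normal_iexp)
qed

lemma inner_matrix_vector:
  fixes V :: "real ^ 'm ^ 'm::finite"
  shows "a \<bullet> (V *v a) = (\<Sum>i\<in>UNIV. \<Sum>j\<in>UNIV. a $ i * a $ j * V $ i $ j)"
  by (simp add: inner_vec_def matrix_vector_mult_def sum_distrib_left mult_ac)

text \<open>
  Linear forms are multilinear polynomials of degree one, whose gradient products are constant. For
  them the bound on characteristic functions is zero, and this identifies the one-dimensional
  images, including those of zero variance, by uniqueness of characteristic functions.
\<close>
lemma centered_gaussian_law_exists:
  fixes V :: "real ^ 'm::finite ^ 'm"
  assumes V: "nonneg_symmetric V"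
  obtains \<mu> where "centered_gaussian_law V \<mu>"
    "\<And>a. (CLINT x|\<mu>. iexp (a \<bullet> x)) = complex_of_real (exp (- (a \<bullet> (V *v a)) / 2))"
    "\<And>j. integrable \<mu> (\<lambda>x. (x $ j)\<^sup>2)"
proof -
  have sym: "V $ i $ j = V $ j $ i" for i j
    using V unfolding nonneg_symmetric_def transpose_def by (metis vec_lambda_beta)
  have psd: "0 \<le> (\<Sum>i\<in>UNIV. \<Sum>j\<in>UNIV. x i * x j * V $ i $ j)" for x :: "'m \<Rightarrow> real"
  proof -
    have "0 \<le> (\<chi> i. x i) \<bullet> (V *v (\<chi> i. x i))" using V by (simp add: nonneg_symmetric_def)
    then show ?thesis unfolding inner_matrix_vector by simp
  qed
  have "\<exists>u. \<forall>i\<in>UNIV. \<forall>j\<in>UNIV. V $ i $ j = (\<Sum>k\<in>(UNIV :: 'm set). u i k * u j k)"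
    by (rule gram_representation[where V="\<lambda>i j. V $ i $ j" and J=UNIV]) (simp, rule sym, rule psd)
  then obtain u where "\<forall>i\<in>UNIV. \<forall>j\<in>UNIV. V $ i $ j = (\<Sum>k\<in>(UNIV :: 'm set). u i k * u j k)" ..
  then have u: "V $ i $ j = (\<Sum>k\<in>UNIV. u i k * u j k)" for i j by blast
  define e :: "'m \<Rightarrow> nat set" where "e k = {to_nat k}" for k
  define I :: "nat set" where "I = range (to_nat :: 'm \<Rightarrow> nat)"
  have I: "finite I" by (simp add: I_def)
  have e_inj: "inj e" by (auto simp: e_def inj_def)
  define c where "c j A = (if A \<in> range e then u j (inv e A) else 0)" for j A
  have ce: "c j (e k) = u j k" for j k by (simp add: c_def inv_f_f[OF e_inj])
  have hom: "homogeneous 1 (c j)" for j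
    by (auto simp: homogeneous_def c_def e_def split: if_splits)
  have inner: "inner_coeff I (c i) (c j) = V $ i $ j" for i j
  proof -
    have "inner_coeff I (c i) (c j) = (\<Sum>A\<in>range e. c i A * c j A)"
      unfolding inner_coeff_def by (rule sum.mono_neutral_right) (auto simp: I_def e_def c_def)
    also have "\<dots> = (\<Sum>k\<in>UNIV. u i k * u j k)"
      by (subst sum.reindex[OF e_inj]) (simp add: ce)
    finally show ?thesis by (simp add: u)
  qed
  let ?X = "\<lambda>x. \<chi> j. multilin I (c j) x"
  have mm: "all_moments (gauss I) (multilin I (c j))" for j by (rule all_moments_multilin[OF I]) simp
  have X [measurable]: "?X \<in> borel_measurable (gauss I)"
    by (rule measurable_vec_lambda) (rule all_moments_measurable[OF mm])
  define \<mu> where "\<mu> = distr (gauss I) borel ?X"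
  interpret P: prob_space "gauss I" by (rule prob_space_gauss)
  interpret \<mu>: prob_space \<mu> unfolding \<mu>_def by (rule P.prob_space_distr[OF X])
  have sets_\<mu>: "sets \<mu> = sets borel" by (simp add: \<mu>_def)
  have variance_0: "(LINT x|gauss I. (carre_du_champ I (c i) (c j) x - real 1 * inner_coeff I (c i) (c j))\<^sup>2) = 0" for i j
  proof (rule antisym)
    have empty: "{r. 1 \<le> r \<and> r \<le> 1 \<and> r \<le> 1 \<and> \<not> (r = 1 \<and> r = (1::nat))} = {}" by auto
    show "(LINT x|gauss I. (carre_du_champ I (c i) (c j) x - real 1 * inner_coeff I (c i) (c j))\<^sup>2) \<le> 0"
      using carre_du_champ_variance[OF I hom hom order_refl order_refl, of i j] unfolding empty by simp
  qed simp
  have char: "(CLINT x|\<mu>. iexp (a \<bullet> x)) = complex_of_real (exp (- (a \<bullet> (V *v a)) / 2))" for a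
  proof -
    have "norm ((CLINT x|gauss I. iexp (\<Sum>j\<in>UNIV. a $ j * multilin I (c j) x))
        - complex_of_real (exp (- (\<Sum>j\<in>UNIV. \<Sum>k\<in>UNIV. a $ j * a $ k * V $ j $ k) / 2))) \<le> 0"
      using char_function_multilin_bound[OF I, of UNIV "\<lambda>_. 1" c "\<lambda>j. a $ j" "\<lambda>i j. V $ i $ j"] hom psd[of "\<lambda>j. a $ j"]
        variance_0
      by (simp add: inner)
    then have "(CLINT x|gauss I. iexp (\<Sum>j\<in>UNIV. a $ j * multilin I (c j) x))
      = complex_of_real (exp (- (a \<bullet> (V *v a)) / 2))"
      unfolding inner_matrix_vector by simp
    moreover have "(CLINT x|\<mu>. iexp (a \<bullet> x)) = (CLINT x|gauss I. iexp (a \<bullet> ?X x))"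
      unfolding \<mu>_def by (rule integral_distr[OF X]) measurable
    moreover have "a \<bullet> ?X x = (\<Sum>j\<in>UNIV. a $ j * multilin I (c j) x)" for x
      by (simp add: inner_vec_def)
    ultimately show ?thesis by simp
  qed
  have comp [measurable]: "(\<lambda>x :: real ^ 'm. x $ j) \<in> borel_measurable borel" for j
    by (intro borel_measurable_continuous_onI continuous_intros)
  have "centered_gaussian_law V \<mu>"
    unfolding centered_gaussian_law_def
  proof (intro conjI allI)
    show "prob_space \<mu>" by unfold_locales
    show "sets \<mu> = sets borel" by (rule sets_\<mu>)
    show "(LINT x|\<mu>. x $ i) = 0" for i
      using integral_multilin_eq_0[OF I hom order_refl, of i] unfolding \<mu>_def by (subst integral_distr[OF X]) simp_all
    show "(LINT x|\<mu>. x $ i * x $ j) = V $ i $ j" for i j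
      using integral_multilin_mult[OF I, of "c i" "c j"] unfolding \<mu>_def by (subst integral_distr[OF X]) (simp_all add: inner)
    fix a :: "real ^ 'm"
    let ?\<nu> = "distr \<mu> borel (\<lambda>x. a \<bullet> x)"
    define \<sigma> where "\<sigma> = sqrt (a \<bullet> (V *v a))"
    have q: "0 \<le> a \<bullet> (V *v a)" using V by (simp add: nonneg_symmetric_def)
    have am [measurable]: "(\<lambda>x. a \<bullet> x) \<in> borel_measurable \<mu>"
      by (simp add: measurable_cong_sets[OF sets_\<mu> refl])
    have "?\<nu> = distr std_normal_distribution borel (\<lambda>y. \<sigma> * y)"
    proof (rule Levy_uniqueness)
      show "real_distribution ?\<nu>"
        using \<mu>.prob_space_distr[OF am] by (simp add: real_distribution_def real_distribution_axioms_def)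
      show "real_distribution (distr std_normal_distribution borel (\<lambda>y. \<sigma> * y))"
        using prob_space.prob_space_distr[OF prob_space_std_normal, of "\<lambda>y. \<sigma> * y" borel]
        by (simp add: real_distribution_def real_distribution_axioms_def)
      show "char ?\<nu> = char (distr std_normal_distribution borel (\<lambda>y. \<sigma> * y))"
      proof
        fix t
        have "char ?\<nu> t = (CLINT x|\<mu>. iexp ((t *\<^sub>R a) \<bullet> x))"
          unfolding char_def by (subst integral_distr[OF am]) auto
        also have "\<dots> = complex_of_real (exp (- ((t *\<^sub>R a) \<bullet> (V *v (t *\<^sub>R a))) / 2))"
          by (rule char)
        also have "(t *\<^sub>R a) \<bullet> (V *v (t *\<^sub>R a)) = (t * \<sigma>)\<^sup>2"
          using q unfolding \<sigma>_def
          by (simp add: matrix_vector_mult_scaleR power_mult_distrib power2_eq_square[of t] mult.assoc)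
        finally show "char ?\<nu> t = char (distr std_normal_distribution borel (\<lambda>y. \<sigma> * y)) t"
          by (simp add: char_scaled_std_normal)
      qed
    qed
    then show "gaussian_law_real ?\<nu>"
      using gaussian_law_real_scaled[of \<sigma>] q by (simp add: \<sigma>_def)
  qed
  moreover have "integrable \<mu> (\<lambda>x. (x $ j)\<^sup>2)" for j
    unfolding \<mu>_def using all_moments_integrable[OF gauss_power[OF mm[of j], of 2]]
    by (subst integrable_distr_eq[OF X]) simp_all
  ultimately show thesis using char by (intro that)
qed

text \<open>
  A nonzero variance excludes the point masses.
\<close>
lemma centered_gaussian_law_coordinate:
  fixes V :: "real ^ 'm::finite ^ 'm"
  assumes \<mu>: "centered_gaussian_law V \<mu>" and nz: "V $ j $ j \<noteq> 0"
  obtains \<sigma> where "0 < \<sigma>" "\<sigma>\<^sup>2 = V $ j $ j" "distr \<mu> borel (\<lambda>x. x $ j) = density lborel (normal_density 0 \<sigma>)"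
proof -
  let ?\<nu> = "distr \<mu> borel (\<lambda>x. x $ j)"
  have sets_\<mu>: "sets \<mu> = sets borel" using \<mu> by (simp add: centered_gaussian_law_def)
  have comp [measurable]: "(\<lambda>x :: real ^ 'm. x $ j) \<in> borel_measurable \<mu>"
    unfolding measurable_cong_sets[OF sets_\<mu> refl]
    by (intro borel_measurable_continuous_onI continuous_intros)
  have "gaussian_law_real (distr \<mu> borel (\<lambda>x. axis j 1 \<bullet> x))"
    using \<mu> by (simp add: centered_gaussian_law_def)
  then have g: "gaussian_law_real ?\<nu>" by (simp add: inner_axis')
  have m1: "(LINT y|?\<nu>. y) = 0" and m2: "(LINT y|?\<nu>. y * y) = V $ j $ j"
    using \<mu> by (simp_all add: integral_distr centered_gaussian_law_def)
  from g consider (point) c where "?\<nu> = return borel c"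
    | (normal) c \<sigma> where "\<sigma> > 0" "?\<nu> = density lborel (\<lambda>x. ennreal (normal_density c \<sigma> x))"
    unfolding gaussian_law_real_def by blast
  then show thesis
  proof cases
    case point
    then have "c = 0" using m1 by (simp add: integral_return)
    then show ?thesis using m2 nz point by (simp add: integral_return)
  next
    case normal
    have dens: "(LINT y|?\<nu>. f y) = (LINT y|lborel. normal_density c \<sigma> y * f y)"
      if [measurable]: "f \<in> borel_measurable borel" for f :: "real \<Rightarrow> real"
      unfolding normal(2) by (subst integral_density) auto
    have "c = 0" using m1 integral_normal_moment_nz_1[OF normal(1), of c] by (simp add: dens)
    moreover have "\<sigma>\<^sup>2 = V $ j $ j"
      using m2 integral_normal_moment_even[OF normal(1), of c 1] \<open>c = 0\<close>
      by (simp add: dens power2_eq_square fact_numeral)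
    ultimately show ?thesis using that normal by simp
  qed
qed

text \<open>
  Truncating \<open>y\<^sup>4\<close> at \<open>L\<^sup>4\<close> gives a bounded continuous function, and the error is at most
  \<open>y\<^sup>6 / L\<^sup>2\<close>.
\<close>
lemma fourth_moment_convergence:
  fixes Y :: "nat \<Rightarrow> 'a \<Rightarrow> real" and \<nu> :: "real measure"
  assumes M: "prob_space M" and \<nu>: "prob_space \<nu>" and sets_\<nu>: "sets \<nu> = sets borel"
    and Y: "\<And>n. all_moments M (Y n)" and Y6: "\<And>n. (LINT \<omega>|M. Y n \<omega> ^ 6) \<le> C"
    and id: "all_moments \<nu> (\<lambda>y. y)" and \<nu>6: "(LINT y|\<nu>. y ^ 6) \<le> C"
    and weak: "\<And>h. continuous_on UNIV h \<Longrightarrow> bounded (range h) \<Longrightarrow>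
      (\<lambda>n. LINT \<omega>|M. h (Y n \<omega>)) \<longlonglongrightarrow> (LINT y|\<nu>. h y :: real)"
  shows "(\<lambda>n. LINT \<omega>|M. Y n \<omega> ^ 4) \<longlonglongrightarrow> (LINT y|\<nu>. y ^ 4)"
proof (rule LIMSEQ_I)
  fix \<epsilon> :: real assume \<epsilon>: "0 < \<epsilon>"
  have "0 \<le> (LINT y|\<nu>. y ^ 6)" by (intro Bochner_Integration.integral_nonneg) simp
  then have C: "0 \<le> C" using \<nu>6 by linarith
  \<comment> \<open>The truncation error \<open>C / L\<^sup>2\<close> is then at most \<open>\<epsilon> / 4\<close>, for the sequence as well as for the limit.\<close>
  define L where "L = sqrt (4 * (C + 1) / \<epsilon>)"
  have L2: "L\<^sup>2 = 4 * (C + 1) / \<epsilon>" and L: "0 < L" using C \<epsilon> by (auto simp: L_def)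
  have CL: "C / L\<^sup>2 \<le> \<epsilon> / 4" using C \<epsilon> unfolding L2 by (simp add: field_simps)
  define h where "h y = min (y ^ 4) (L ^ 4)" for y :: real
  have h_cont: "continuous_on UNIV h" unfolding h_def[abs_def] by (intro continuous_intros)
  have h_bdd: "bounded (range h)" by (auto simp: bounded_iff h_def intro!: exI[of _ "L ^ 4"])
  have point: "\<bar>y ^ 4 - h y\<bar> \<le> y ^ 6 / L\<^sup>2" for y
  proof (cases "y ^ 4 \<le> L ^ 4")
    case True
    then show ?thesis by (simp add: h_def)
  next
    case False
    have "L\<^sup>2 \<le> y\<^sup>2"
    proof (rule ccontr)
      assume "\<not> L\<^sup>2 \<le> y\<^sup>2"
      then have "y\<^sup>2 \<le> L\<^sup>2" by simp
      from power_mono[OF this, of 2] have "(y\<^sup>2)\<^sup>2 \<le> (L\<^sup>2)\<^sup>2" by simp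
      then show False using False by simp
    qed
    then have "y ^ 4 * L\<^sup>2 \<le> y ^ 4 * y\<^sup>2" by (intro mult_left_mono) auto
    then have "y ^ 4 \<le> y ^ 6 / L\<^sup>2" using L by (simp add: field_simps flip: power_add)
    moreover have "0 \<le> y ^ 4 - h y" "y ^ 4 - h y \<le> y ^ 4" using L by (auto simp: h_def)
    ultimately show ?thesis by linarith
  qed
  have close: "\<bar>(LINT z|K. Z z ^ 4) - (LINT z|K. h (Z z))\<bar> \<le> \<epsilon> / 4"
    if K: "prob_space K" and Z: "all_moments K Z" and Z6: "(LINT z|K. Z z ^ 6) \<le> C" for K :: "'z measure" and Z
  proof -
    interpret prob_space K by fact
    have [measurable]: "Z \<in> borel_measurable K" by (rule all_moments_measurable[OF Z])
    have [measurable]: "h \<in> borel_measurable borel" by (rule borel_measurable_continuous_onI[OF h_cont])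
    have i4: "integrable K (\<lambda>z. Z z ^ 4)" and i6: "integrable K (\<lambda>z. Z z ^ 6)"
      by (intro all_moments_integrable all_moments_power Z)+
    have ih: "integrable K (\<lambda>z. h (Z z))"
      by (rule integrable_const_bound[of _ "L ^ 4"]) (auto simp: h_def)
    have "\<bar>(LINT z|K. Z z ^ 4) - (LINT z|K. h (Z z))\<bar> = \<bar>LINT z|K. Z z ^ 4 - h (Z z)\<bar>"
      using i4 ih by simp
    also have "\<dots> \<le> (LINT z|K. Z z ^ 6 / L\<^sup>2)"
      unfolding real_norm_def[symmetric]
      by (rule norm_integral_le) (use i4 ih i6 point in auto)
    also have "\<dots> \<le> C / L\<^sup>2" using Z6 L by (simp add: divide_right_mono)
    finally show ?thesis using CL by linarith
  qed
  obtain n0 where n0: "\<And>n. n \<ge> n0 \<Longrightarrow> \<bar>(LINT \<omega>|M. h (Y n \<omega>)) - (LINT y|\<nu>. h y)\<bar> < \<epsilon> / 4"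
    using LIMSEQ_D[OF weak[OF h_cont h_bdd], of "\<epsilon> / 4"] \<epsilon> by auto
  have "norm ((LINT \<omega>|M. Y n \<omega> ^ 4) - (LINT y|\<nu>. y ^ 4)) < \<epsilon>" if "n \<ge> n0" for n
    using close[OF M Y Y6, of n] close[OF \<nu> id \<nu>6] n0[OF that] \<epsilon> unfolding real_norm_def by linarith
  then show "\<exists>n0. \<forall>n\<ge>n0. norm ((LINT \<omega>|M. Y n \<omega> ^ 4) - (LINT y|\<nu>. y ^ 4)) < \<epsilon>" by blast
qed

lemma normal_law_moments:
  assumes \<sigma>: "0 < \<sigma>"
  shows "all_moments (density lborel (normal_density 0 \<sigma>)) (\<lambda>y. y)"
    "(LINT y|density lborel (normal_density 0 \<sigma>). y ^ 4) = 3 * (\<sigma>\<^sup>2)\<^sup>2"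
proof -
  show "all_moments (density lborel (normal_density 0 \<sigma>)) (\<lambda>y. y)"
    unfolding all_moments_def using integrable_normal_moment_abs[OF \<sigma>, of 0]
    by (auto simp: integrable_density)
  show "(LINT y|density lborel (normal_density 0 \<sigma>). y ^ 4) = 3 * (\<sigma>\<^sup>2)\<^sup>2"
    using integral_normal_moment_even[OF \<sigma>, of 0 2]
    by (subst integral_density) (auto simp: fact_numeral power_divide)
qed


section \<open>Homogeneous sums and the equivalence\<close>

lemma finite_tuples: "finite (tuples N k)"
  unfolding tuples_def by (rule finite_lists_length_eq) simp

text \<open>
  Each set with \<open>k\<close> elements has \<open>k!\<close> enumerations.
\<close>
lemma sum_tuples_distinct:
  fixes g :: "nat list \<Rightarrow> real"
  assumes zero: "\<And>xs. xs \<in> tuples N k \<Longrightarrow> \<not> distinct xs \<Longrightarrow> g xs = 0"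
    and val: "\<And>xs. xs \<in> tuples N k \<Longrightarrow> distinct xs \<Longrightarrow> g xs = \<phi> (set xs)"
  shows "(\<Sum>xs\<in>tuples N k. g xs) = fact k * (\<Sum>A | A \<subseteq> {1..N} \<and> card A = k. \<phi> A)"
proof -
  let ?S = "{A. A \<subseteq> {1..N} \<and> card A = k}"
  have fin: "finite A" if "A \<in> ?S" for A using that by (auto dest: finite_subset)
  have "(\<Sum>xs\<in>tuples N k. g xs) = (\<Sum>xs\<in>{xs \<in> tuples N k. distinct xs}. \<phi> (set xs))"
    using finite_tuples zero val by (intro sum.mono_neutral_cong_right) auto
  also have "{xs \<in> tuples N k. distinct xs} = (\<Union>A\<in>?S. permutations_of_set A)"
    by (auto simp: tuples_def permutations_of_set_def distinct_card)
  also have "(\<Sum>xs\<in>(\<Union>A\<in>?S. permutations_of_set A). \<phi> (set xs)) = (\<Sum>A\<in>?S. \<Sum>xs\<in>permutations_of_set A. \<phi> (set xs))"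
    by (rule sum.UNION_disjoint) (simp, simp, auto simp: permutations_of_set_def)
  also have "\<dots> = (\<Sum>A\<in>?S. fact k * \<phi> A)"
  proof (intro sum.cong refl)
    fix A assume A: "A \<in> ?S"
    have "(\<Sum>xs\<in>permutations_of_set A. \<phi> (set xs)) = (\<Sum>xs\<in>permutations_of_set A. \<phi> A)"
      by (intro sum.cong refl) (auto simp: permutations_of_set_def)
    also have "\<dots> = fact k * \<phi> A" using A fin[OF A] by (simp add: card_permutations_of_set)
    finally show "(\<Sum>xs\<in>permutations_of_set A. \<phi> (set xs)) = fact k * \<phi> A" .
  qed
  finally show ?thesis by (simp add: sum_distrib_left)
qed

text \<open>
  The factor \<open>d!\<close> collects the tuples with the same entries.
\<close>
definition tuple_coeff :: "nat \<Rightarrow> nat \<Rightarrow> (nat list \<Rightarrow> real) \<Rightarrow> nat set \<Rightarrow> real" where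
  "tuple_coeff N d f A = (if A \<subseteq> {1..N} \<and> card A = d then fact d * f (sorted_list_of_set A) else 0)"

lemma homogeneous_tuple_coeff: "homogeneous d (tuple_coeff N d f)"
  by (auto simp: homogeneous_def tuple_coeff_def split: if_splits)

lemma tuple_coeff_eq:
  assumes sym: "symmetric_on_tuples N d f" and diag: "vanishes_on_diagonals N d f" and xs: "xs \<in> tuples N d"
  shows "f xs = (if distinct xs then tuple_coeff N d f (set xs) / fact d else 0)"
proof (cases "distinct xs")
  case True
  have len: "length xs = d" and sub: "set xs \<subseteq> {1..N}" using xs by (auto simp: tuples_def)
  have "mset (sorted_list_of_set (set xs)) = mset xs"
    using True by (subst set_eq_iff_mset_eq_distinct[symmetric]) auto
  then obtain p where p: "p permutes {..<length xs}" "permute_list p xs = sorted_list_of_set (set xs)"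
    by (rule mset_eq_permutation)
  then have "f (sorted_list_of_set (set xs)) = f xs"
    using sym xs len unfolding symmetric_on_tuples_def by metis
  then show ?thesis using True len sub by (simp add: tuple_coeff_def distinct_card)
next
  case False
  then show ?thesis
    using diag xs unfolding vanishes_on_diagonals_def by (auto simp: tuples_def distinct_conv_nth)
qed

lemma homogeneous_sum_multilin:
  assumes sym: "symmetric_on_tuples N d f" and diag: "vanishes_on_diagonals N d f"
    and I: "finite I" "{1..N} \<subseteq> I"
  shows "homogeneous_sum d N f G \<omega> = multilin I (tuple_coeff N d f) (\<lambda>i\<in>I. G i \<omega>)"
proof -
  let ?c = "tuple_coeff N d f"
  have "homogeneous_sum d N f G \<omega> = fact d * (\<Sum>A | A \<subseteq> {1..N} \<and> card A = d. ?c A / fact d * (\<Prod>i\<in>A. G i \<omega>))"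
    unfolding homogeneous_sum_def
  proof (rule sum_tuples_distinct)
    fix xs assume xs: "xs \<in> tuples N d"
    show "f xs * (\<Prod>k<d. G (xs ! k) \<omega>) = 0" if "\<not> distinct xs"
      using tuple_coeff_eq[OF sym diag xs] that by simp
    assume dist: "distinct xs"
    have "(\<Prod>k<d. G (xs ! k) \<omega>) = (\<Prod>i\<in>set xs. G i \<omega>)"
      by (rule prod.reindex_bij_betw) (use dist xs in \<open>auto intro!: bij_betw_nth simp: tuples_def\<close>)
    then show "f xs * (\<Prod>k<d. G (xs ! k) \<omega>) = ?c (set xs) / fact d * (\<Prod>i\<in>set xs. G i \<omega>)"
      using tuple_coeff_eq[OF sym diag xs] dist by simp
  qed
  also have "\<dots> = (\<Sum>A | A \<subseteq> {1..N} \<and> card A = d. ?c A * (\<Prod>i\<in>A. G i \<omega>))"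
    by (simp add: sum_distrib_left)
  also have "\<dots> = multilin I ?c (\<lambda>i\<in>I. G i \<omega>)"
    unfolding multilin_def
    using I by (intro sum.mono_neutral_cong_left) (auto simp: tuple_coeff_def intro!: prod.cong arg_cong2[of _ _ _ _ "(*)"])
  finally show ?thesis .
qed

lemma sum_tuples_append:
  fixes g :: "nat list \<Rightarrow> nat list \<Rightarrow> real"
  shows "(\<Sum>js\<in>tuples N (2 * k). g (take k js) (drop k js)) = (\<Sum>xs\<in>tuples N k. \<Sum>ys\<in>tuples N k. g xs ys)"
proof -
  have "(\<Sum>js\<in>tuples N (2 * k). g (take k js) (drop k js)) = (\<Sum>(xs, ys)\<in>tuples N k \<times> tuples N k. g xs ys)"
    by (rule sum.reindex_bij_witness[where i="\<lambda>(xs, ys). xs @ ys" and j="\<lambda>js. (take k js, drop k js)"])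
      (auto simp: tuples_def dest: in_set_takeD in_set_dropD)
  then show ?thesis by (simp add: sum.cartesian_product)
qed

text \<open>
  Enumerating the contracted set gives \<open>r!\<close>, enumerating the two free sets gives \<open>((d - r)!)\<^sup>2\<close>
  in the squared norm, and each coefficient carries \<open>d!\<close>.
\<close>
lemma tuple_norm_contraction:
  assumes sym: "symmetric_on_tuples N d f" and diag: "vanishes_on_diagonals N d f"
    and I: "finite I" "{1..N} \<subseteq> I" and r: "r \<le> d"
  shows "tuple_norm (2 * d - 2 * r) N (contraction d N r f)
    = fact r * fact (d - r) / (fact d)\<^sup>2 * sqrt (sqnorm I (contr I r (tuple_coeff N d f) (tuple_coeff N d f)))"
proof -
  let ?c = "tuple_coeff N d f"
  define k where "k = d - r"
  define \<kappa> :: real where "\<kappa> = fact r / (fact d)\<^sup>2"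
  let ?K = "contr I r ?c ?c"
  define h where "h xs ys = (\<Sum>as\<in>tuples N r. f (as @ xs) * f (as @ ys))" for xs ys
  have app: "as @ xs \<in> tuples N d" if "as \<in> tuples N r" "xs \<in> tuples N k" for as xs
    using that r by (auto simp: tuples_def k_def)
  have h_zero: "h xs ys = 0" if "xs \<in> tuples N k" "ys \<in> tuples N k" "\<not> distinct xs \<or> \<not> distinct ys" for xs ys
    unfolding h_def
  proof (rule sum.neutral, rule ballI)
    fix as assume "as \<in> tuples N r"
    then show "f (as @ xs) * f (as @ ys) = 0"
      using tuple_coeff_eq[OF sym diag app] that by auto
  qed
  have h_val: "h xs ys = \<kappa> * ?K (set xs) (set ys)"
    if xs: "xs \<in> tuples N k" "distinct xs" and ys: "ys \<in> tuples N k" "distinct ys" for xs ys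
  proof -
    let ?\<phi> = "\<lambda>C. of_bool (C \<inter> set xs = {} \<and> C \<inter> set ys = {}) * (?c (C \<union> set xs) * ?c (C \<union> set ys)) / (fact d)\<^sup>2"
    have "h xs ys = fact r * (\<Sum>C | C \<subseteq> {1..N} \<and> card C = r. ?\<phi> C)"
      unfolding h_def
    proof (rule sum_tuples_distinct)
      fix as assume as: "as \<in> tuples N r"
      note e = tuple_coeff_eq[OF sym diag app[OF as xs(1)]] tuple_coeff_eq[OF sym diag app[OF as ys(1)]]
      show "f (as @ xs) * f (as @ ys) = 0" if "\<not> distinct as" using e that by simp
      show "f (as @ xs) * f (as @ ys) = ?\<phi> (set as)" if "distinct as"
        unfolding e using that xs ys by (simp add: power2_eq_square)
    qed
    also have "(\<Sum>C | C \<subseteq> {1..N} \<and> card C = r. ?\<phi> C)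
      = (\<Sum>C | C \<subseteq> I \<and> card C = r \<and> C \<inter> set xs = {} \<and> C \<inter> set ys = {}. ?c (C \<union> set xs) * ?c (C \<union> set ys) / (fact d)\<^sup>2)"
    proof (rule sum.mono_neutral_cong)
      show "finite {C. C \<subseteq> {1..N} \<and> card C = r}" by simp
      show "finite {C. C \<subseteq> I \<and> card C = r \<and> C \<inter> set xs = {} \<and> C \<inter> set ys = {}}" using I by simp
    qed (use I in \<open>auto simp: tuple_coeff_def\<close>)
    also have "\<dots> = ?K (set xs) (set ys) / (fact d)\<^sup>2"
      by (simp add: contr_def sum_divide_distrib)
    finally show ?thesis by (simp add: \<kappa>_def)
  qed
  have K_zero: "?K A B = 0" if "\<not> (A \<subseteq> {1..N} \<and> card A = k \<and> B \<subseteq> {1..N} \<and> card B = k)" and AB: "A \<subseteq> I" "B \<subseteq> I" for A B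
  proof (rule ccontr)
    assume nz: "?K A B \<noteq> 0"
    from contr_homogeneous_nonzero[OF I(1) homogeneous_tuple_coeff homogeneous_tuple_coeff AB nz]
    have "card A = k" "card B = k" by (auto simp: k_def)
    moreover obtain C where "?c (C \<union> A) * ?c (C \<union> B) \<noteq> 0"
      using nz unfolding contr_def by (auto elim!: sum.not_neutral_contains_not_neutral)
    then have "A \<subseteq> {1..N}" "B \<subseteq> {1..N}" by (auto simp: tuple_coeff_def split: if_splits)
    ultimately show False using that by simp
  qed
  let ?S = "{A. A \<subseteq> {1..N} \<and> card A = k}"
  have "(\<Sum>js\<in>tuples N (2 * d - 2 * r). (contraction d N r f js)\<^sup>2) = (\<Sum>xs\<in>tuples N k. \<Sum>ys\<in>tuples N k. (h xs ys)\<^sup>2)"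
    unfolding contraction_def h_def sum_tuples_append[symmetric] k_def by (simp add: diff_mult_distrib2)
  also have "\<dots> = (\<Sum>xs\<in>tuples N k. if distinct xs then fact k * (\<Sum>B\<in>?S. (\<kappa> * ?K (set xs) B)\<^sup>2) else 0)"
  proof (rule sum.cong[OF refl])
    fix xs assume xs: "xs \<in> tuples N k"
    show "(\<Sum>ys\<in>tuples N k. (h xs ys)\<^sup>2) = (if distinct xs then fact k * (\<Sum>B\<in>?S. (\<kappa> * ?K (set xs) B)\<^sup>2) else 0)"
    proof (cases "distinct xs")
      case True
      have "(\<Sum>ys\<in>tuples N k. (h xs ys)\<^sup>2) = fact k * (\<Sum>B\<in>?S. (\<kappa> * ?K (set xs) B)\<^sup>2)"
        by (rule sum_tuples_distinct) (use h_zero h_val xs True in auto)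
      then show ?thesis using True by simp
    next
      case False
      then show ?thesis using h_zero xs by simp
    qed
  qed
  also have "\<dots> = fact k * (\<Sum>A\<in>?S. fact k * (\<Sum>B\<in>?S. (\<kappa> * ?K A B)\<^sup>2))"
    by (rule sum_tuples_distinct) auto
  also have "\<dots> = (fact k * \<kappa>)\<^sup>2 * (\<Sum>A\<in>?S. \<Sum>B\<in>?S. (?K A B)\<^sup>2)"
    by (simp add: power_mult_distrib sum_distrib_left power2_eq_square mult_ac)
  also have "(\<Sum>A\<in>?S. \<Sum>B\<in>?S. (?K A B)\<^sup>2) = sqnorm I ?K"
  proof -
    have "(\<Sum>A\<in>?S. \<Sum>B\<in>?S. (?K A B)\<^sup>2) = (\<Sum>A\<in>?S. \<Sum>B\<in>Pow I. (?K A B)\<^sup>2)"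
    proof (rule sum.cong[OF refl])
      fix A assume A: "A \<in> ?S"
      have "?K A B = 0" if "B \<in> Pow I - ?S" for B using A I that by (intro K_zero) auto
      then show "(\<Sum>B\<in>?S. (?K A B)\<^sup>2) = (\<Sum>B\<in>Pow I. (?K A B)\<^sup>2)"
        using I by (intro sum.mono_neutral_left) auto
    qed
    also have "\<dots> = (\<Sum>A\<in>Pow I. \<Sum>B\<in>Pow I. (?K A B)\<^sup>2)"
    proof -
      have "?K A B = 0" if "A \<in> Pow I - ?S" "B \<in> Pow I" for A B using that by (intro K_zero) auto
      then have "(\<Sum>B\<in>Pow I. (?K A B)\<^sup>2) = 0" if "A \<in> Pow I - ?S" for A using that by simp
      then show ?thesis using I by (intro sum.mono_neutral_left) auto
    qed
    finally show ?thesis by (simp add: sqnorm_def)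
  qed
  finally have "tuple_norm (2 * d - 2 * r) N (contraction d N r f) = sqrt ((fact k * \<kappa>)\<^sup>2 * sqnorm I ?K)"
    by (simp add: tuple_norm_def L2_set_def)
  also have "\<dots> = (fact k * \<kappa>) * sqrt (sqnorm I ?K)"
    by (simp add: real_sqrt_mult \<kappa>_def)
  finally show ?thesis by (simp add: \<kappa>_def k_def mult_ac)
qed

text \<open>
  The sequence of random vectors in the form in which the argument uses it: the component \<open>j\<close> is a
  multilinear polynomial of degree \<open>d j\<close> in the coordinates of \<open>\<xi> n\<close>, which is a standard Gaussian
  family on an index set that may grow with \<open>n\<close>.
\<close>
locale chaos_vectors = prob_space M for M :: "'a measure" +
  fixes \<xi> :: "nat \<Rightarrow> 'a \<Rightarrow> nat \<Rightarrow> real" and I :: "nat \<Rightarrow> nat set"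
    and c :: "'m::finite \<Rightarrow> nat \<Rightarrow> nat set \<Rightarrow> real" and d :: "'m \<Rightarrow> nat" and V :: "real ^ 'm ^ 'm"
  assumes finite_I: "finite (I n)"
    and \<xi>_measurable: "\<xi> n \<in> measurable M (gauss (I n))"
    and \<xi>_law: "distr M (gauss (I n)) (\<xi> n) = gauss (I n)"
    and hom: "homogeneous (d j) (c j n)"
    and d_pos: "1 \<le> d j"
    and V_psd: "nonneg_symmetric V"
    and V_diag: "V $ j $ j \<noteq> 0"
    and covariance: "(\<lambda>n. inner_coeff (I n) (c i n) (c j n)) \<longlonglongrightarrow> V $ i $ j"
begin

definition Q :: "'m \<Rightarrow> nat \<Rightarrow> 'a \<Rightarrow> real" where
  "Q j n \<omega> = multilin (I n) (c j n) (\<xi> n \<omega>)"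

abbreviation contr_norm :: "'m \<Rightarrow> nat \<Rightarrow> nat \<Rightarrow> real" where
  "contr_norm j r n \<equiv> sqnorm (I n) (contr (I n) r (c j n) (c j n))"

lemma integral_\<xi>:
  fixes \<phi> :: "(nat \<Rightarrow> real) \<Rightarrow> 'b::{banach, second_countable_topology}"
  assumes "\<phi> \<in> borel_measurable (gauss (I n))"
  shows "(LINT \<omega>|M. \<phi> (\<xi> n \<omega>)) = (LINT x|gauss (I n). \<phi> x)"
  using integral_distr[OF \<xi>_measurable assms] by (simp add: \<xi>_law)

lemma multilin_moments: "all_moments (gauss (I n)) (multilin (I n) (c j n))"
  using finite_I by (intro all_moments_multilin) auto

lemma all_moments_Q: "all_moments M (Q j n)"
  unfolding all_moments_def
proof (intro conjI allI)
  note [measurable] = \<xi>_measurable all_moments_measurable[OF multilin_moments]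
  show "Q j n \<in> borel_measurable M" unfolding Q_def[abs_def] by measurable
  fix k
  have "integrable (distr M (gauss (I n)) (\<xi> n)) (\<lambda>x. \<bar>multilin (I n) (c j n) x\<bar> ^ k)"
    using multilin_moments[of n j] unfolding \<xi>_law all_moments_def by blast
  then show "integrable M (\<lambda>\<omega>. \<bar>Q j n \<omega>\<bar> ^ k)"
    unfolding Q_def by (subst (asm) integrable_distr_eq) auto
qed

lemma moment_Q: "(LINT \<omega>|M. Q j n \<omega> ^ k) = (LINT x|gauss (I n). multilin (I n) (c j n) x ^ k)"
  unfolding Q_def by (rule integral_\<xi>) (intro all_moments_measurable gauss_power multilin_moments)

lemma second_moment_Q: "(LINT \<omega>|M. (Q j n \<omega>)\<^sup>2) = inner_coeff (I n) (c j n) (c j n)"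
  unfolding moment_Q unfolding power2_eq_square by (rule integral_multilin_mult[OF finite_I])

lemma fourth_moments_imp_contractions:
  assumes m4: "(\<lambda>n. LINT \<omega>|M. Q j n \<omega> ^ 4) \<longlonglongrightarrow> 3 * (V $ j $ j)\<^sup>2" and r: "1 \<le> r" "r < d j"
  shows "(\<lambda>n. contr_norm j r n) \<longlonglongrightarrow> 0"
proof (rule tendsto_sandwich)
  let ?v = "\<lambda>n. inner_coeff (I n) (c j n) (c j n)"
  show "\<forall>\<^sub>F n in sequentially. 0 \<le> contr_norm j r n" by (simp add: sqnorm_nonneg)
  show "\<forall>\<^sub>F n in sequentially. contr_norm j r n \<le> (LINT \<omega>|M. Q j n \<omega> ^ 4) - 3 * (?v n)\<^sup>2"
  proof (rule always_eventually, rule allI)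
    fix n
    have "contr_norm j r n \<le> (\<Sum>r\<in>{1..<d j}. contr_norm j r n)"
      using r by (intro member_le_sum) (auto simp: sqnorm_nonneg)
    then show "contr_norm j r n \<le> (LINT \<omega>|M. Q j n \<omega> ^ 4) - 3 * (?v n)\<^sup>2"
      using fourth_moment_lower_bound[OF finite_I[of n] hom[of j n] d_pos] unfolding moment_Q by linarith
  qed
  have "(\<lambda>n. (LINT \<omega>|M. Q j n \<omega> ^ 4) - 3 * (?v n)\<^sup>2) \<longlonglongrightarrow> 3 * (V $ j $ j)\<^sup>2 - 3 * (V $ j $ j)\<^sup>2"
    by (intro tendsto_intros m4 covariance)
  then show "(\<lambda>n. (LINT \<omega>|M. Q j n \<omega> ^ 4) - 3 * (?v n)\<^sup>2) \<longlonglongrightarrow> 0" by simp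
qed simp

text \<open>
  A mixed contraction of order \<open>r\<close> is bounded by contractions of orders \<open>d i - r\<close> and \<open>d j - r\<close>.
  At most one of these orders is zero; that factor is only bounded, but the other one tends to zero.
\<close>
lemma carre_du_champ_concentrates:
  assumes contr0: "\<And>j r. 1 \<le> r \<Longrightarrow> r < d j \<Longrightarrow> (\<lambda>n. contr_norm j r n) \<longlonglongrightarrow> 0"
  shows "(\<lambda>n. LINT x|gauss (I n). (carre_du_champ (I n) (c i n) (c j n) x - d i * inner_coeff (I n) (c i n) (c j n))\<^sup>2) \<longlonglongrightarrow> 0"
proof (rule tendsto_sandwich)
  let ?R = "{r. 1 \<le> r \<and> r \<le> d i \<and> r \<le> d j \<and> \<not> (r = d i \<and> r = d j)}"
  let ?b = "\<lambda>n. \<Sum>r\<in>?R. (real r)\<^sup>2 * 2 ^ (d i + d j) * sqnorm (I n) (contr (I n) r (c i n) (c j n))"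
  show "\<forall>\<^sub>F n in sequentially. 0 \<le> (LINT x|gauss (I n). (carre_du_champ (I n) (c i n) (c j n) x - d i * inner_coeff (I n) (c i n) (c j n))\<^sup>2)"
    by (intro always_eventually allI Bochner_Integration.integral_nonneg) simp
  show "\<forall>\<^sub>F n in sequentially. (LINT x|gauss (I n). (carre_du_champ (I n) (c i n) (c j n) x - d i * inner_coeff (I n) (c i n) (c j n))\<^sup>2) \<le> ?b n"
    by (intro always_eventually allI carre_du_champ_variance finite_I hom d_pos)
  have lim: "(\<lambda>n. contr_norm j s n) \<longlonglongrightarrow> (if s = 0 then (V $ j $ j)\<^sup>2 else 0)" if "s < d j" for s j
  proof (cases "s = 0")
    case True
    then show ?thesis using covariance[of j j] by (simp add: sqnorm_contr_0[OF finite_I] tendsto_power)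
  next
    case False
    then show ?thesis using contr0[of s j] that by simp
  qed
  have "(\<lambda>n. sqnorm (I n) (contr (I n) r (c i n) (c j n))) \<longlonglongrightarrow> 0" if r: "r \<in> ?R" for r
  proof (rule tendsto_sandwich)
    show "\<forall>\<^sub>F n in sequentially. 0 \<le> sqnorm (I n) (contr (I n) r (c i n) (c j n))" by (simp add: sqnorm_nonneg)
    show "\<forall>\<^sub>F n in sequentially. sqnorm (I n) (contr (I n) r (c i n) (c j n)) \<le> sqrt (contr_norm i (d i - r) n * contr_norm j (d j - r) n)"
      using r by (intro always_eventually allI real_le_rsqrt sqnorm_contr_mixed_le finite_I hom) auto
    have "(\<lambda>n. sqrt (contr_norm i (d i - r) n * contr_norm j (d j - r) n))
      \<longlonglongrightarrow> sqrt ((if d i - r = 0 then (V $ i $ i)\<^sup>2 else 0) * (if d j - r = 0 then (V $ j $ j)\<^sup>2 else 0))"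
      using r by (intro tendsto_intros lim) auto
    also have "(if d i - r = 0 then (V $ i $ i)\<^sup>2 else 0) * (if d j - r = 0 then (V $ j $ j)\<^sup>2 else 0) = 0"
      using r by auto
    finally show "(\<lambda>n. sqrt (contr_norm i (d i - r) n * contr_norm j (d j - r) n)) \<longlonglongrightarrow> 0" by simp
  qed simp
  then have "?b \<longlonglongrightarrow> (\<Sum>r\<in>?R. (real r)\<^sup>2 * 2 ^ (d i + d j) * 0)"
    by (intro tendsto_sum tendsto_mult_left)
  then show "?b \<longlonglongrightarrow> 0" by simp
qed simp

lemma second_moment_bounded: "\<exists>K. \<forall>n j. inner_coeff (I n) (c j n) (c j n) \<le> K"
proof -
  have "\<exists>K. \<forall>n. inner_coeff (I n) (c j n) (c j n) \<le> K" for j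
  proof -
    have "Bseq (\<lambda>n. inner_coeff (I n) (c j n) (c j n))"
      by (rule convergent_imp_Bseq) (use covariance[of j j] in \<open>auto simp: convergent_def\<close>)
    then show ?thesis unfolding Bseq_def by (metis abs_le_iff real_norm_def)
  qed
  then obtain K where K: "\<And>n j. inner_coeff (I n) (c j n) (c j n) \<le> K j" by metis
  have "K j \<le> Max (range K)" for j by (intro Max_ge) auto
  then show ?thesis using K order_trans by blast
qed

lemma contractions_imp_law:
  assumes contr0: "\<And>j r. 1 \<le> r \<Longrightarrow> r < d j \<Longrightarrow> (\<lambda>n. contr_norm j r n) \<longlonglongrightarrow> 0"
  shows "\<exists>\<mu>. centered_gaussian_law V \<mu> \<and> converges_in_law M (\<lambda>n \<omega>. \<chi> j. Q j n \<omega>) \<mu>"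
proof -
  obtain \<mu> where \<mu>: "centered_gaussian_law V \<mu>"
    and char\<mu>: "\<And>a. (CLINT x|\<mu>. iexp (a \<bullet> x)) = complex_of_real (exp (- (a \<bullet> (V *v a)) / 2))"
    and int\<mu>: "\<And>j. integrable \<mu> (\<lambda>x. (x $ j)\<^sup>2)"
    using centered_gaussian_law_exists[OF V_psd] by blast
  obtain K where K: "\<And>n j. inner_coeff (I n) (c j n) (c j n) \<le> K" using second_moment_bounded by blast
  define C where "C = max K (Max (range (\<lambda>j. V $ j $ j)))"
  have VC: "V $ j $ j \<le> C" for j unfolding C_def by (intro max.coboundedI2 Max_ge) auto
  have "converges_in_law M (\<lambda>n \<omega>. \<chi> j. Q j n \<omega>) \<mu>"
  proof (rule converges_in_law_of_char[where C=C])
    show "prob_space M" by unfold_locales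
    show "prob_space \<mu>" "sets \<mu> = sets borel" using \<mu> by (auto simp: centered_gaussian_law_def)
    show "(\<lambda>\<omega>. \<chi> j. Q j n \<omega>) \<in> borel_measurable M" for n
      by (intro measurable_vec_lambda all_moments_measurable all_moments_Q)
    show "integrable M (\<lambda>\<omega>. ((\<chi> j. Q j n \<omega>) $ j)\<^sup>2)" for n j
      by (simp add: all_moments_integrable all_moments_power all_moments_Q)
    show "(LINT \<omega>|M. ((\<chi> j. Q j n \<omega>) $ j)\<^sup>2) \<le> C" for n j
      using K[of n j] by (simp add: second_moment_Q C_def le_max_iff_disj)
    show "integrable \<mu> (\<lambda>x. (x $ j)\<^sup>2)" for j by (rule int\<mu>)
    show "(LINT x|\<mu>. (x $ j)\<^sup>2) \<le> C" for j
      using \<mu> VC[of j] by (simp add: centered_gaussian_law_def power2_eq_square)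
    fix a :: "real ^ 'm"
    let ?bound = "\<lambda>n. \<Sum>i\<in>UNIV. \<Sum>j\<in>UNIV. \<bar>a $ i * a $ j\<bar> *
         (sqrt (LINT x|gauss (I n). (carre_du_champ (I n) (c i n) (c j n) x - d i * inner_coeff (I n) (c i n) (c j n))\<^sup>2)
          + \<bar>inner_coeff (I n) (c i n) (c j n) - V $ i $ j\<bar>)"
    have q: "0 \<le> a \<bullet> (V *v a)" using V_psd by (simp add: nonneg_symmetric_def)
    have le: "norm ((CLINT \<omega>|M. iexp (a \<bullet> (\<chi> j. Q j n \<omega>))) - (CLINT x|\<mu>. iexp (a \<bullet> x))) \<le> ?bound n" for n
    proof -
      have "(CLINT \<omega>|M. iexp (a \<bullet> (\<chi> j. Q j n \<omega>)))
         = (CLINT \<omega>|M. iexp (\<Sum>j\<in>UNIV. a $ j * multilin (I n) (c j n) (\<xi> n \<omega>)))"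
        by (simp add: inner_vec_def Q_def)
      also have "\<dots> = (CLINT x|gauss (I n). iexp (\<Sum>j\<in>UNIV. a $ j * multilin (I n) (c j n) x))"
      proof (rule integral_\<xi>)
        note [measurable] = all_moments_measurable[OF multilin_moments]
        show "(\<lambda>x. iexp (\<Sum>j\<in>UNIV. a $ j * multilin (I n) (c j n) x)) \<in> borel_measurable (gauss (I n))"
          by measurable
      qed
      finally show ?thesis
        using char_function_multilin_bound[OF finite_I[of n] finite hom[of _ n] d_pos, where J=UNIV and a="\<lambda>j. a $ j" and V="\<lambda>i j. V $ i $ j"] q
        unfolding char\<mu> inner_matrix_vector by simp
    qed
    have "?bound \<longlonglongrightarrow> (\<Sum>i\<in>UNIV. \<Sum>j\<in>UNIV. \<bar>a $ i * a $ j\<bar> * (sqrt 0 + \<bar>V $ i $ j - V $ i $ j\<bar>))"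
      by (intro tendsto_intros carre_du_champ_concentrates contr0 covariance)
    then have lim: "?bound \<longlonglongrightarrow> 0" by simp
    have "(\<lambda>n. (CLINT \<omega>|M. iexp (a \<bullet> (\<chi> j. Q j n \<omega>))) - (CLINT x|\<mu>. iexp (a \<bullet> x))) \<longlonglongrightarrow> 0"
      by (rule Lim_null_comparison[OF always_eventually[OF allI[OF le]] lim])
    then show "(\<lambda>n. CLINT \<omega>|M. iexp (a \<bullet> (\<chi> j. Q j n \<omega>))) \<longlonglongrightarrow> (CLINT x|\<mu>. iexp (a \<bullet> x))"
      by (simp add: LIM_zero_iff)
  qed
  with \<mu> show ?thesis by blast
qed

lemma law_imp_fourth_moments:
  assumes \<mu>: "centered_gaussian_law V \<mu>" and law: "converges_in_law M (\<lambda>n \<omega>. \<chi> j. Q j n \<omega>) \<mu>"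
  shows "(\<lambda>n. LINT \<omega>|M. Q j n \<omega> ^ 4) \<longlonglongrightarrow> 3 * (V $ j $ j)\<^sup>2"
proof -
  obtain \<sigma> where \<sigma>: "0 < \<sigma>" "\<sigma>\<^sup>2 = V $ j $ j" "distr \<mu> borel (\<lambda>x. x $ j) = density lborel (normal_density 0 \<sigma>)"
    by (rule centered_gaussian_law_coordinate[OF \<mu> V_diag])
  let ?\<nu> = "density lborel (normal_density 0 \<sigma>)"
  obtain K where K: "\<And>n j. inner_coeff (I n) (c j n) (c j n) \<le> K" using second_moment_bounded by blast
  have sets_\<mu>: "sets \<mu> = sets borel" using \<mu> by (simp add: centered_gaussian_law_def)
  have comp: "(\<lambda>x :: real ^ 'm. x $ j) \<in> borel_measurable \<mu>"
    unfolding measurable_cong_sets[OF sets_\<mu> refl]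
    by (intro borel_measurable_continuous_onI continuous_intros)
  have "(\<lambda>n. LINT \<omega>|M. Q j n \<omega> ^ 4) \<longlonglongrightarrow> (LINT y|?\<nu>. y ^ 4)"
  proof (rule fourth_moment_convergence[where C="max (125 ^ d j * K ^ 3) (LINT y|?\<nu>. y ^ 6)"])
    show "prob_space M" by unfold_locales
    show "prob_space ?\<nu>" using \<sigma>(1) by (rule prob_space_normal_density)
    show "all_moments M (Q j n)" for n by (rule all_moments_Q)
    show "all_moments ?\<nu> (\<lambda>y. y)" by (rule normal_law_moments[OF \<sigma>(1)])
    show "(LINT \<omega>|M. Q j n \<omega> ^ 6) \<le> max (125 ^ d j * K ^ 3) (LINT y|?\<nu>. y ^ 6)" for n
    proof -
      have "(LINT \<omega>|M. Q j n \<omega> ^ 6) \<le> 125 ^ d j * inner_coeff (I n) (c j n) (c j n) ^ 3"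
        unfolding moment_Q using hom[of j n] by (intro sixth_moment_bound finite_I) (auto simp: homogeneous_def)
      also have "\<dots> \<le> 125 ^ d j * K ^ 3"
        by (intro mult_left_mono power_mono K inner_coeff_nonneg) simp
      finally show ?thesis by simp
    qed
    fix h :: "real \<Rightarrow> real" assume h: "continuous_on UNIV h" "bounded (range h)"
    have "continuous_on UNIV (\<lambda>x :: real ^ 'm. h (x $ j))"
      by (intro continuous_on_compose2[OF h(1)] continuous_intros) auto
    moreover have "bounded (range (\<lambda>x :: real ^ 'm. h (x $ j)))"
      using h(2) by (rule bounded_subset) auto
    ultimately have "(\<lambda>n. LINT \<omega>|M. h ((\<chi> j. Q j n \<omega>) $ j)) \<longlonglongrightarrow> (LINT x|\<mu>. h (x $ j))"
      using law unfolding converges_in_law_def by blast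
    moreover have "(LINT x|\<mu>. h (x $ j)) = (LINT y|?\<nu>. h y)"
      unfolding \<sigma>(3)[symmetric] by (rule integral_distr[OF comp, symmetric]) (rule borel_measurable_continuous_onI[OF h(1)])
    ultimately show "(\<lambda>n. LINT \<omega>|M. h (Q j n \<omega>)) \<longlonglongrightarrow> (LINT y|?\<nu>. h y)" by simp
  qed simp_all
  then show ?thesis by (simp add: normal_law_moments[OF \<sigma>(1)] \<sigma>(2))
qed

lemma equivalences:
  defines "law \<equiv> \<exists>\<mu>. centered_gaussian_law V \<mu> \<and> converges_in_law M (\<lambda>n \<omega>. \<chi> j. Q j n \<omega>) \<mu>"
    and "moments \<equiv> \<forall>j. (\<lambda>n. LINT \<omega>|M. Q j n \<omega> ^ 4) \<longlonglongrightarrow> 3 * (V $ j $ j)\<^sup>2"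
    and "contractions \<equiv> \<forall>j. \<forall>r\<in>{1..d j - 1}. (\<lambda>n. contr_norm j r n) \<longlonglongrightarrow> 0"
  shows "(law \<longleftrightarrow> moments) \<and> (moments \<longleftrightarrow> contractions)"
proof -
  have "law \<Longrightarrow> moments" unfolding law_def moments_def using law_imp_fourth_moments by blast
  moreover have "contractions" if moments
    unfolding contractions_def
  proof (intro allI ballI)
    fix j r assume "r \<in> {1..d j - 1}"
    then have "1 \<le> r" "r < d j" using d_pos[of j] by auto
    then show "(\<lambda>n. contr_norm j r n) \<longlonglongrightarrow> 0"
      using that fourth_moments_imp_contractions unfolding moments_def by blast
  qed
  moreover have "law" if contractions
    unfolding law_def
    by (rule contractions_imp_law) (use that in \<open>auto simp: contractions_def\<close>)
  ultimately show ?thesis by blast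
qed

end

lemma distr_restrict_gauss:
  assumes "prob_space M" and indep: "prob_space.indep_vars M (\<lambda>_. borel) G {1..}"
    and dist: "\<And>i. i \<ge> 1 \<Longrightarrow> distributed M lborel (G i) (\<lambda>x. ennreal (std_normal_density x))"
    and I: "I \<noteq> {}" "I \<subseteq> {1..}"
  shows "(\<lambda>\<omega>. \<lambda>i\<in>I. G i \<omega>) \<in> measurable M (gauss I)"
    "distr M (gauss I) (\<lambda>\<omega>. \<lambda>i\<in>I. G i \<omega>) = gauss I"
proof -
  interpret prob_space M by fact
  have G [measurable]: "G i \<in> borel_measurable M" if "i \<in> I" for i
    using distributed_measurable[OF dist, of i] I that by auto
  have "(\<lambda>\<omega>. \<lambda>i\<in>I. G i \<omega>) \<in> measurable M (PiM I (\<lambda>_. borel))"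
    by (intro measurable_restrict G)
  then show "(\<lambda>\<omega>. \<lambda>i\<in>I. G i \<omega>) \<in> measurable M (gauss I)"
    by (simp add: measurable_cong_sets[OF refl sets_gauss])
  have "indep_vars (\<lambda>_. borel) G I"
    using indep I(2) by (rule indep_vars_subset)
  then have "distr M (PiM I (\<lambda>_. borel)) (\<lambda>\<omega>. \<lambda>i\<in>I. G i \<omega>) = PiM I (\<lambda>i. distr M borel (G i))"
    using I(1) G by (subst (asm) indep_vars_iff_distr_eq_PiM') auto
  also have "\<dots> = gauss I"
    unfolding gauss_def
  proof (rule PiM_cong[OF refl])
    fix i assume "i \<in> I"
    then have "distr M lborel (G i) = std_normal_distribution"
      using dist[of i] I by (auto simp: distributed_def)
    moreover have "distr M lborel (G i) = distr M borel (G i)" by (rule distr_cong) auto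
    ultimately show "distr M borel (G i) = std_normal_distribution" by simp
  qed
  finally show "distr M (gauss I) (\<lambda>\<omega>. \<lambda>i\<in>I. G i \<omega>) = gauss I"
    by (subst distr_cong[OF refl sets_gauss refl])
qed

theorem proposition1p6:
  fixes M :: "'a measure"
    and G :: "nat \<Rightarrow> 'a \<Rightarrow> real"
    and d :: "'m::finite \<Rightarrow> nat"
    and N :: "'m \<Rightarrow> nat \<Rightarrow> nat"
    and f :: "'m \<Rightarrow> nat \<Rightarrow> nat list \<Rightarrow> real"
    and V :: "real ^ 'm ^ 'm"
  defines "Q \<equiv> \<lambda>j n. homogeneous_sum (d j) (N j n) (f j n) G"
  assumes "prob_space M"
    and "prob_space.indep_vars M (\<lambda>_. borel) G {1..}"
    and "\<And>i. i \<ge> 1 \<Longrightarrow> distributed M lborel (G i) (\<lambda>x. ennreal (std_normal_density x))"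
    and "\<And>j. d j \<ge> 2"
    and "\<And>j. filterlim (N j) at_top sequentially"
    and "\<And>j n. n \<ge> 1 \<Longrightarrow> symmetric_on_tuples (N j n) (d j) (f j n)"
    and "\<And>j n. n \<ge> 1 \<Longrightarrow> vanishes_on_diagonals (N j n) (d j) (f j n)"
    and "\<And>j. bounded ((\<lambda>n. \<integral>\<omega>. (Q j n \<omega>)\<^sup>2 \<partial>M) ` {1..})"
    and "nonneg_symmetric V"
    and "\<And>i. V $ i $ i \<noteq> 0"
    and "\<And>i j. (\<lambda>n. \<integral>\<omega>. Q i n \<omega> * Q j n \<omega> \<partial>M) \<longlonglongrightarrow> V $ i $ j"
  defines "cond1 \<equiv> \<exists>\<mu>. centered_gaussian_law V \<mu> \<and>
                        converges_in_law M (\<lambda>n \<omega>. \<chi> j. Q j n \<omega>) \<mu>"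
    and "cond2 \<equiv> \<forall>j. (\<lambda>n. \<integral>\<omega>. (Q j n \<omega>) ^ 4 \<partial>M) \<longlonglongrightarrow> 3 * (V $ j $ j)\<^sup>2"
    and "cond3 \<equiv> \<forall>j. \<forall>r\<in>{1..d j - 1}.
            (\<lambda>n. tuple_norm (2 * d j - 2 * r) (N j n) (contraction (d j) (N j n) r (f j n)))
              \<longlonglongrightarrow> 0"
  shows "(cond1 \<longleftrightarrow> cond2) \<and> (cond2 \<longleftrightarrow> cond3)"
proof -
  \<comment> \<open>One index set serves all components; the successor makes it nonempty. The index \<open>n\<close> is shifted because the hypotheses on \<open>f j n\<close> start at \<open>n = 1\<close>, which does not affect limits.\<close>
  define I where "I n = {1..Suc (Max (range (\<lambda>j. N j (Suc n))))}" for n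
  define c where "c j n = tuple_coeff (N j (Suc n)) (d j) (f j (Suc n))" for j n
  define \<xi> where "\<xi> n \<omega> = (\<lambda>i\<in>I n. G i \<omega>)" for n \<omega>
  have I: "finite (I n)" "I n \<noteq> {}" "I n \<subseteq> {1..}" for n by (auto simp: I_def)
  have NI: "{1..N j (Suc n)} \<subseteq> I n" for j n
  proof -
    have "N j (Suc n) \<le> Max (range (\<lambda>j. N j (Suc n)))" by (rule Max_ge) auto
    then show ?thesis unfolding I_def
      by (intro atLeastatMost_subset_iff[THEN iffD2] disjI2 conjI le_SucI order_refl)
  qed
  have sym: "symmetric_on_tuples (N j (Suc n)) (d j) (f j (Suc n))"
    and diag: "vanishes_on_diagonals (N j (Suc n)) (d j) (f j (Suc n))" for j n
    using assms(7,8) by auto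
  have Q: "Q j (Suc n) \<omega> = multilin (I n) (c j n) (\<xi> n \<omega>)" for j n \<omega>
    unfolding Q_def c_def \<xi>_def by (rule homogeneous_sum_multilin[OF sym diag I(1) NI])
  have \<xi>: "\<xi> n \<in> measurable M (gauss (I n))" "distr M (gauss (I n)) (\<xi> n) = gauss (I n)" for n
    unfolding \<xi>_def[abs_def]
    by (rule distr_restrict_gauss[OF assms(2,3)]; (rule I | erule assms(4)))+
  have mom: "all_moments (gauss (I n)) (multilin (I n) (c j n))" for j n
    by (rule all_moments_multilin[OF I(1)]) simp
  have inner: "(\<integral>\<omega>. Q i (Suc n) \<omega> * Q j (Suc n) \<omega> \<partial>M) = inner_coeff (I n) (c i n) (c j n)" for i j n
  proof -
    have "(\<integral>\<omega>. Q i (Suc n) \<omega> * Q j (Suc n) \<omega> \<partial>M)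
        = (LINT x|distr M (gauss (I n)) (\<xi> n). multilin (I n) (c i n) x * multilin (I n) (c j n) x)"
      unfolding Q by (rule integral_distr[OF \<xi>(1), symmetric]) (intro all_moments_measurable all_moments_mult mom)
    then show ?thesis by (simp add: \<xi>(2) integral_multilin_mult[OF I(1)])
  qed
  interpret prob_space M by fact
  interpret C: chaos_vectors M \<xi> I c d V
  proof
    show "finite (I n)" for n by (rule I)
    show "\<xi> n \<in> measurable M (gauss (I n))" "distr M (gauss (I n)) (\<xi> n) = gauss (I n)" for n by (rule \<xi>)+
    show "homogeneous (d j) (c j n)" for j n unfolding c_def by (rule homogeneous_tuple_coeff)
    show "1 \<le> d j" for j using assms(5)[of j] by simp
    show "nonneg_symmetric V" "V $ j $ j \<noteq> 0" for j by (fact assms)+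
    show "(\<lambda>n. inner_coeff (I n) (c i n) (c j n)) \<longlonglongrightarrow> V $ i $ j" for i j
      using assms(12)[of i j, THEN LIMSEQ_Suc] unfolding inner .
  qed
  have CQ: "C.Q j n = Q j (Suc n)" for j n by (rule ext) (simp add: C.Q_def Q)
  have cond1: "cond1 \<longleftrightarrow> (\<exists>\<mu>. centered_gaussian_law V \<mu> \<and> converges_in_law M (\<lambda>n \<omega>. \<chi> j. C.Q j n \<omega>) \<mu>)"
    unfolding cond1_def converges_in_law_def CQ
    by (subst filterlim_sequentially_Suc[symmetric]) (rule refl)
  have cond2: "cond2 \<longleftrightarrow> (\<forall>j. (\<lambda>n. LINT \<omega>|M. C.Q j n \<omega> ^ 4) \<longlonglongrightarrow> 3 * (V $ j $ j)\<^sup>2)"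
    unfolding cond2_def CQ by (subst filterlim_sequentially_Suc[symmetric]) (rule refl)
  have cond3: "cond3 \<longleftrightarrow> (\<forall>j. \<forall>r\<in>{1..d j - 1}. (\<lambda>n. C.contr_norm j r n) \<longlonglongrightarrow> 0)"
    unfolding cond3_def
  proof (intro all_cong1 ball_cong refl)
    fix j r assume r: "r \<in> {1..d j - 1}"
    define \<kappa> :: real where "\<kappa> = fact r * fact (d j - r) / (fact (d j))\<^sup>2"
    have \<kappa>: "0 < \<kappa>" by (simp add: \<kappa>_def)
    let ?t = "\<lambda>n. tuple_norm (2 * d j - 2 * r) (N j n) (contraction (d j) (N j n) r (f j n))"
    have t: "?t (Suc n) = \<kappa> * sqrt (C.contr_norm j r n)" for n
      unfolding \<kappa>_def c_def by (rule tuple_norm_contraction[OF sym diag I(1) NI]) (use r in auto)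
    have "?t \<longlonglongrightarrow> 0 \<longleftrightarrow> (\<lambda>n. ?t (Suc n)) \<longlonglongrightarrow> 0"
      by (rule filterlim_sequentially_Suc[symmetric])
    also have "\<dots> \<longleftrightarrow> (\<lambda>n. C.contr_norm j r n) \<longlonglongrightarrow> 0"
    proof
      assume "(\<lambda>n. ?t (Suc n)) \<longlonglongrightarrow> 0"
      then have "(\<lambda>n. (?t (Suc n) / \<kappa>)\<^sup>2) \<longlonglongrightarrow> (0 / \<kappa>)\<^sup>2"
        using \<kappa> by (intro tendsto_intros) auto
      then show "(\<lambda>n. C.contr_norm j r n) \<longlonglongrightarrow> 0"
        using \<kappa> by (simp add: t sqnorm_nonneg)
    next
      assume "(\<lambda>n. C.contr_norm j r n) \<longlonglongrightarrow> 0"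
      then have "(\<lambda>n. \<kappa> * sqrt (C.contr_norm j r n)) \<longlonglongrightarrow> \<kappa> * sqrt 0"
        by (intro tendsto_intros)
      then show "(\<lambda>n. ?t (Suc n)) \<longlonglongrightarrow> 0" by (simp add: t)
    qed
    finally show "?t \<longlonglongrightarrow> 0 \<longleftrightarrow> (\<lambda>n. C.contr_norm j r n) \<longlonglongrightarrow> 0" .
  qed
  show ?thesis unfolding cond1 cond2 cond3 by (rule C.equivalences)
qed


end
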